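(* Let $d\ge 2$ and $\tilde m\ge 1$ be integers, let $\Phi:\mathbb{S}^d\times\mathbb{S}^d\to\mathbb{R}$ be a zonal kernel with expansion coefficients $(c_\ell)_{\ell\ge0}$ that is conditionally positive definite of order $\tilde m$, and let $\mathcal{L}=p(\Delta)$ with $p:\sigma(\Delta)\to\mathbb{R}$ such that $\lambda_\ell=p(\nu_\ell)$ grows at most algebraically in $\ell$ and $\sum_{\ell=0}^\infty c_\ell|\lambda_\ell|\ell^{d-1}$ converges absolutely. Let $X\subset\mathbb{S}^d$ be a finite $\Pi_{\tilde m-1}$-unisolvent set with $N$ points, with differentiation matrix $\mathbf{M}_X$ and block decomposition $\mathbf{M}_X=\mathbf{V}\begin{pmatrix}\boldsymbol{\Lambda}&\mathbf{R}\\ \mathbf{0}&\boldsymbol{\Theta}\end{pmatrix}\mathbf{V}^{-1}$ as described in the context. If $\mathbf{M}^\epsilon\in\mathbb{R}^{N\times N}$ and $\mu\in\sigma(\mathbf{M}^\epsilon)$, then $$\mathrm{dist}(\mu,\sigma(\mathbf{M}_X))\le\max\left(2\kappa\|\mathbf{M}_X-\mathbf{M}^\epsilon\|,\ \sqrt{2\kappa\|\mathbf{R}\|\,\|\mathbf{M}_X-\mathbf{M}^\epsilon\|}\right),$$ where $\kappa=\mathrm{cond}(\mathbf{V})=\|\mathbf{V}\|\,\|\mathbf{V}^{-1}\|$.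
   Context: $\mathbb{S}^d\subset\mathbb{R}^{d+1}$ is the unit sphere and $\Delta$ its Laplace-Beltrami operator, with eigenvalues $\nu_\ell=-\ell(\ell+d-1)$, $\ell=0,1,2,\dots$; $\{Y_\ell^\mu\}_{\mu=1}^{N_\ell}$ is an $L_2(\mathbb{S}^d)$-orthonormal basis of real spherical harmonics of degree $\ell$. $\Pi_{k}=\mathrm{span}\{Y_\ell^\mu:\ell\le k,\ \mu\le N_\ell\}$. The operator $\mathcal{L}=p(\Delta)$ acts by $\mathcal{L}Y_\ell^\mu=\lambda_\ell Y_\ell^\mu$ with $\lambda_\ell=p(\nu_\ell)$. A zonal kernel is one with an absolutely and uniformly convergent expansion $\Phi(x,y)=\sum_{\ell=0}^\infty\sum_{\mu\le N_\ell}c_\ell Y_\ell^\mu(x)Y_\ell^\mu(y)$. It is conditionally positive definite of order $\tilde m$ if for every finite set $X=\{x_1,\dots,x_N\}\subset\mathbb{S}^d$ of distinct points, $\mathbf{\Phi}_X=(\Phi(x_j,x_k))_{j,k}$ is strictly positive definite on $\{\alpha\in\mathbb{R}^N:\sum_j\alpha_jp(x_j)=0\ \forall p\in\Pi_{\tilde m-1}\}$. $X$ is $\Pi_{\tilde m-1}$-unisolvent if the only element of $\Pi_{\tilde m-1}$ vanishing on $X$ is $0$. The trial space is $S_X(\Phi)=\{\sum_ja_j\Phi(\cdot,x_j):\sum_ja_jp(x_j)=0\ \forall p\in\Pi_{\tilde m-1}\}+\Pi_{\tilde m-1}$, and $\mathbf{M}_X\in\mathbb{R}^{N\times N}$ is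 the unique matrix with $\mathbf{M}_X(u|_X)=(\mathcal{L}u)|_X$ for all $u\in S_X(\Phi)$. Block decomposition. Let $M=\dim\Pi_{\tilde m-1}$, let $(p_j)_{j\le M}$ enumerate $\{Y_\ell^\mu:\ell<\tilde m\}$, let $\mathbf{P}\in\mathbb{R}^{N\times M}$ have entries $\mathbf{P}_{k,j}=p_j(x_k)$, let $\mathbf{P}^\dagger=(\mathbf{P}^T\mathbf{P})^{-1}\mathbf{P}^T$, and let $\boldsymbol{\Lambda}$ be the $M\times M$ diagonal matrix with $\boldsymbol{\Lambda}_{j,j}=\lambda_\ell$ when $p_j=Y_\ell^\mu$. Let $\mathbf{K}_X=(\mathcal{L}\Phi(x_j,x_k))_{j,k}$ with $\mathcal{L}\Phi(x,y)=\sum_\ell\sum_\mu c_\ell\lambda_\ell Y_\ell^\mu(x)Y_\ell^\mu(y)$. Let $\mathbf{W}\in\mathbb{R}^{N\times(N-M)}$ have orthonormal columns spanning $(\mathrm{range}\,\mathbf{P})^\perp$, let $\mathbf{A}=\mathbf{W}(\mathbf{W}^T\mathbf{\Phi}_X\mathbf{W})^{-1}\mathbf{W}^T$, let $\mathbf{S}=(\mathbf{W}^T\mathbf{\Phi}_X\mathbf{W})^{-1/2}$ (symmetric positive definite), and let $\mathbf{S}\mathbf{W}^T\mathbf{K}_X\mathbf{W}\mathbf{S}=\mathbf{U}\boldsymbol{\Theta}\mathbf{U}^T$ with $\mathbf{U}$ orthogonal and $\boldsymbol{\Theta}$ diagonal. Put $\mathbf{Z}=\mathbf{W}\mathbf{S}^{-1}\mathbf{U}$,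 $\mathbf{V}=(\mathbf{P}\ \ \mathbf{Z})$, and $\mathbf{R}=(\mathbf{P}^\dagger\mathbf{K}_X-\boldsymbol{\Lambda}\mathbf{P}^\dagger\mathbf{\Phi}_X)\mathbf{A}\mathbf{Z}$. Then $\mathbf{V}$ is invertible and $\mathbf{M}_X=\mathbf{V}\begin{pmatrix}\boldsymbol{\Lambda}&\mathbf{R}\\ \mathbf{0}&\boldsymbol{\Theta}\end{pmatrix}\mathbf{V}^{-1}$. $\|\cdot\|$ is the matrix norm induced by the Euclidean vector norm; $\sigma(\cdot)$ denotes the (complex) spectrum and $\mathrm{dist}(\mu,\sigma)=\min_{\lambda\in\sigma}|\mu-\lambda|$. *)

theory Defs
  imports
    "HOL-Analysis.Analysis"
    "HOL-Library.Landau_Symbols"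
    "Jordan_Normal_Form.Gauss_Jordan_Elimination"
    "Jordan_Normal_Form.Spectral_Radius"
begin

unbundle no vec_syntax
hide_const (open) Finite_Cartesian_Product.vec Finite_Cartesian_Product.mat
  Finite_Cartesian_Product.row Finite_Cartesian_Product.column
hide_type (open) Finite_Cartesian_Product.vec

section \<open>Spherical harmonics\<close>

text \<open>The ambient space \<open>\<real>\<^bsup>d+1\<^esup>\<close> is a type of class
  \<^class>\<open>euclidean_space\<close> with \<open>DIM('a) = d + 1\<close>.
  Functions on the sphere are total functions on \<^typ>\<open>'a\<close> of which only the values on
  \<open>sphere 0 1\<close> matter.\<close>

definition laplacian :: "('a::euclidean_space \<Rightarrow> real) \<Rightarrow> 'a \<Rightarrow> real" where
  "laplacian f x = (\<Sum>b\<in>Basis. (deriv ^^ 2) (\<lambda>t. f (x + t *\<^sub>R b)) 0)"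

text \<open>The Laplace-Beltrami operator of the unit sphere: the Euclidean Laplacian of the extension
  that is constant along rays.\<close>

definition laplace_beltrami :: "('a::euclidean_space \<Rightarrow> real) \<Rightarrow> 'a \<Rightarrow> real" where
  "laplace_beltrami f x = laplacian (\<lambda>y. f (y /\<^sub>R norm y)) x"

definition spherical_harmonic :: "nat \<Rightarrow> ('a::euclidean_space \<Rightarrow> real) \<Rightarrow> bool" where
  "spherical_harmonic l f \<longleftrightarrow>
     (\<exists>q. real_polynomial_function q \<and> (\<forall>r x. q (r *\<^sub>R x) = r ^ l * q x) \<and>
          (\<forall>x. laplacian q x = 0) \<and> (\<forall>x\<in>sphere 0 1. f x = q x))"

definition sphere_eigenvalue :: "nat \<Rightarrow> nat \<Rightarrow> real" where
  "sphere_eigenvalue d l = - (real l * (real l + real d - 1))"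

text \<open>\<open>sphere_eigenvalue d l\<close> is indeed the eigenvalue of the Laplace-Beltrami operator on the
  spherical harmonics of degree \<open>l\<close>; a function on the spectrum of that operator is
  represented below by a function \<open>p\<close> on the reals, used at these values only.\<close>

lemma polynomial_line_derivs:
  fixes q :: "'a::euclidean_space \<Rightarrow> real"
  assumes "real_polynomial_function q"
  shows "\<exists>Q1 Q2. \<forall>t. ((\<lambda>t. q (x + t *\<^sub>R b)) has_real_derivative Q1 t) (at t) \<and>
                    (Q1 has_real_derivative Q2 t) (at t)"
proof -
  have "polynomial_function (\<lambda>t::real. x + t *\<^sub>R b)"
    by (intro polynomial_function_add polynomial_function_const polynomial_function_mult polynomial_function_id)
  then have r: "real_polynomial_function (q \<circ> (\<lambda>t::real. x + t *\<^sub>R b))"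
    using assms real_polynomial_function_compose by blast
  obtain Q1 where Q1: "real_polynomial_function Q1"
    "\<And>t. ((q \<circ> (\<lambda>t. x + t *\<^sub>R b)) has_real_derivative Q1 t) (at t)"
    using has_real_derivative_polynomial_function[OF r] by blast
  obtain Q2 where "\<And>t. (Q1 has_real_derivative Q2 t) (at t)"
    using has_real_derivative_polynomial_function[OF Q1(1)] by blast
  with Q1 show ?thesis by (auto simp: o_def)
qed

lemma laplace_beltrami_spherical_harmonic:
  fixes f :: "'a::euclidean_space \<Rightarrow> real"
  assumes f: "spherical_harmonic l f" and x: "x \<in> sphere 0 1" and d: "DIM('a) = d + 1"
  shows "laplace_beltrami f x = sphere_eigenvalue d l * f x"
proof -
  obtain q where q: "real_polynomial_function q" and hom: "\<And>r x. q (r *\<^sub>R x) = r ^ l * q x"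
    and harm: "laplacian q x = 0" and fq: "\<And>x. x \<in> sphere 0 1 \<Longrightarrow> f x = q x"
    using f unfolding spherical_harmonic_def by blast
  have nx: "inner x x = 1" using x by (simp add: dot_square_norm)
  obtain D where D: "(q has_derivative D) (at x)"
    using differentiable_at_real_polynomial_function[OF q] unfolding differentiable_def by blast
  have linD: "linear D" using D by (rule has_derivative_linear)
  have lin_line: "((\<lambda>t. q (x + t *\<^sub>R b)) has_real_derivative D b) (at 0)" for b
  proof -
    have "((\<lambda>t. q (x + t *\<^sub>R b)) has_derivative (\<lambda>t. D (t *\<^sub>R b))) (at 0)"
      by (rule has_derivative_compose[where f = "\<lambda>t. x + t *\<^sub>R b" and g = q])
         (use D in \<open>auto intro!: derivative_eq_intros\<close>)
    then show ?thesis
      unfolding has_field_derivative_def using linD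
      by (simp add: linear_scale mult.commute[of _ "D b"])
  qed
  have euler: "D x = l * q x"
  proof -
    have "((\<lambda>t. q (x + t *\<^sub>R x)) has_real_derivative l * q x) (at 0)"
    proof -
      have "(\<lambda>t. q (x + t *\<^sub>R x)) = (\<lambda>t. (1 + t) ^ l * q x)"
        using hom[of "1 + _" x] by (auto simp: scaleR_add_left)
      then show ?thesis by (auto intro!: derivative_eq_intros)
    qed
    then show ?thesis using lin_line DERIV_unique by blast
  qed
  have D_sum: "(\<Sum>b\<in>Basis. (inner x b) * D b) = D x"
  proof -
    have "D x = D (\<Sum>b\<in>Basis. (inner x b) *\<^sub>R b)" by (simp add: euclidean_representation)
    also have "\<dots> = (\<Sum>b\<in>Basis. (inner x b) * D b)"
      using linD by (simp add: linear_sum linear_scale)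
    finally show ?thesis by simp
  qed
  define m where "m = - real l / 2"
  have second: "(deriv ^^ 2) (\<lambda>t. f ((x + t *\<^sub>R b) /\<^sub>R norm (x + t *\<^sub>R b))) 0 =
      (deriv ^^ 2) (\<lambda>t. q (x + t *\<^sub>R b)) 0 - 2 * l * ((inner x b) * D b)
      + q x * (l * (l + 2) * (inner x b)\<^sup>2 - l)" if b: "b \<in> Basis" for b
  proof -
    obtain Q1 Q2 where Q1: "\<And>t. ((\<lambda>t. q (x + t *\<^sub>R b)) has_real_derivative Q1 t) (at t)"
      and Q2: "\<And>t. (Q1 has_real_derivative Q2 t) (at t)" using polynomial_line_derivs[OF q] by metis
    have Q10: "Q1 0 = D b" using Q1[of 0] lin_line DERIV_unique by blast
    have "deriv (\<lambda>t. q (x + t *\<^sub>R b)) = Q1" using Q1 DERIV_imp_deriv by blast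
    then have Q20: "(deriv ^^ 2) (\<lambda>t. q (x + t *\<^sub>R b)) 0 = Q2 0"
      using Q2 by (simp add: numeral_2_eq_2 DERIV_imp_deriv)
    define s where "s = inner x b"
    define n where "n = (\<lambda>t::real. 1 + 2 * t * s + t\<^sup>2)"
    have n: "(norm (x + t *\<^sub>R b))\<^sup>2 = n t" for t
      unfolding power2_norm_eq_inner using nx b
      by (simp add: inner_simps n_def s_def inner_commute[of b x] inner_same_Basis power2_eq_square distrib_left)
    have npos: "n t > 0" if "\<bar>t\<bar> < 1" for t
    proof -
      have "x + t *\<^sub>R b \<noteq> 0"
      proof
        assume "x + t *\<^sub>R b = 0"
        then have "x = - t *\<^sub>R b" by (simp add: eq_neg_iff_add_eq_0)
        then have "norm x = \<bar>t\<bar>" using b by simp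
        then show False using x that by simp
      qed
      then show ?thesis using n[of t] by (metis zero_less_norm_iff zero_less_power)
    qed
    define G where "G = (\<lambda>t. q (x + t *\<^sub>R b) * n t powr m)"
    define G1 where "G1 = (\<lambda>t. Q1 t * n t powr m + q (x + t *\<^sub>R b) * (m * n t powr (m - 1) * (2 * s + 2 * t)))"
    have FG: "f ((x + t *\<^sub>R b) /\<^sub>R norm (x + t *\<^sub>R b)) = G t" if t: "\<bar>t\<bar> < 1" for t
    proof -
      have pos: "norm (x + t *\<^sub>R b) > 0" using npos[OF t] n[of t] by (metis norm_ge_zero order_le_less power_zero_numeral less_irrefl)
      then have "f ((x + t *\<^sub>R b) /\<^sub>R norm (x + t *\<^sub>R b)) = inverse (norm (x + t *\<^sub>R b)) ^ l * q (x + t *\<^sub>R b)"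
        using fq[of "(x + t *\<^sub>R b) /\<^sub>R norm (x + t *\<^sub>R b)"] hom by simp
      also have "inverse (norm (x + t *\<^sub>R b)) ^ l = n t powr m"
      proof -
        have "n t powr m = ((norm (x + t *\<^sub>R b)) powr 2) powr m" using n pos by (simp add: powr_numeral)
        also have "\<dots> = norm (x + t *\<^sub>R b) powr (- real l)" unfolding powr_powr by (simp add: m_def)
        also have "\<dots> = inverse (norm (x + t *\<^sub>R b)) ^ l" using pos by (simp add: powr_minus powr_realpow power_inverse)
        finally show ?thesis by simp
      qed
      finally show ?thesis by (simp add: G_def)
    qed
    have dn: "(n has_real_derivative (2 * s + 2 * t)) (at t)" for t
      unfolding n_def by (auto intro!: derivative_eq_intros)
    have dnp: "((\<lambda>t. n t powr k) has_real_derivative (k * n t powr (k - 1) * (2 * s + 2 * t))) (at t)" if "\<bar>t\<bar> < 1" for t k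
      using DERIV_powr[OF dn npos[OF that] DERIV_const, of k] npos[OF that]
      by (simp add: powr_diff field_simps)
    have GG1: "(G has_real_derivative G1 t) (at t)" if "\<bar>t\<bar> < 1" for t
      unfolding G_def G1_def by (rule derivative_eq_intros Q1 dnp[OF that] | simp add: algebra_simps)+
    have ev: "\<forall>\<^sub>F s in nhds t. \<bar>s\<bar> < 1" if "\<bar>t\<bar> < 1" for t :: real
      by (rule eventually_nhds_in_open[of "{s. \<bar>s\<bar> < 1}", simplified]) (use that in \<open>auto intro!: open_Collect_less continuous_intros\<close>)
    have d1: "deriv (\<lambda>t. f ((x + t *\<^sub>R b) /\<^sub>R norm (x + t *\<^sub>R b))) t = G1 t" if t: "\<bar>t\<bar> < 1" for t
    proof -
      have "deriv (\<lambda>t. f ((x + t *\<^sub>R b) /\<^sub>R norm (x + t *\<^sub>R b))) t = deriv G t"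
        by (rule deriv_cong_ev[OF eventually_mono[OF ev[OF t]] refl]) (rule FG)
      then show ?thesis using GG1[OF t] DERIV_imp_deriv by metis
    qed
    have "(deriv ^^ 2) (\<lambda>t. f ((x + t *\<^sub>R b) /\<^sub>R norm (x + t *\<^sub>R b))) 0 = deriv G1 0"
      unfolding numeral_2_eq_2 funpow.simps o_def id_def
      by (rule deriv_cong_ev[OF eventually_mono[OF ev] refl]) (auto intro: d1)
    also have "\<dots> = Q2 0 + 2 * (Q1 0 * (m * (2 * s))) + q x * (m * (m - 1) * (2 * s)\<^sup>2 + 2 * m)"
    proof (rule DERIV_imp_deriv)
      have n0: "n 0 = 1" by (simp add: n_def)
      show "(G1 has_real_derivative Q2 0 + 2 * (Q1 0 * (m * (2 * s))) + q x * (m * (m - 1) * (2 * s)\<^sup>2 + 2 * m)) (at 0)"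
        unfolding G1_def
        by (rule derivative_eq_intros Q1 Q2 dnp refl | simp)+
           (simp add: n0 algebra_simps power2_eq_square)
    qed
    finally show ?thesis using Q10 Q20
      by (simp add: m_def s_def power2_eq_square algebra_simps)
  qed
  have sq: "(\<Sum>b\<in>Basis. (inner x b)\<^sup>2) = 1"
    using nx euclidean_inner[of x x] by (simp add: power2_eq_square)
  have "laplace_beltrami f x = laplacian q x - 2 * l * (\<Sum>b\<in>Basis. (inner x b) * D b)
      + q x * (l * (l + 2) * (\<Sum>b\<in>Basis. (inner x b)\<^sup>2) - real DIM('a) * l)"
    unfolding laplace_beltrami_def laplacian_def
    by (subst sum.cong[OF refl second], assumption)
       (simp add: sum.distrib sum_subtractf sum_distrib_left right_diff_distrib distrib_left mult.assoc)
  also have "\<dots> = sphere_eigenvalue d l * q x"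
    unfolding D_sum euler sq harm d by (simp add: sphere_eigenvalue_def algebra_simps)
  finally show ?thesis using fq[OF x] by simp
qed

text \<open>Surface measure, from polar coordinates: the measure of \<open>B\<close> is \<open>DIM('a)\<close> times the volume
  of the part of the unit ball that projects radially into \<open>B\<close>.\<close>

definition sphere_measure :: "'a::euclidean_space measure" where
  "sphere_measure = scale_measure (of_nat DIM('a))
     (distr (restrict_space lborel (ball 0 1 - {0})) (restrict_space borel (sphere 0 1))
            (\<lambda>x. x /\<^sub>R norm x))"

definition sphere_inner :: "('a::euclidean_space \<Rightarrow> real) \<Rightarrow> ('a \<Rightarrow> real) \<Rightarrow> real" where
  "sphere_inner f g = (\<integral>x. f x * g x \<partial>sphere_measure)"

text \<open>\<open>Y l \<mu>\<close> with \<open>\<mu> < Nd l\<close>: an orthonormal family consisting, for each degree \<open>l\<close>, of a basis of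
  the spherical harmonics of degree \<open>l\<close>.\<close>

definition harmonic_basis :: "(nat \<Rightarrow> nat \<Rightarrow> 'a::euclidean_space \<Rightarrow> real) \<Rightarrow> (nat \<Rightarrow> nat) \<Rightarrow> bool" where
  "harmonic_basis Y Nd \<longleftrightarrow>
     (\<forall>l. \<forall>\<mu><Nd l. spherical_harmonic l (Y l \<mu>)) \<and>
     (\<forall>l f. spherical_harmonic l f \<longrightarrow>
        (\<exists>a. \<forall>x\<in>sphere 0 1. f x = (\<Sum>\<mu><Nd l. a \<mu> * Y l \<mu> x))) \<and>
     (\<forall>l l'. \<forall>\<mu><Nd l. \<forall>\<mu>'<Nd l'.
        sphere_inner (Y l \<mu>) (Y l' \<mu>') = (if l = l' \<and> \<mu> = \<mu>' then 1 else 0))"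

definition Pi_space :: "(nat \<Rightarrow> nat \<Rightarrow> 'a::euclidean_space \<Rightarrow> real) \<Rightarrow> (nat \<Rightarrow> nat) \<Rightarrow> nat \<Rightarrow>
    ('a \<Rightarrow> real) set" where
  "Pi_space Y Nd k =
     {f. \<exists>a. \<forall>x\<in>sphere 0 1. f x = (\<Sum>l\<le>k. \<Sum>\<mu><Nd l. a l \<mu> * Y l \<mu> x)}"

text \<open>The operator \<open>p(\<Delta>)\<close>, where \<open>lam l = p (sphere_eigenvalue d l)\<close>: it multiplies the
  degree \<open>l\<close> part of the spherical harmonic expansion by \<open>lam l\<close>.\<close>

definition multiplier_op :: "(nat \<Rightarrow> nat \<Rightarrow> 'a::euclidean_space \<Rightarrow> real) \<Rightarrow> (nat \<Rightarrow> nat) \<Rightarrow>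
    (nat \<Rightarrow> real) \<Rightarrow> ('a \<Rightarrow> real) \<Rightarrow> 'a \<Rightarrow> real" where
  "multiplier_op Y Nd lam f x =
     (\<Sum>l. lam l * (\<Sum>\<mu><Nd l. sphere_inner f (Y l \<mu>) * Y l \<mu> x))"

section \<open>Kernels and trial spaces\<close>

definition zonal_sum :: "(nat \<Rightarrow> nat \<Rightarrow> 'a::euclidean_space \<Rightarrow> real) \<Rightarrow> (nat \<Rightarrow> nat) \<Rightarrow>
    (nat \<Rightarrow> real) \<Rightarrow> 'a \<Rightarrow> 'a \<Rightarrow> real" where
  "zonal_sum Y Nd c x y = (\<Sum>l. \<Sum>\<mu><Nd l. c l * Y l \<mu> x * Y l \<mu> y)"

definition zonal_kernel :: "(nat \<Rightarrow> nat \<Rightarrow> 'a::euclidean_space \<Rightarrow> real) \<Rightarrow> (nat \<Rightarrow> nat) \<Rightarrow>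
    (nat \<Rightarrow> real) \<Rightarrow> ('a \<Rightarrow> 'a \<Rightarrow> real) \<Rightarrow> bool" where
  "zonal_kernel Y Nd c \<Phi> \<longleftrightarrow>
     (\<forall>x\<in>sphere 0 1. \<forall>y\<in>sphere 0 1.
        summable (\<lambda>l. \<Sum>\<mu><Nd l. \<bar>c l * Y l \<mu> x * Y l \<mu> y\<bar>)) \<and>
     uniform_limit (sphere 0 1 \<times> sphere 0 1)
       (\<lambda>n (x, y). \<Sum>l<n. \<Sum>\<mu><Nd l. c l * Y l \<mu> x * Y l \<mu> y) (\<lambda>(x, y). \<Phi> x y) sequentially"

definition kernel_mat :: "('a \<Rightarrow> 'a \<Rightarrow> real) \<Rightarrow> nat \<Rightarrow> (nat \<Rightarrow> 'a) \<Rightarrow> real mat" where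
  "kernel_mat \<Phi> N x = mat N N (\<lambda>(j, k). \<Phi> (x j) (x k))"

definition moment_space :: "('a \<Rightarrow> real) set \<Rightarrow> nat \<Rightarrow> (nat \<Rightarrow> 'a) \<Rightarrow> real vec set" where
  "moment_space Q N x = {\<alpha> \<in> carrier_vec N. \<forall>q\<in>Q. (\<Sum>j<N. \<alpha> $ j * q (x j)) = 0}"

text \<open>Conditional positive definiteness of order \<open>m \<ge> 1\<close> is obtained with
  \<open>Q = Pi_space Y Nd (m - 1)\<close>.\<close>

definition cond_pos_def :: "('a::euclidean_space \<Rightarrow> real) set \<Rightarrow> ('a \<Rightarrow> 'a \<Rightarrow> real) \<Rightarrow> bool" where
  "cond_pos_def Q \<Phi> \<longleftrightarrow>
     (\<forall>N x. inj_on x {..<N} \<and> x ` {..<N} \<subseteq> sphere 0 1 \<longrightarrow>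
        (\<forall>\<alpha>\<in>moment_space Q N x. \<alpha> \<noteq> 0\<^sub>v N \<longrightarrow> \<alpha> \<bullet> (kernel_mat \<Phi> N x *\<^sub>v \<alpha>) > 0))"

definition unisolvent :: "('a::euclidean_space \<Rightarrow> real) set \<Rightarrow> 'a set \<Rightarrow> bool" where
  "unisolvent Q X \<longleftrightarrow> (\<forall>q\<in>Q. (\<forall>x\<in>X. q x = 0) \<longrightarrow> (\<forall>y\<in>sphere 0 1. q y = 0))"

definition trial_space :: "('a::euclidean_space \<Rightarrow> real) set \<Rightarrow> ('a \<Rightarrow> 'a \<Rightarrow> real) \<Rightarrow> nat \<Rightarrow>
    (nat \<Rightarrow> 'a) \<Rightarrow> ('a \<Rightarrow> real) set" where
  "trial_space Q \<Phi> N x =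
     {u. \<exists>\<alpha>\<in>moment_space Q N x. \<exists>q\<in>Q. \<forall>y\<in>sphere 0 1. u y = (\<Sum>j<N. \<alpha> $ j * \<Phi> y (x j)) + q y}"

definition restrict_pts :: "nat \<Rightarrow> (nat \<Rightarrow> 'a) \<Rightarrow> ('a \<Rightarrow> real) \<Rightarrow> real vec" where
  "restrict_pts N x u = vec N (\<lambda>j. u (x j))"

definition differentiation_matrix :: "(('a \<Rightarrow> real) \<Rightarrow> 'a \<Rightarrow> real) \<Rightarrow> ('a \<Rightarrow> real) set \<Rightarrow> nat \<Rightarrow>
    (nat \<Rightarrow> 'a) \<Rightarrow> real mat" where
  "differentiation_matrix L T N x =
     (THE D. D \<in> carrier_mat N N \<and> (\<forall>u\<in>T. D *\<^sub>v restrict_pts N x u = restrict_pts N x (L u)))"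

section \<open>Real matrices\<close>

abbreviation mat_inv :: "real mat \<Rightarrow> real mat" where
  "mat_inv A \<equiv> the (mat_inverse A)"

definition mat_range :: "real mat \<Rightarrow> real vec set" where
  "mat_range A = {A *\<^sub>v v | v. v \<in> carrier_vec (dim_col A)}"

definition sym_pos_def :: "real mat \<Rightarrow> bool" where
  "sym_pos_def A \<longleftrightarrow> square_mat A \<and> A\<^sup>T = A \<and>
     (\<forall>v\<in>carrier_vec (dim_row A). v \<noteq> 0\<^sub>v (dim_row A) \<longrightarrow> v \<bullet> (A *\<^sub>v v) > 0)"

definition euclid_norm :: "real vec \<Rightarrow> real" where
  "euclid_norm v = sqrt (v \<bullet> v)"

text \<open>The unit ball (rather than the unit sphere) makes the norm of a matrix without columns \<open>0\<close>.\<close>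

definition op_norm :: "real mat \<Rightarrow> real" where
  "op_norm A = Sup {euclid_norm (A *\<^sub>v v) | v. v \<in> carrier_vec (dim_col A) \<and> euclid_norm v \<le> 1}"

text \<open>For real matrices \<open>spectrum\<close> would only contain the real eigenvalues.\<close>

definition complex_spectrum :: "real mat \<Rightarrow> complex set" where
  "complex_spectrum A = spectrum (map_mat complex_of_real A)"

end

theory Submission
  imports Defs
begin

text \<open>If \<open>y\<close> is an eigenvector of \<open>M\<^sup>\<epsilon>\<close> for \<open>\<mu>\<close> and \<open>w = V\<^sup>-\<^sup>1 y\<close>, then
  \<open>(\<mu> - T) w = V\<^sup>-\<^sup>1 (M\<^sup>\<epsilon> - M\<^sub>X) V w\<close> for the block triangular matrix \<open>T = V\<^sup>-\<^sup>1 M\<^sub>X V\<close>. Solving this system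
  from the bottom block upwards gives \<open>\<delta>\<^sup>2 \<le> \<kappa> \<parallel>M\<^sub>X - M\<^sup>\<epsilon>\<parallel> (\<delta> + \<parallel>R\<parallel>)\<close> for the distance \<open>\<delta>\<close> of \<open>\<mu>\<close> to the
  diagonal of \<open>T\<close>, and one of the two summands on the right is at least \<open>\<delta>\<^sup>2 / 2\<close>.

  The analytic point is that \<open>M\<^sub>X\<close> maps the values of \<open>\<Sum>\<^sub>j \<alpha>\<^sub>j \<Phi>(\<cdot>, x\<^sub>j) + q\<close> to those of the expected
  combination of \<open>\<L>\<Phi>\<close> and \<open>\<L>q\<close>, for which the series of \<open>\<L>\<Phi>\<close> has to converge pointwise. This needs
  \<open>\<Sum>\<^sub>\<mu> Y\<^sub>\<ell>\<^sup>\<mu>(x)\<^sup>2 = O(\<ell>\<^sup>d\<^sup>-\<^sup>1)\<close>. The left hand side is invariant under reflections, hence a constant multiple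
  of \<open>N\<^sub>\<ell>\<close>; and \<open>N\<^sub>\<ell> = O(\<ell>\<^sup>d\<^sup>-\<^sup>1)\<close> because a harmonic homogeneous polynomial is determined by its Cauchy data on
  a hyperplane, which in turn are determined by their values on a grid of \<open>(\<ell> + 1)\<^sup>d\<^sup>-\<^sup>1\<close> points.\<close>

section \<open>Matrices\<close>

text \<open>The matrix \<open>MX\<close> is a definite description over the trial space, so the
  block decomposition itself has to be proved. A matrix is fixed by its products with
  \<open>P\<close> and \<open>\<Phi>X * W\<close>, whose columns together span: unisolvence makes
  \<open>P\<close> injective, and conditional positive definiteness makes
  \<open>W\<^sup>T * \<Phi>X * W\<close> injective. The block product is compared with the operator
  on these columns only. The operator is given by Fourier coefficients of a whole function, so those
  of the kernel in its first argument are needed; uniform convergence of the zonal series supplies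
  them. Reflections replace rotations because a single one exchanges any two given points of the
  sphere and because it is its own inverse, which makes it easy to change variables. Invariance of
  surface measure is inherited from Lebesgue measure, via uniqueness of translation invariant
  measures.\<close>

lemma wide_matrix_kernel:
  fixes A :: "'a::field mat"
  assumes A: "A \<in> carrier_mat n m" and nm: "n < m"
  obtains v where "v \<in> carrier_vec m" "v \<noteq> 0\<^sub>v m" "A *\<^sub>v v = 0\<^sub>v n"
proof -
  \<comment> \<open>Zero rows make the matrix square. A zero row puts a unit vector into the kernel
    of \<open>B\<^sup>T\<close>, so \<open>det B = 0\<close>, and a kernel vector of
    \<open>B\<close> is one of \<open>A\<close>.\<close>
  define B where "B = mat m m (\<lambda>(i, j). if i < n then A $$ (i, j) else 0)"
  have B: "B \<in> carrier_mat m m" by (simp add: B_def)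
  have "B\<^sup>T *\<^sub>v unit_vec m n = 0\<^sub>v m"
    using nm by (intro eq_vecI) (auto simp: B_def scalar_prod_def unit_vec_def if_distrib cong: if_cong)
  moreover have "unit_vec m n \<noteq> (0\<^sub>v m :: 'a vec)"
    using nm by (auto simp: vec_eq_iff unit_vec_def)
  ultimately have "det (B\<^sup>T) = 0"
    using det_0_iff_vec_prod_zero[of "B\<^sup>T" m] B by (metis transpose_carrier_mat unit_vec_carrier)
  then have "det B = 0" using det_transpose[OF B] by simp
  then obtain v where v: "v \<in> carrier_vec m" "v \<noteq> 0\<^sub>v m" "B *\<^sub>v v = 0\<^sub>v m"
    using det_0_iff_vec_prod_zero[OF B] by blast
  have "A *\<^sub>v v = 0\<^sub>v n"
  proof (intro eq_vecI)
    fix i assume "i < dim_vec (0\<^sub>v n :: 'a vec)"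
    then have i: "i < n" by simp
    have "row A i = row B i" using A i nm by (auto simp: B_def)
    then have "(A *\<^sub>v v) $ i = (B *\<^sub>v v) $ i" using A B i nm by simp
    then show "(A *\<^sub>v v) $ i = 0\<^sub>v n $ i" using v i nm by simp
  qed (use A in auto)
  with v(1,2) show thesis by (rule that)
qed

lemma mat_inverse_the:
  fixes A B :: "'a::field mat"
  assumes "A \<in> carrier_mat n n" "B \<in> carrier_mat n n" "A * B = 1\<^sub>m n"
  shows "the (mat_inverse A) = B"
proof -
  have BA: "B * A = 1\<^sub>m n" using assms by (rule mat_mult_left_right_inverse)
  then have "A \<in> Units (ring_mat TYPE('a) n ())"
    using assms by (auto simp: Units_def ring_mat_def)
  then obtain C where C: "mat_inverse A = Some C" using mat_inverse(1)[OF assms(1)] by fastforce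
  then have "A * C = 1\<^sub>m n" "C \<in> carrier_mat n n" using mat_inverse(2)[OF assms(1)] by auto
  then have "C = B * A * C" using BA by simp
  also have "\<dots> = B" using \<open>A * C = _\<close> \<open>C \<in> _\<close> assms by simp
  finally show ?thesis using C by simp
qed

lemma injective_mat_inverse:
  fixes A :: "'a::field mat"
  assumes A: "A \<in> carrier_mat n n"
    and inj: "\<And>v. v \<in> carrier_vec n \<Longrightarrow> A *\<^sub>v v = 0\<^sub>v n \<Longrightarrow> v = 0\<^sub>v n"
  shows "the (mat_inverse A) \<in> carrier_mat n n" "A * the (mat_inverse A) = 1\<^sub>m n"
    "the (mat_inverse A) * A = 1\<^sub>m n"
proof -
  have "det A \<noteq> 0" using inj det_0_iff_vec_prod_zero[OF A] by blast
  then have "A \<in> Units (ring_mat TYPE('a) n ())"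
    by (rule det_non_zero_imp_unit[OF A])
  then obtain C where C: "mat_inverse A = Some C" using mat_inverse(1)[OF A] by fastforce
  then show "the (mat_inverse A) \<in> carrier_mat n n" "A * the (mat_inverse A) = 1\<^sub>m n"
    "the (mat_inverse A) * A = 1\<^sub>m n"
    using mat_inverse(2)[OF A] by auto
qed

section \<open>Euclidean norms of real and complex vectors, and the operator norm\<close>

lemma euclid_norm_L2: "euclid_norm v = L2_set (\<lambda>i. v $ i) {..<dim_vec v}"
  by (simp add: euclid_norm_def L2_set_def scalar_prod_def power2_eq_square lessThan_atLeast0)

lemma euclid_norm_smult: "euclid_norm (a \<cdot>\<^sub>v v) = \<bar>a\<bar> * euclid_norm v"
  by (simp add: euclid_norm_def real_sqrt_mult flip: mult.assoc)

lemma euclid_norm_nonneg: "0 \<le> euclid_norm v"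
  by (simp add: euclid_norm_L2 L2_set_nonneg)

text \<open>A real supremum carries information only for a set that is bounded above; the sum of the
  absolute values of all entries is a sufficient, crude bound.\<close>

lemma op_norm_bdd:
  assumes "A \<in> carrier_mat nr nc"
  shows "bdd_above {euclid_norm (A *\<^sub>v v) | v. v \<in> carrier_vec (dim_col A) \<and> euclid_norm v \<le> 1}"
proof (rule bdd_aboveI, safe)
  fix v assume v: "v \<in> carrier_vec (dim_col A)" "euclid_norm v \<le> 1"
  have vj: "\<bar>v $ j\<bar> \<le> 1" if "j < nc" for j
  proof -
    have "\<bar>v $ j\<bar> \<le> L2_set (\<lambda>i. \<bar>v $ i\<bar>) {..<nc}"
      using that by (intro member_le_L2_set) auto
    also have "\<dots> = euclid_norm v" using v assms by (simp add: euclid_norm_L2 L2_set_def)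
    finally show ?thesis using v by simp
  qed
  have "euclid_norm (A *\<^sub>v v) \<le> (\<Sum>i<nr. \<bar>(A *\<^sub>v v) $ i\<bar>)"
    unfolding euclid_norm_L2 using assms L2_set_le_sum_abs[of "\<lambda>i. (A *\<^sub>v v) $ i" "{..<nr}"] by simp
  also have "\<dots> \<le> (\<Sum>i<nr. \<Sum>j<nc. \<bar>A $$ (i, j)\<bar>)"
  proof (rule sum_mono)
    fix i assume "i \<in> {..<nr}"
    then have "(A *\<^sub>v v) $ i = (\<Sum>j<nc. A $$ (i, j) * v $ j)"
      using assms v by (auto simp: scalar_prod_def lessThan_atLeast0)
    also have "\<bar>\<dots>\<bar> \<le> (\<Sum>j<nc. \<bar>A $$ (i, j) * v $ j\<bar>)" by (rule sum_abs)
    also have "\<dots> \<le> (\<Sum>j<nc. \<bar>A $$ (i, j)\<bar>)"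
      by (rule sum_mono) (use vj in \<open>auto simp: abs_mult intro: mult_left_le\<close>)
    finally show "\<bar>(A *\<^sub>v v) $ i\<bar> \<le> (\<Sum>j<nc. \<bar>A $$ (i, j)\<bar>)" .
  qed
  finally show "euclid_norm (A *\<^sub>v v) \<le> (\<Sum>i<nr. \<Sum>j<nc. \<bar>A $$ (i, j)\<bar>)" .
qed

lemma op_norm_nonneg:
  assumes "A \<in> carrier_mat nr nc"
  shows "0 \<le> op_norm A"
proof -
  have "euclid_norm (A *\<^sub>v 0\<^sub>v nc) \<le> op_norm A"
    unfolding op_norm_def using assms
    by (intro cSup_upper op_norm_bdd[OF assms]) (auto intro!: exI[of _ "0\<^sub>v nc"] simp: euclid_norm_def)
  then show ?thesis using euclid_norm_nonneg order_trans by blast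
qed

lemma euclid_norm_mult_le:
  assumes A: "A \<in> carrier_mat nr nc" and v: "v \<in> carrier_vec nc"
  shows "euclid_norm (A *\<^sub>v v) \<le> op_norm A * euclid_norm v"
proof (cases "euclid_norm v = 0")
  case True
  then have "(\<Sum>i<nc. (v $ i)\<^sup>2) = 0" using v by (simp add: euclid_norm_L2 L2_set_def)
  then have "\<forall>i<nc. v $ i = 0" by (subst (asm) sum_nonneg_eq_0_iff) auto
  then have "v = 0\<^sub>v nc" using v by auto
  then have "A *\<^sub>v v = 0\<^sub>v nr" using A by auto
  then show ?thesis using True by (simp add: euclid_norm_def)
next
  case False
  define a where "a = inverse (euclid_norm v)"
  have a: "a > 0" using False euclid_norm_nonneg[of v] by (simp add: a_def)
  have "euclid_norm (A *\<^sub>v (a \<cdot>\<^sub>v v)) \<le> op_norm A"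
    unfolding op_norm_def using A v a False
    by (intro cSup_upper op_norm_bdd[OF A])
       (auto intro!: exI[of _ "a \<cdot>\<^sub>v v"] simp: euclid_norm_smult a_def)
  also have "A *\<^sub>v (a \<cdot>\<^sub>v v) = a \<cdot>\<^sub>v (A *\<^sub>v v)" using A v by (simp add: mult_mat_vec)
  finally show ?thesis
    using a by (simp add: euclid_norm_smult a_def field_simps)
qed

definition cvec_norm :: "complex vec \<Rightarrow> real" where
  "cvec_norm v = L2_set (\<lambda>i. cmod (v $ i)) {..<dim_vec v}"

lemma cvec_norm_Re_Im:
  "(cvec_norm v)\<^sup>2 = (euclid_norm (map_vec Re v))\<^sup>2 + (euclid_norm (map_vec Im v))\<^sup>2"
  by (simp add: cvec_norm_def euclid_norm_L2 L2_set_def sum_nonneg cmod_power2 sum.distrib)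

lemma cvec_norm_nonneg: "0 \<le> cvec_norm v"
  by (simp add: cvec_norm_def L2_set_nonneg)

lemma cvec_norm_eq_0_iff: "v \<in> carrier_vec n \<Longrightarrow> cvec_norm v = 0 \<longleftrightarrow> v = 0\<^sub>v n"
  by (auto simp: cvec_norm_def L2_set_eq_0_iff)

text \<open>A real matrix acts separately on real and imaginary parts, and the squared norms of
  these add up. Hence \<open>op_norm\<close>, a supremum over real vectors, also controls the
  complex eigenvectors of non-real eigenvalues.\<close>

lemma cvec_norm_mult_le:
  fixes A :: "real mat"
  assumes A: "A \<in> carrier_mat nr nc" and v: "v \<in> carrier_vec nc"
  shows "cvec_norm (map_mat of_real A *\<^sub>v v) \<le> op_norm A * cvec_norm v"
proof -
  have re: "map_vec Re (map_mat of_real A *\<^sub>v v) = A *\<^sub>v map_vec Re v"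
    and im: "map_vec Im (map_mat of_real A *\<^sub>v v) = A *\<^sub>v map_vec Im v"
    using A v by (auto simp: scalar_prod_def intro!: eq_vecI)
  have "(cvec_norm (map_mat of_real A *\<^sub>v v))\<^sup>2
      \<le> (op_norm A * euclid_norm (map_vec Re v))\<^sup>2 + (op_norm A * euclid_norm (map_vec Im v))\<^sup>2"
    unfolding cvec_norm_Re_Im re im
    by (intro add_mono power_mono euclid_norm_mult_le[OF A] euclid_norm_nonneg) (use v in auto)
  also have "\<dots> = (op_norm A * cvec_norm v)\<^sup>2"
    unfolding power_mult_distrib cvec_norm_Re_Im by (rule distrib_left[symmetric])
  finally show ?thesis
    using op_norm_nonneg[OF A] cvec_norm_nonneg[of v] by (auto intro: power2_le_imp_le)
qed

text \<open>\<open>E\<close> plays the part of the difference between the exact and the perturbed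
  matrix. The conclusion speaks of a diagonal entry of \<open>T\<close>; that such entries are
  eigenvalues is left to \<open>upper_triangular_similar_spectrum\<close>.\<close>

lemma block_triangular_perturbation:
  fixes Lam R \<Theta> T V V' E :: "real mat" and y :: "complex vec" and \<mu> :: complex
  assumes Lam: "Lam \<in> carrier_mat M M" "diagonal_mat Lam"
    and \<Theta>: "\<Theta> \<in> carrier_mat K K" "diagonal_mat \<Theta>"
    and R: "R \<in> carrier_mat M K" and T: "T = four_block_mat Lam R (0\<^sub>m K M) \<Theta>"
    and V: "V \<in> carrier_mat n n" and V': "V' \<in> carrier_mat n n" and VV': "V * V' = 1\<^sub>m n"
    and E: "E \<in> carrier_mat n n" and n: "n = M + K"
    and y: "y \<in> carrier_vec n" "y \<noteq> 0\<^sub>v n"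
    and eig: "map_mat of_real (V * T * V' - E) *\<^sub>v y = \<mu> \<cdot>\<^sub>v y"
  defines "\<kappa> \<equiv> op_norm V * op_norm V'"
  shows "\<exists>i<n. cmod (\<mu> - of_real (T $$ (i, i)))
      \<le> max (2 * \<kappa> * op_norm E) (sqrt (2 * \<kappa> * op_norm R * op_norm E))"
proof -
  let ?C = "map_mat complex_of_real"
  have Tc: "T \<in> carrier_mat n n" using Lam \<Theta> n by (auto simp: T)
  have V'V: "V' * V = 1\<^sub>m n" using mat_mult_left_right_inverse[OF V V' VV'] .
  have C: "?C V \<in> carrier_mat n n" "?C V' \<in> carrier_mat n n" "?C T \<in> carrier_mat n n"
    "?C E \<in> carrier_mat n n" using V V' Tc E by auto
  define w where "w = ?C V' *\<^sub>v y"
  \<comment> \<open>The perturbation applied to the eigenvector, in the coordinates given by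
    \<open>V\<close>: the eigenvector equation becomes \<open>T w - g = \<mu> w\<close>.\<close>
  define g where "g = ?C V' *\<^sub>v (?C E *\<^sub>v (?C V *\<^sub>v w))"
  have w: "w \<in> carrier_vec n" and g: "g \<in> carrier_vec n" using C y by (auto simp: w_def g_def)
  have CV: "?C V * ?C V' = 1\<^sub>m n" "?C V' * ?C V = 1\<^sub>m n"
    using VV' V'V V V' by (metis of_real_hom.mat_hom_mult of_real_hom.mat_hom_one)+
  have Vw: "?C V *\<^sub>v w = y"
    using assoc_mult_mat_vec[OF C(1,2) y(1)] CV y by (simp add: w_def)
  have w0: "w \<noteq> 0\<^sub>v n"
    using Vw C y by auto
  have "?C (V * T * V' - E) = ?C V * ?C T * ?C V' - ?C E"
  proof -
    have "?C (V * T * V' - E) = ?C (V * T * V') - ?C E"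
      using V V' Tc E by (intro eq_matI) auto
    then show ?thesis
      by (simp add: of_real_hom.mat_hom_mult[OF V Tc] of_real_hom.mat_hom_mult[OF mult_carrier_mat[OF V Tc] V']
          del: assoc_mult_mat)
  qed
  then have "(?C V * ?C T * ?C V') *\<^sub>v y - ?C E *\<^sub>v y = \<mu> \<cdot>\<^sub>v y"
    using eig C y by (metis minus_mult_distrib_mat_vec mult_carrier_mat)
  moreover have "(?C V * ?C T * ?C V') *\<^sub>v y = ?C V *\<^sub>v (?C T *\<^sub>v w)"
    using C y by (simp add: w_def assoc_mult_mat_vec[of _ n n _ n])
  ultimately have "?C V *\<^sub>v (?C T *\<^sub>v w) - ?C E *\<^sub>v y = \<mu> \<cdot>\<^sub>v y" by simp
  then have "?C V' *\<^sub>v (?C V *\<^sub>v (?C T *\<^sub>v w) - ?C E *\<^sub>v y) = \<mu> \<cdot>\<^sub>v w"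
    using C y by (simp add: w_def mult_mat_vec)
  then have "?C V' *\<^sub>v (?C V *\<^sub>v (?C T *\<^sub>v w)) - g = \<mu> \<cdot>\<^sub>v w"
    using C w y Vw by (simp add: g_def mult_minus_distrib_mat_vec[of _ n n])
  moreover have "?C V' *\<^sub>v (?C V *\<^sub>v (?C T *\<^sub>v w)) = ?C T *\<^sub>v w"
    using C w CV assoc_mult_mat_vec[OF C(2,1), of "?C T *\<^sub>v w"] by simp
  ultimately have main: "?C T *\<^sub>v w - g = \<mu> \<cdot>\<^sub>v w" by simp
  have gle: "cvec_norm g \<le> \<kappa> * op_norm E * cvec_norm w"
  proof -
    have "cvec_norm g \<le> op_norm V' * cvec_norm (?C E *\<^sub>v (?C V *\<^sub>v w))"
      unfolding g_def using C w by (intro cvec_norm_mult_le[OF V']) simp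
    also have "\<dots> \<le> op_norm V' * (op_norm E * cvec_norm (?C V *\<^sub>v w))"
      using C w by (intro mult_left_mono cvec_norm_mult_le[OF E] op_norm_nonneg[OF V']) simp
    also have "\<dots> \<le> op_norm V' * (op_norm E * (op_norm V * cvec_norm w))"
      using C w by (intro mult_left_mono cvec_norm_mult_le[OF V] op_norm_nonneg[OF V'] op_norm_nonneg[OF E]) simp
    finally show ?thesis by (simp add: \<kappa>_def mult_ac)
  qed
  \<comment> \<open>\<open>w2\<close> is the lower block of \<open>w\<close>, and \<open>r\<close>
    is its coupling through \<open>R\<close> into the upper equations; the lower equations have no
    such term.\<close>
  define w2 where "w2 = vec K (\<lambda>j. w $ (M + j))"
  define r where "r = (\<lambda>i. if i < M then (?C R *\<^sub>v w2) $ i else 0)"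
  have Tw: "(?C T *\<^sub>v w) $ i = of_real (T $$ (i, i)) * w $ i + r i" if i: "i < n" for i
  proof -
    have "(?C T *\<^sub>v w) $ i = (\<Sum>j<M+K. of_real (T $$ (i, j)) * w $ j)"
      using Tc w i n by (simp add: scalar_prod_def lessThan_atLeast0)
    also have "\<dots> = (\<Sum>j<M. of_real (T $$ (i, j)) * w $ j) + (\<Sum>j<K. of_real (T $$ (i, M + j)) * w $ (M + j))"
      by (induction K) (simp_all add: add.assoc)
    also have "\<dots> = of_real (T $$ (i, i)) * w $ i + r i"
    proof (cases "i < M")
      case True
      have "(\<Sum>j<M. of_real (T $$ (i, j)) * w $ j) = (\<Sum>j<M. if j = i then of_real (T $$ (i, i)) * w $ i else 0)"
        using True Lam \<Theta> R by (intro sum.cong) (auto simp: T diagonal_mat_def)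
      moreover have "(\<Sum>j<K. of_real (T $$ (i, M + j)) * w $ (M + j)) = r i"
        using True Lam \<Theta> R by (auto simp: T r_def w2_def scalar_prod_def lessThan_atLeast0)
      ultimately show ?thesis using True by simp
    next
      case False
      have "(\<Sum>j<M. of_real (T $$ (i, j)) * w $ j) = 0"
        using False i n Lam \<Theta> R by (intro sum.neutral) (auto simp: T)
      moreover have "(\<Sum>j<K. of_real (T $$ (i, M + j)) * w $ (M + j)) =
          (\<Sum>j<K. if j = i - M then of_real (T $$ (i, i)) * w $ i else 0)"
        using False i n Lam \<Theta> R by (intro sum.cong) (auto simp: T diagonal_mat_def)
      ultimately show ?thesis using False i n by (simp add: r_def)
    qed
    finally show ?thesis .
  qed
  have comp: "(\<mu> - of_real (T $$ (i, i))) * w $ i = r i - g $ i" if "i < n" for i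
  proof -
    have "(?C T *\<^sub>v w - g) $ i = (\<mu> \<cdot>\<^sub>v w) $ i" using main by simp
    then show ?thesis using Tw[OF that] g w C that by (simp add: algebra_simps)
  qed
  \<comment> \<open>A nonzero vector has a component, so the minimum below is taken over a nonempty
    set.\<close>
  have "n > 0" using y by (cases n) (auto simp: vec_eq_iff)
  define \<delta> where "\<delta> = Min ((\<lambda>i. cmod (\<mu> - of_real (T $$ (i, i)))) ` {..<n})"
  have \<delta>le: "\<delta> \<le> cmod (\<mu> - of_real (T $$ (i, i)))" if "i < n" for i
    using that by (auto simp: \<delta>_def)
  obtain i0 where i0: "i0 < n" "\<delta> = cmod (\<mu> - of_real (T $$ (i0, i0)))"
  proof -
    have "\<delta> \<in> (\<lambda>i. cmod (\<mu> - of_real (T $$ (i, i)))) ` {..<n}"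
      unfolding \<delta>_def by (rule Min_in) (use \<open>n > 0\<close> in auto)
    then show thesis using that by auto
  qed
  have k0: "\<kappa> \<ge> 0" "op_norm E \<ge> 0" "op_norm R \<ge> 0"
    using op_norm_nonneg V V' E R by (auto simp: \<kappa>_def)
  have "\<delta> \<le> max (2 * \<kappa> * op_norm E) (sqrt (2 * \<kappa> * op_norm R * op_norm E))"
  proof (cases "\<delta> = 0")
    case True
    then show ?thesis using k0 by (simp add: le_max_iff_disj)
  next
    case False
    then have pos: "\<delta> > 0" using i0 by simp
    have wle: "\<delta> * cmod (w $ i) \<le> cmod (r i - g $ i)" if "i < n" for i
      using comp[OF that] \<delta>le[OF that]
      by (metis norm_mult mult_right_mono norm_ge_zero)
    \<comment> \<open>In the lower block \<open>r\<close> vanishes, so \<open>w2\<close> is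
      controlled by \<open>g\<close> alone.\<close>
    have "\<delta> * cvec_norm w2 = L2_set (\<lambda>j. \<delta> * cmod (w $ (M + j))) {..<K}"
      using pos by (simp add: cvec_norm_def w2_def L2_set_right_distrib cong: L2_set_cong_simp)
    also have "\<dots> \<le> L2_set (\<lambda>j. cmod (g $ (M + j))) {..<K}"
    proof (rule L2_set_mono)
      fix j assume "j \<in> {..<K}"
      then show "\<delta> * cmod (w $ (M + j)) \<le> cmod (g $ (M + j))"
        using wle[of "M + j"] n by (simp add: r_def)
    qed (use pos in simp)
    also have "\<dots> \<le> cvec_norm g"
    proof -
      have "(\<Sum>j<K. (cmod (g $ (M + j)))\<^sup>2) \<le> (\<Sum>j<M. (cmod (g $ j))\<^sup>2) + (\<Sum>j<K. (cmod (g $ (M + j)))\<^sup>2)"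
        by (simp add: sum_nonneg)
      also have "\<dots> = (\<Sum>j<M+K. (cmod (g $ j))\<^sup>2)" by (induction K) (simp_all add: add.assoc)
      finally show ?thesis using g n by (simp add: cvec_norm_def L2_set_def)
    qed
    finally have w2: "\<delta> * cvec_norm w2 \<le> cvec_norm g" .
    have "\<delta> * cvec_norm w = L2_set (\<lambda>i. \<delta> * cmod (w $ i)) {..<n}"
      using pos w by (simp add: cvec_norm_def L2_set_right_distrib)
    also have "\<dots> \<le> L2_set (\<lambda>i. cmod (g $ i) + cmod (r i)) {..<n}"
    proof (rule L2_set_mono)
      fix i assume "i \<in> {..<n}"
      then show "\<delta> * cmod (w $ i) \<le> cmod (g $ i) + cmod (r i)"
        using wle[of i] norm_triangle_ineq4[of "r i" "g $ i"] by simp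
    qed (use pos in simp)
    also have "\<dots> \<le> L2_set (\<lambda>i. cmod (g $ i)) {..<n} + L2_set (\<lambda>i. cmod (r i)) {..<n}"
      by (rule L2_set_triangle_ineq)
    also have "L2_set (\<lambda>i. cmod (r i)) {..<n} = cvec_norm (?C R *\<^sub>v w2)"
    proof -
      have "(\<Sum>i<n. (cmod (r i))\<^sup>2) = (\<Sum>i<M. (cmod (r i))\<^sup>2)"
        using n by (intro sum.mono_neutral_right) (auto simp: r_def)
      then show ?thesis using R by (simp add: cvec_norm_def L2_set_def r_def)
    qed
    also have "\<dots> \<le> op_norm R * cvec_norm w2"
      by (rule cvec_norm_mult_le[OF R]) (simp add: w2_def)
    also have "L2_set (\<lambda>i. cmod (g $ i)) {..<n} = cvec_norm g" using g by (simp add: cvec_norm_def)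
    finally have "\<delta> * cvec_norm w \<le> cvec_norm g + op_norm R * cvec_norm w2" by simp
    \<comment> \<open>A second factor \<delta> makes the bound for
      \<open>\<delta> * cvec_norm w2\<close> applicable without a division.\<close>
    then have "\<delta> * (\<delta> * cvec_norm w) \<le> \<delta> * cvec_norm g + op_norm R * (\<delta> * cvec_norm w2)"
      using mult_left_mono[of "\<delta> * cvec_norm w" "cvec_norm g + op_norm R * cvec_norm w2" \<delta>] pos
      by (simp add: distrib_left mult.left_commute)
    also have "\<dots> \<le> \<delta> * cvec_norm g + op_norm R * cvec_norm g"
      using w2 k0 by (simp add: mult_left_mono)
    also have "\<dots> = (\<delta> + op_norm R) * cvec_norm g" by (simp add: distrib_right)
    also have "\<dots> \<le> (\<delta> + op_norm R) * (\<kappa> * op_norm E * cvec_norm w)"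
      using gle pos k0 by (intro mult_left_mono) auto
    finally have "\<delta>\<^sup>2 * cvec_norm w \<le> (\<kappa> * op_norm E * \<delta> + \<kappa> * op_norm R * op_norm E) * cvec_norm w"
      by (simp add: power2_eq_square algebra_simps)
    moreover have "cvec_norm w > 0" using cvec_norm_nonneg[of w] cvec_norm_eq_0_iff[OF w] w0 by simp
    ultimately have q: "\<delta>\<^sup>2 \<le> \<kappa> * op_norm E * \<delta> + \<kappa> * op_norm R * op_norm E" by simp
    show ?thesis
    proof (cases "\<delta> \<le> 2 * \<kappa> * op_norm E")
      case False
      then have "2 * \<kappa> * op_norm E * \<delta> \<le> \<delta>\<^sup>2" using pos by (simp add: power2_eq_square)
      then have "\<delta>\<^sup>2 \<le> 2 * \<kappa> * op_norm R * op_norm E" using q by simp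
      then show ?thesis using real_le_rsqrt by (simp add: le_max_iff_disj)
    qed simp
  qed
  then show ?thesis using i0 by auto
qed

section \<open>Matrix identities and the algebra of the block decomposition\<close>

lemma mat_eqI_mult_vec:
  fixes A B :: "'a::comm_semiring_1 mat"
  assumes A: "A \<in> carrier_mat n k" and B: "B \<in> carrier_mat n k"
    and eq: "\<And>v. v \<in> carrier_vec k \<Longrightarrow> A *\<^sub>v v = B *\<^sub>v v"
  shows "A = B"
proof (rule eq_matI)
  fix i j assume ij: "i < dim_row B" "j < dim_col B"
  have entry: "(C *\<^sub>v unit_vec k j) $ i = C $$ (i, j)" if "C \<in> carrier_mat n k" for C :: "'a mat"
    using that ij B by (simp add: scalar_prod_right_unit)
  show "A $$ (i, j) = B $$ (i, j)" using entry[OF A] entry[OF B] eq[of "unit_vec k j"] by simp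
qed (use A B in auto)

text \<open>A pair of blocks side by side is encoded as a four block matrix with an empty second row.\<close>

lemma columns_mult_rows:
  fixes P Z C D :: "'a::comm_ring_1 mat"
  assumes c: "P \<in> carrier_mat n M" "Z \<in> carrier_mat n K" "C \<in> carrier_mat M n" "D \<in> carrier_mat K n"
  shows "four_block_mat P Z (0\<^sub>m 0 M) (0\<^sub>m 0 K) * four_block_mat C (0\<^sub>m M 0) D (0\<^sub>m K 0)
    = P * C + Z * D"
proof -
  have "four_block_mat P Z (0\<^sub>m 0 M) (0\<^sub>m 0 K) * four_block_mat C (0\<^sub>m M 0) D (0\<^sub>m K 0)
    = four_block_mat (P * C + Z * D) (0\<^sub>m n 0) (0\<^sub>m 0 n) (0\<^sub>m 0 0)"
    using c by (subst mult_four_block_mat[of _ n M _ K _ 0 _ _ n _ 0]) auto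
  then show ?thesis using c by (auto intro!: eq_matI)
qed

text \<open>Dimension conditions are easier for the simplifier than membership in \<open>carrier_mat\<close> with
  unknown dimensions.\<close>

lemma mat_mult_assoc_dim:
  fixes A :: "'a::semiring_0 mat"
  shows "dim_col A = dim_row B \<Longrightarrow> dim_col B = dim_row C \<Longrightarrow> A * B * C = A * (B * C)"
  by (rule assoc_mult_mat[of _ "dim_row A" "dim_row B" _ "dim_row C" _ "dim_col C"]) auto

lemma mat_distrib_dim:
  fixes A B C :: "'a::ring mat"
  shows "dim_row A = dim_row B \<Longrightarrow> dim_col A = dim_col B \<Longrightarrow> dim_col A = dim_row C \<Longrightarrow>
      (A + B) * C = A * C + B * C"
    and "dim_row A = dim_row B \<Longrightarrow> dim_col A = dim_col B \<Longrightarrow> dim_col A = dim_row C \<Longrightarrow>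
      (A - B) * C = A * C - B * C"
    and "dim_row A = dim_row B \<Longrightarrow> dim_col A = dim_col B \<Longrightarrow> dim_col C = dim_row A \<Longrightarrow>
      C * (A + B) = C * A + C * B"
    and "dim_row A = dim_row B \<Longrightarrow> dim_col A = dim_col B \<Longrightarrow> dim_col C = dim_row A \<Longrightarrow>
      C * (A - B) = C * A - C * B"
  by (rule add_mult_distrib_mat minus_mult_distrib_mat mult_add_distrib_mat mult_minus_distrib_mat;
      rule carrier_matI; simp)+

lemma carrier_mat_iff: "A \<in> carrier_mat n k \<longleftrightarrow> dim_row A = n \<and> dim_col A = k"
  by (blast intro: carrier_matI dest: carrier_matD)

lemmas mat_algebra = mat_mult_assoc_dim mat_distrib_dim carrier_mat_iff

text \<open>\<open>F\<close> and \<open>G\<close> stand for the kernel matrices of \<open>\<Phi>\<close> and of \<open>\<L>\<Phi>\<close>.\<close>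

locale block_decomposition =
  fixes n M K :: nat and P W F G S U \<Theta> Lam :: "real mat"
  assumes n: "n = M + K"
    and P: "P \<in> carrier_mat n M" and W: "W \<in> carrier_mat n K"
    and F: "F \<in> carrier_mat n n" and G: "G \<in> carrier_mat n n"
    and S: "S \<in> carrier_mat K K" and U: "U \<in> carrier_mat K K"
    and \<Theta>: "\<Theta> \<in> carrier_mat K K" and Lam: "Lam \<in> carrier_mat M M"
    and P_inj: "\<And>v. v \<in> carrier_vec M \<Longrightarrow> P *\<^sub>v v = 0\<^sub>v n \<Longrightarrow> v = 0\<^sub>v M"
    and WW: "W\<^sup>T * W = 1\<^sub>m K" and WP: "W\<^sup>T * P = 0\<^sub>m K M"
    and B_inj: "\<And>v. v \<in> carrier_vec K \<Longrightarrow> (W\<^sup>T * F * W) *\<^sub>v v = 0\<^sub>v K \<Longrightarrow> v = 0\<^sub>v K"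
    and S_inj: "\<And>v. v \<in> carrier_vec K \<Longrightarrow> S *\<^sub>v v = 0\<^sub>v K \<Longrightarrow> v = 0\<^sub>v K"
    and SS: "S * S = mat_inv (W\<^sup>T * F * W)"
    and UU: "U\<^sup>T * U = 1\<^sub>m K"
    and eig: "S * W\<^sup>T * G * W * S = U * \<Theta> * U\<^sup>T"
begin

definition "Pd = mat_inv (P\<^sup>T * P) * P\<^sup>T"
definition "B = W\<^sup>T * F * W"
definition "A = W * mat_inv B * W\<^sup>T"
definition "Z = W * mat_inv S * U"
definition "R = (Pd * G - Lam * Pd * F) * A * Z"
definition "V = four_block_mat P Z (0\<^sub>m 0 M) (0\<^sub>m 0 K)"
definition "T = four_block_mat Lam R (0\<^sub>m K M) \<Theta>"
text \<open>The lower rows of the inverse of \<open>V\<close>: a left inverse of \<open>Z\<close>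
  that vanishes on the range of \<open>P\<close>.\<close>

definition "X = U\<^sup>T * S * W\<^sup>T"

lemma dims[simp]:
  "dim_row P = n" "dim_col P = M" "dim_row W = n" "dim_col W = K" "dim_row F = n" "dim_col F = n"
  "dim_row G = n" "dim_col G = n" "dim_row S = K" "dim_col S = K" "dim_row U = K" "dim_col U = K"
  "dim_row \<Theta> = K" "dim_col \<Theta> = K" "dim_row Lam = M" "dim_col Lam = M"
  using P W F G S U \<Theta> Lam by auto

lemma B: "B \<in> carrier_mat K K" and dim_B[simp]: "dim_row B = K" "dim_col B = K"
  by (auto simp: B_def)

lemma B_inverse: "mat_inv B \<in> carrier_mat K K" "B * mat_inv B = 1\<^sub>m K" "mat_inv B * B = 1\<^sub>m K"
  using injective_mat_inverse[OF B B_inj[folded B_def]] by auto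

lemma S_inverse: "mat_inv S \<in> carrier_mat K K" "S * mat_inv S = 1\<^sub>m K" "mat_inv S * S = 1\<^sub>m K"
  using injective_mat_inverse[OF S S_inj] by auto

lemma dim_inv[simp]: "dim_row (mat_inv B) = K" "dim_col (mat_inv B) = K"
  "dim_row (mat_inv S) = K" "dim_col (mat_inv S) = K"
  using B_inverse S_inverse by auto

lemma UUT: "U * U\<^sup>T = 1\<^sub>m K"
  by (rule mat_mult_left_right_inverse[of "U\<^sup>T" K U]) (simp_all add: UU carrier_mat_iff)

lemma S_inv_sq: "mat_inv S * mat_inv S = B"
proof -
  have "mat_inv S * mat_inv S = mat_inv S * mat_inv S * (S * S * B)"
    using SS B_inverse by (simp add: B_def[symmetric])
  also have "\<dots> = mat_inv S * ((mat_inv S * S) * (S * B))"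
    by (simp add: mat_algebra)
  also have "\<dots> = (mat_inv S * S) * B"
    by (simp add: S_inverse(3) flip: mat_mult_assoc_dim)
  finally show ?thesis unfolding S_inverse by simp
qed

text \<open>A kernel vector \<open>v\<close> of the Gram matrix satisfies
  \<open>(P *\<^sub>v v) \<bullet> (P *\<^sub>v v) = 0\<close>, so injectivity of \<open>P\<close>
  carries over.\<close>

lemma PP_inverse: "mat_inv (P\<^sup>T * P) \<in> carrier_mat M M" "mat_inv (P\<^sup>T * P) * (P\<^sup>T * P) = 1\<^sub>m M"
proof -
  have inj: "v = 0\<^sub>v M" if v: "v \<in> carrier_vec M" "(P\<^sup>T * P) *\<^sub>v v = 0\<^sub>v M" for v
  proof (rule P_inj[OF v(1)])
    have Pv: "P *\<^sub>v v \<in> carrier_vec n" by (rule mult_mat_vec_carrier[OF P v(1)])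
    have "(P *\<^sub>v v) \<bullet> (P *\<^sub>v v) = (P\<^sup>T *\<^sub>v (P *\<^sub>v v)) \<bullet> v"
      by (rule transpose_vec_mult_scalar[OF P v(1) Pv, symmetric])
    also have "P\<^sup>T *\<^sub>v (P *\<^sub>v v) = 0\<^sub>v M" using v assoc_mult_mat_vec[of "P\<^sup>T" M n P M v] P by simp
    finally have "(P *\<^sub>v v) \<bullet> (P *\<^sub>v v) = 0" using v by simp
    then have "(\<Sum>i<n. ((P *\<^sub>v v) $ i)\<^sup>2) = 0"
      using Pv unfolding scalar_prod_def by (simp add: power2_eq_square lessThan_atLeast0)
    then have "\<forall>i<n. (P *\<^sub>v v) $ i = 0" by (subst (asm) sum_nonneg_eq_0_iff) auto
    then show "P *\<^sub>v v = 0\<^sub>v n" using Pv by (intro eq_vecI) auto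
  qed
  have c: "P\<^sup>T * P \<in> carrier_mat M M" by (simp add: carrier_mat_iff)
  show "mat_inv (P\<^sup>T * P) \<in> carrier_mat M M" "mat_inv (P\<^sup>T * P) * (P\<^sup>T * P) = 1\<^sub>m M"
    using injective_mat_inverse[OF c inj] by blast+
qed

lemma dim_PP_inverse[simp]: "dim_row (mat_inv (P\<^sup>T * P)) = M" "dim_col (mat_inv (P\<^sup>T * P)) = M"
  using PP_inverse by auto

lemma dim_defs[simp]: "dim_row Pd = M" "dim_col Pd = n" "dim_row A = n" "dim_col A = n"
  "dim_row Z = n" "dim_col Z = K" "dim_row R = M" "dim_col R = K" "dim_row X = K" "dim_col X = n"
  "dim_row V = n" "dim_col V = n" "dim_row T = n" "dim_col T = n"
  by (simp_all add: Pd_def A_def Z_def R_def X_def V_def T_def n)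

lemma Pd_P: "Pd * P = 1\<^sub>m M"
  using PP_inverse by (simp add: Pd_def mat_algebra)

lemma Pd_W: "Pd * W = 0\<^sub>m M K"
proof -
  have "P\<^sup>T * W = (W\<^sup>T * P)\<^sup>T" using P W by (subst transpose_mult[of _ K n]) auto
  also have "\<dots> = 0\<^sub>m M K" by (simp add: WP)
  finally show ?thesis by (simp add: Pd_def mat_algebra)
qed

text \<open>\<open>Pd\<close> stacked on \<open>W\<^sup>T\<close> is a left inverse of the square
  matrix with blocks \<open>P\<close> and \<open>W\<close>, hence also a right inverse. Multiplied
  out, the latter is the sum of the orthogonal projections onto the range of \<open>P\<close> and
  its complement.\<close>

lemma PPd_WWT: "P * Pd + W * W\<^sup>T = 1\<^sub>m n"
proof -
  define Q where "Q = four_block_mat P W (0\<^sub>m 0 M) (0\<^sub>m 0 K)"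
  define Q' where "Q' = four_block_mat Pd (0\<^sub>m M 0) (W\<^sup>T) (0\<^sub>m K 0)"
  have c: "Q \<in> carrier_mat n n" "Q' \<in> carrier_mat n n"
    by (simp_all add: Q_def Q'_def n carrier_mat_iff)
  have "Q' * Q = four_block_mat (Pd * P + 0\<^sub>m M 0 * 0\<^sub>m 0 M) (Pd * W + 0\<^sub>m M 0 * 0\<^sub>m 0 K)
      (W\<^sup>T * P + 0\<^sub>m K 0 * 0\<^sub>m 0 M) (W\<^sup>T * W + 0\<^sub>m K 0 * 0\<^sub>m 0 K)"
    unfolding Q_def Q'_def
    by (rule mult_four_block_mat[of _ M n _ 0 _ K _ _ M _ K]) (simp_all add: carrier_mat_iff)
  also have "\<dots> = 1\<^sub>m n" by (simp add: Pd_P Pd_W WP WW n)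
  finally have "Q * Q' = 1\<^sub>m n" using mat_mult_left_right_inverse[OF c(2,1)] by simp
  then show ?thesis unfolding Q_def Q'_def
    by (subst (asm) columns_mult_rows[of _ n M _ K]) (simp_all add: carrier_mat_iff)
qed

definition "V' = four_block_mat Pd (0\<^sub>m M 0) X (0\<^sub>m K 0)"

lemma dim_V'[simp]: "dim_row V' = n" "dim_col V' = n"
  by (simp_all add: V'_def n)

lemma ZX: "Z * X = W * W\<^sup>T"
proof -
  have "Z * X = W * (mat_inv S * ((U * U\<^sup>T) * (S * W\<^sup>T)))" by (simp add: Z_def X_def mat_algebra)
  also have "\<dots> = W * ((mat_inv S * S) * W\<^sup>T)" unfolding UUT by (simp add: mat_algebra)
  also have "\<dots> = W * W\<^sup>T" unfolding S_inverse by simp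
  finally show ?thesis .
qed

lemma V_V': "V * V' = 1\<^sub>m n"
  unfolding V_def V'_def
  by (subst columns_mult_rows[of _ n M _ K]) (simp_all add: ZX PPd_WWT carrier_mat_iff)

lemma mat_inv_V: "mat_inv V = V'"
  by (rule mat_inverse_the[OF _ _ V_V']) (simp_all add: carrier_mat_iff)

definition "D = V * T * V'"

lemma D_dim[simp]: "dim_row D = n" "dim_col D = n"
  by (simp_all add: D_def)

lemma D_eq: "D = P * (Lam * Pd + R * X) + Z * (\<Theta> * X)"
proof -
  have "T * V' = four_block_mat (Lam * Pd + R * X) (Lam * 0\<^sub>m M 0 + R * 0\<^sub>m K 0)
      (0\<^sub>m K M * Pd + \<Theta> * X) (0\<^sub>m K M * 0\<^sub>m M 0 + \<Theta> * 0\<^sub>m K 0)"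
    unfolding T_def V'_def
    by (rule mult_four_block_mat[of _ M M _ K _ K _ _ n _ 0]) (simp_all add: carrier_mat_iff)
  also have "\<dots> = four_block_mat (Lam * Pd + R * X) (0\<^sub>m M 0) (\<Theta> * X) (0\<^sub>m K 0)"
    by (simp add: left_add_zero_mat[of _ K n] carrier_mat_iff)
  finally have TV: "T * V' = \<dots>" .
  have "D = V * (T * V')" unfolding D_def by (simp add: mat_algebra)
  also have "\<dots> = P * (Lam * Pd + R * X) + Z * (\<Theta> * X)"
    unfolding TV unfolding V_def
    by (rule columns_mult_rows[of _ n]) (simp_all add: carrier_mat_iff)
  finally show ?thesis .
qed

lemma XP: "X * P = 0\<^sub>m K M"
  by (simp add: X_def WP mat_algebra)

lemma D_P: "D * P = P * Lam"
proof -
  have "D * P = P * (Lam * (Pd * P) + R * (X * P)) + Z * (\<Theta> * (X * P))"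
    unfolding D_eq by (simp add: mat_algebra)
  also have "\<dots> = P * Lam"
    unfolding Pd_P XP by (simp add: carrier_mat_iff right_add_zero_mat[of _ n M] right_add_zero_mat[of _ M M])
  finally show ?thesis .
qed

text \<open>By \<open>XFW\<close> the last factor is \<open>X * (F * W)\<close>. Since
  \<open>Z * X\<close> is the projection \<open>W * W\<^sup>T\<close>, the matrix \<open>A\<close>
  recovers \<open>W\<close> from the part of \<open>F * W\<close> orthogonal to the range of
  \<open>P\<close>.\<close>

lemma AZ: "A * Z * (U\<^sup>T * mat_inv S) = W"
proof -
  have "A * Z * (U\<^sup>T * mat_inv S) = W * (mat_inv B * ((W\<^sup>T * W) * (mat_inv S * ((U * U\<^sup>T) * mat_inv S))))"
    by (simp add: A_def Z_def mat_algebra)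
  also have "\<dots> = W * (mat_inv B * (mat_inv S * mat_inv S))"
    unfolding UUT WW by simp
  also have "\<dots> = W" unfolding S_inv_sq by (simp add: B_inverse)
  finally show ?thesis .
qed

lemma XFW: "X * (F * W) = U\<^sup>T * mat_inv S"
proof -
  have "X * (F * W) = U\<^sup>T * (S * B)" by (simp add: X_def B_def mat_algebra)
  also have "\<dots> = U\<^sup>T * ((S * mat_inv S) * mat_inv S)"
    unfolding S_inv_sq[symmetric] by (simp add: mat_algebra)
  finally show ?thesis unfolding S_inverse by simp
qed

text \<open>This explains the form of \<open>R\<close>: by \<open>AZ\<close> its contribution
  exchanges \<open>Lam * Pd * F * W\<close> for \<open>Pd * G * W\<close>, which is the component of
  \<open>G * W\<close> along \<open>P\<close>. The eigendecomposition \<open>eig\<close> turns the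
  \<open>\<Theta>\<close> term into the orthogonal component, and the two projections add
  up.\<close>

lemma D_FW: "D * (F * W) = G * W"
proof -
  let ?Y = "U\<^sup>T * mat_inv S"
  have "D * (F * W) = P * (Lam * (Pd * (F * W)) + R * (X * (F * W))) + Z * (\<Theta> * (X * (F * W)))"
    unfolding D_eq by (simp add: mat_algebra)
  also have "R * (X * (F * W)) = (Pd * G - Lam * Pd * F) * (A * Z * ?Y)"
    unfolding XFW R_def by (simp add: mat_algebra)
  also have "\<dots> = Pd * (G * W) - Lam * (Pd * (F * W))"
    unfolding AZ by (simp add: mat_algebra)
  also have "Lam * (Pd * (F * W)) + \<dots> = Pd * (G * W)"
    by (intro eq_matI) auto
  also have "Z * (\<Theta> * (X * (F * W))) = W * (mat_inv S * ((U * \<Theta> * U\<^sup>T) * mat_inv S))"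
    unfolding XFW by (simp add: Z_def mat_algebra)
  also have "\<dots> = W * ((mat_inv S * S) * (W\<^sup>T * (G * (W * (S * mat_inv S)))))"
    unfolding eig[symmetric] by (simp add: mat_algebra)
  also have "\<dots> = W * (W\<^sup>T * (G * W))" unfolding S_inverse by simp
  also have "P * (Pd * (G * W)) + \<dots> = (P * Pd + W * W\<^sup>T) * (G * W)"
    by (simp add: mat_algebra)
  also have "\<dots> = G * W" unfolding PPd_WWT by simp
  finally show ?thesis .
qed

text \<open>The component of \<open>F * W\<close> orthogonal to the range of \<open>P\<close> is
  \<open>W * B\<close> with \<open>B\<close> invertible. So \<open>W\<close> is expressible through
  \<open>F * W\<close> and \<open>P\<close>, and \<open>P\<close> and \<open>W\<close> together
  determine a matrix by \<open>PPd_WWT\<close>.\<close>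

lemma D_unique:
  assumes D': "D' \<in> carrier_mat n n" and DP: "D' * P = P * Lam" and DF: "D' * (F * W) = G * W"
  shows "D' = D"
proof -
  define H where "H = P * (Pd * (F * W))"
  have H[simp]: "dim_row H = n" "dim_col H = K" by (simp_all add: H_def)
  have "F * W = (P * Pd + W * W\<^sup>T) * (F * W)" unfolding PPd_WWT by simp
  also have "\<dots> = H + W * B" by (simp add: B_def H_def mat_algebra)
  finally have FW: "F * W = H + W * B" .
  have "(F * W - H) * mat_inv B = W * B * mat_inv B"
    unfolding FW by (rule arg_cong[where f = "\<lambda>Q. Q * mat_inv B"]) (auto intro!: eq_matI)
  also have "\<dots> = W * (B * mat_inv B)" by (simp add: mat_algebra)
  finally have W_eq: "W = (F * W - H) * mat_inv B" unfolding B_inverse by simp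
  have DW: "E * W = (E * (F * W) - E * P * (Pd * (F * W))) * mat_inv B" if E: "E \<in> carrier_mat n n" for E
  proof -
    have dE[simp]: "dim_row E = n" "dim_col E = n" using E by auto
    have "E * W = E * ((F * W - H) * mat_inv B)" using W_eq by simp
    also have "\<dots> = (E * (F * W) - E * H) * mat_inv B"
      by (simp add: mat_distrib_dim(4) flip: mat_mult_assoc_dim)
    also have "E * H = E * P * (Pd * (F * W))"
      by (simp add: H_def mat_mult_assoc_dim)
    finally show ?thesis .
  qed
  have full: "E = E * P * Pd + E * W * W\<^sup>T" if E: "E \<in> carrier_mat n n" for E
  proof -
    have dE[simp]: "dim_row E = n" "dim_col E = n" using E by auto
    have "E = E * (P * Pd + W * W\<^sup>T)" unfolding PPd_WWT by simp
    also have "\<dots> = E * P * Pd + E * W * W\<^sup>T"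
      by (simp add: mat_distrib_dim(3) mat_mult_assoc_dim)
    finally show ?thesis .
  qed
  have D: "D \<in> carrier_mat n n" by (simp add: carrier_mat_iff)
  have "D' * W = D * W"
    using DW[OF D'] DW[OF D] DP DF D_P D_FW by simp
  then show ?thesis using full[OF D'] full[OF D] DP D_P by simp
qed

end

section \<open>Solid harmonics\<close>

definition dirder :: "'a::euclidean_space \<Rightarrow> ('a \<Rightarrow> real) \<Rightarrow> 'a \<Rightarrow> real" where
  "dirder v q x = deriv (\<lambda>t. q (x + t *\<^sub>R v)) 0"

lemma has_derivative_dirder:
  assumes "(q has_derivative D) (at x)"
  shows "((\<lambda>t. q (x + t *\<^sub>R v)) has_real_derivative D v) (at 0)" and "dirder v q x = D v"
proof -
  have "((\<lambda>t. q (x + t *\<^sub>R v)) has_derivative (\<lambda>t. D (t *\<^sub>R v))) (at 0)"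
    by (rule has_derivative_compose[where f = "\<lambda>t. x + t *\<^sub>R v" and g = q])
       (use assms in \<open>auto intro!: derivative_eq_intros\<close>)
  then show "((\<lambda>t. q (x + t *\<^sub>R v)) has_real_derivative D v) (at 0)"
    unfolding has_field_derivative_def using has_derivative_linear[OF assms]
    by (simp add: linear_scale mult.commute[of _ "D v"])
  then show "dirder v q x = D v"
    unfolding dirder_def by (rule DERIV_imp_deriv)
qed

lemma polynomial_has_derivative:
  assumes "real_polynomial_function q"
  shows "(q has_derivative (\<lambda>v. dirder v q x)) (at x)"
proof -
  obtain D where D: "(q has_derivative D) (at x)"
    using differentiable_at_real_polynomial_function[OF assms] unfolding differentiable_def by blast
  then have "D = (\<lambda>v. dirder v q x)" using has_derivative_dirder(2) by fastforce
  with D show ?thesis by simp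
qed

lemma dirder_linear:
  assumes "real_polynomial_function q"
  shows "linear (\<lambda>v. dirder v q x)"
  using polynomial_has_derivative[OF assms] by (rule has_derivative_linear)

lemma dirder_line:
  assumes "real_polynomial_function q"
  shows "((\<lambda>t. q (x + t *\<^sub>R v)) has_real_derivative dirder v q (x + t *\<^sub>R v)) (at t)"
proof -
  have "((\<lambda>s. q ((x + t *\<^sub>R v) + s *\<^sub>R v)) has_real_derivative dirder v q (x + t *\<^sub>R v)) (at 0)"
    using has_derivative_dirder(1)[OF polynomial_has_derivative[OF assms]] .
  then have "((\<lambda>s. q (x + (t + s) *\<^sub>R v)) has_real_derivative dirder v q (x + t *\<^sub>R v)) (at 0)"
    by (simp add: algebra_simps)
  then show ?thesis
    using DERIV_shift[of "\<lambda>t. q (x + t *\<^sub>R v)" "dirder v q (x + t *\<^sub>R v)" 0 t] by (simp add: add.commute)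
qed

lemma dirder_const: "dirder v (\<lambda>x. c) = (\<lambda>x. 0)"
  by (auto simp: dirder_def)

lemma dirder_bounded_linear:
  assumes "bounded_linear f"
  shows "dirder v f = (\<lambda>x. f v)"
  using has_derivative_dirder(2)[OF bounded_linear.has_derivative[OF assms has_derivative_ident]] by auto

lemma dirder_add:
  assumes "real_polynomial_function f" "real_polynomial_function g"
  shows "dirder v (\<lambda>x. f x + g x) = (\<lambda>x. dirder v f x + dirder v g x)"
  using has_derivative_dirder(2)[OF has_derivative_add[OF polynomial_has_derivative[OF assms(1)] polynomial_has_derivative[OF assms(2)]]]
  by auto

lemma dirder_mult:
  assumes "real_polynomial_function f" "real_polynomial_function g"
  shows "dirder v (\<lambda>x. f x * g x) = (\<lambda>x. f x * dirder v g x + dirder v f x * g x)"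
  using has_derivative_dirder(2)[OF has_derivative_mult[OF polynomial_has_derivative[OF assms(1)] polynomial_has_derivative[OF assms(2)]]]
  by auto

lemma dirder_polynomial:
  assumes "real_polynomial_function q"
  shows "real_polynomial_function (dirder v q)"
  using assms
  by (induction rule: real_polynomial_function.induct)
     (simp_all add: dirder_const dirder_bounded_linear dirder_add dirder_mult real_polynomial_function.intros(2-4))

text \<open>Symmetry of second derivatives; for polynomials, structural induction with the sum and
  product rules is enough.\<close>

lemma dirder_commute:
  assumes "real_polynomial_function q"
  shows "dirder v (dirder w q) = dirder w (dirder v q)"
  using assms
  by (induction rule: real_polynomial_function.induct)
     (auto simp: dirder_const dirder_bounded_linear dirder_add dirder_mult dirder_polynomial
        real_polynomial_function.intros algebra_simps)

lemma dirder_sum: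
  assumes "finite I" "\<And>i. i \<in> I \<Longrightarrow> real_polynomial_function (f i)"
  shows "dirder v (\<lambda>x. \<Sum>i\<in>I. f i x) = (\<lambda>x. \<Sum>i\<in>I. dirder v (f i) x)"
  using assms by (induction I rule: finite_induct)
    (auto simp: dirder_const dirder_add real_polynomial_function_sum)

lemma dirder_cmult:
  assumes "real_polynomial_function f"
  shows "dirder v (\<lambda>x. c * f x) = (\<lambda>x. c * dirder v f x)"
  using dirder_mult[OF real_polynomial_function.intros(2)[of c] assms] by (simp add: dirder_const)

lemma laplacian_polynomial:
  assumes "real_polynomial_function q"
  shows "laplacian q = (\<lambda>x. \<Sum>b\<in>Basis. dirder b (dirder b q) x)"
proof
  fix x
  have "(deriv ^^ 2) (\<lambda>t. q (x + t *\<^sub>R b)) 0 = dirder b (dirder b q) x" for b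
  proof -
    have "deriv (\<lambda>t. q (x + t *\<^sub>R b)) = (\<lambda>t. dirder b q (x + t *\<^sub>R b))"
      using DERIV_imp_deriv[OF dirder_line[OF assms]] by blast
    then show ?thesis by (simp add: numeral_2_eq_2 dirder_def)
  qed
  then show "laplacian q x = (\<Sum>b\<in>Basis. dirder b (dirder b q) x)" by (simp add: laplacian_def)
qed

section \<open>Householder reflections and their action on harmonic polynomials\<close>

definition reflection :: "'a::euclidean_space \<Rightarrow> 'a \<Rightarrow> 'a" where
  "reflection w z = z - (2 / inner w w * inner z w) *\<^sub>R w"

lemma reflection_linear: "linear (reflection w)"
  by (rule linearI) (simp_all add: reflection_def inner_simps algebra_simps add_divide_distrib)

lemma reflection_bounded_linear: "bounded_linear (reflection w)"
  using reflection_linear by (rule linear_conv_bounded_linear[THEN iffD1])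

lemma reflection_inner: "inner (reflection w z) (reflection w y) = inner z y"
proof (cases "w = 0")
  case False
  define k where "k = 2 / inner w w"
  have k: "k * inner w w = 2" using False by (simp add: k_def)
  have "inner (reflection w z) (reflection w y) =
      inner z y - 2 * k * inner z w * inner y w + k * (k * inner w w) * inner z w * inner y w"
    by (simp add: reflection_def inner_diff_left inner_diff_right inner_commute[of w y] k_def[symmetric] algebra_simps
        del: times_divide_eq_left times_divide_eq_right)
  then show ?thesis unfolding k by simp
qed (simp add: reflection_def)

lemma norm_reflection[simp]: "norm (reflection w z) = norm z"
  by (simp add: norm_eq_sqrt_inner reflection_inner)

lemma reflection_idem[simp]: "reflection w (reflection w z) = z"
proof (cases "w = 0")
  case False
  then have "inner (reflection w z) w = - inner z w"
    by (simp add: reflection_def inner_diff_left)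
  then show ?thesis unfolding reflection_def[of w "reflection w z"] by (simp add: reflection_def)
qed (simp add: reflection_def)

text \<open>The mirror is the perpendicular bisector of the two points, which passes through the
  origin because the norms agree. For \<open>x = y\<close> the reflection degenerates to the
  identity.\<close>

lemma reflection_swap:
  assumes "norm x = norm y"
  shows "reflection (x - y) x = y"
proof (cases "x = y")
  case False
  have "inner x x = inner y y" using assms by (simp add: norm_eq_sqrt_inner)
  then have "2 * inner x (x - y) = inner (x - y) (x - y)"
    by (simp add: inner_simps inner_commute)
  then show ?thesis using False by (simp add: reflection_def)
qed (simp add: reflection_def)

lemma polynomial_reflection:
  assumes "real_polynomial_function q"
  shows "real_polynomial_function (\<lambda>x. q (reflection w x))"
proof -
  have "polynomial_function (reflection w)"
    using reflection_bounded_linear by (rule polynomial_function_bounded_linear)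
  then show ?thesis using real_polynomial_function_compose[OF _ assms] by (simp add: o_def)
qed

lemma dirder_reflection:
  "dirder v (\<lambda>x. q (reflection w x)) = (\<lambda>x. dirder (reflection w v) q (reflection w x))"
  by (auto simp: dirder_def linear_add[OF reflection_linear] linear_scale[OF reflection_linear])

text \<open>The trace of the Hessian is invariant: the two correction terms cancel because the
  coefficient \<open>k\<close> in the reflection satisfies \<open>k * inner w w = 2\<close>.\<close>

lemma laplacian_reflection:
  assumes q: "real_polynomial_function q"
  shows "laplacian (\<lambda>x. q (reflection w x)) x = laplacian q (reflection w x)"
proof (cases "w = 0")
  case False
  define k where "k = 2 / inner w w"
  define y where "y = reflection w x"
  define H where "H = (\<lambda>u v. dirder u (dirder v q) y)"
  have lin1: "linear (\<lambda>u. H u v)" for v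
    unfolding H_def by (rule dirder_linear[OF dirder_polynomial[OF q]])
  have sym: "H u v = H v u" for u v by (simp add: H_def dirder_commute[OF q, of u])
  have lin2: "linear (\<lambda>v. H u v)" for u using lin1[of u] by (simp add: sym[of u])
  have refl: "reflection w b = b - (k * inner b w) *\<^sub>R w" for b by (simp add: reflection_def k_def)
  have H: "H (reflection w b) (reflection w b) =
      H b b - 2 * k * (inner b w * H b w) + k\<^sup>2 * (inner b w * inner b w) * H w w" for b
    unfolding refl
    by (simp add: linear_diff[OF lin1] linear_diff[OF lin2] linear_scale[OF lin1] linear_scale[OF lin2]
        sym[of w b] power2_eq_square algebra_simps)
  have Hww: "(\<Sum>b\<in>Basis. inner b w * H b w) = H w w"
  proof -
    have "H w w = H (\<Sum>b\<in>Basis. inner w b *\<^sub>R b) w" by (simp add: euclidean_representation)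
    also have "\<dots> = (\<Sum>b\<in>Basis. inner w b * H b w)"
      by (simp add: linear_sum[OF lin1] linear_scale[OF lin1])
    finally show ?thesis by (simp add: inner_commute)
  qed
  have ww: "(\<Sum>b\<in>Basis. inner b w * inner b w) = inner w w"
    by (simp add: euclidean_inner[of w w] inner_commute)
  have "laplacian (\<lambda>x. q (reflection w x)) x = (\<Sum>b\<in>Basis. H (reflection w b) (reflection w b))"
    unfolding laplacian_polynomial[OF polynomial_reflection[OF q]] dirder_reflection H_def y_def ..
  also have "\<dots> = (\<Sum>b\<in>Basis. H b b) - 2 * k * H w w + k\<^sup>2 * inner w w * H w w"
    unfolding H by (simp add: sum.distrib sum_subtractf flip: sum_distrib_left sum_distrib_right Hww ww)
  also have "k\<^sup>2 * inner w w = 2 * k" using False by (simp add: k_def power2_eq_square)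
  finally show ?thesis by (simp add: laplacian_polynomial[OF q] H_def y_def)
qed (simp add: reflection_def)

lemma spherical_harmonic_reflection:
  assumes "spherical_harmonic l f"
  shows "spherical_harmonic l (\<lambda>x. f (reflection w x))"
proof -
  obtain q where q: "real_polynomial_function q" "\<And>r x. q (r *\<^sub>R x) = r ^ l * q x"
    "\<And>x. laplacian q x = 0" "\<And>x. x \<in> sphere 0 1 \<Longrightarrow> f x = q x"
    using assms unfolding spherical_harmonic_def by blast
  show ?thesis
    unfolding spherical_harmonic_def
    by (rule exI[of _ "\<lambda>x. q (reflection w x)"])
       (use q in \<open>auto simp: polynomial_reflection laplacian_reflection linear_scale[OF reflection_linear]\<close>)
qed

section \<open>Homogeneous polynomials on lines and grids\<close>

lemma polynomial_on_line:
  assumes "real_polynomial_function q"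
  obtains p where "\<And>t. q (x + t *\<^sub>R v) = poly p t"
proof -
  have "polynomial_function (\<lambda>t::real. x + t *\<^sub>R v)"
    by (intro polynomial_function_add polynomial_function_const polynomial_function_mult polynomial_function_id)
  then have "real_polynomial_function (\<lambda>t. q (x + t *\<^sub>R v))"
    using real_polynomial_function_compose[OF _ assms] by (simp add: o_def)
  then obtain a n where a: "(\<lambda>t. q (x + t *\<^sub>R v)) = (\<lambda>t. \<Sum>i\<le>n. a i * t ^ i)"
    unfolding real_polynomial_function_iff_sum by blast
  have "q (x + t *\<^sub>R v) = poly (\<Sum>i\<le>n. monom (a i) i) t" for t
    using fun_cong[OF a, of t] by (simp add: poly_sum poly_monom)
  then show thesis by (rule that)
qed

text \<open>The factor \<open>r ^ j\<close> on the left allows derivatives of homogeneous functions as well, without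
  a case distinction on the degree.\<close>

lemma homogeneous_polynomial_degree:
  assumes q: "real_polynomial_function q"
    and hom: "\<And>r x. r ^ j * q (r *\<^sub>R x) = r ^ l * q x"
  obtains p where "\<And>t. q (x + t *\<^sub>R v) = poly p t" "degree p \<le> l"
proof -
  obtain p where p: "\<And>t. q (x + t *\<^sub>R v) = poly p t" using polynomial_on_line[OF q] by blast
  \<comment> \<open>The line with the roles of \<open>x\<close> and \<open>v\<close> exchanged. As
    \<open>x + t *\<^sub>R v\<close> is \<open>t\<close> times
    \<open>v + inverse t *\<^sub>R x\<close>, homogeneity makes \<open>p\<close>, up to powers of
    \<open>t\<close>, the reversal of \<open>p'\<close>; comparing degrees bounds that of
    \<open>p\<close>.\<close>
  obtain p' where p': "\<And>t. q (v + t *\<^sub>R x) = poly p' t" using polynomial_on_line[OF q] by blast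
  have "poly (monom 1 (degree p' + j) * p) t = poly (monom 1 l * reflect_poly p') t" if t: "t \<noteq> 0" for t
  proof -
    have "t ^ j * poly p t = t ^ j * q (t *\<^sub>R (v + inverse t *\<^sub>R x))"
      using t by (simp add: p[symmetric] algebra_simps)
    also have "\<dots> = t ^ l * poly p' (inverse t)" by (simp add: hom p')
    finally show ?thesis
      using t by (simp add: poly_monom poly_reflect_poly_nz power_add)
  qed
  then have "infinite {t. poly (monom 1 (degree p' + j) * p - monom 1 l * reflect_poly p') t = 0}"
    using infinite_super[of "- {0::real}" "{t. poly (monom 1 (degree p' + j) * p - monom 1 l * reflect_poly p') t = 0}"]
    by (auto simp: infinite_UNIV_char_0)
  then have eq: "monom 1 (degree p' + j) * p = monom 1 l * reflect_poly p'"
    using poly_roots_finite[of "monom 1 (degree p' + j) * p - monom 1 l * reflect_poly p'"] by fastforce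
  have "degree p \<le> l"
  proof (cases "p = 0")
    case False
    then have "degree p' + j + degree p = degree (monom 1 (degree p' + j) * p)"
      by (simp add: degree_mult_eq degree_monom_eq)
    also have "\<dots> \<le> l + degree p'"
      unfolding eq using degree_mult_le[of "monom 1 l" "reflect_poly p'"] degree_reflect_poly_le[of p']
      by (simp add: degree_monom_eq)
    finally show ?thesis by simp
  qed simp
  with p show thesis by (rule that)
qed

text \<open>A nonzero polynomial of degree at most \<open>l\<close> has at most \<open>l\<close>
  roots. The premise on \<open>Z\<close> also admits infinite sets, which serves to fill in a single
  missing point of a line.\<close>

lemma homogeneous_zero_on_line:
  assumes q: "real_polynomial_function q"
    and hom: "\<And>r x. r ^ j * q (r *\<^sub>R x) = r ^ l * q x"
    and zeros: "\<And>t. t \<in> Z \<Longrightarrow> q (x + t *\<^sub>R v) = 0" and Z: "finite Z \<Longrightarrow> l < card Z"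
  shows "q (x + t *\<^sub>R v) = 0"
proof -
  obtain p where p: "\<And>t. q (x + t *\<^sub>R v) = poly p t" "degree p \<le> l"
    using homogeneous_polynomial_degree[OF q hom] by blast
  have sub: "Z \<subseteq> {t. poly p t = 0}" using zeros p by auto
  have "p = 0"
  proof (rule ccontr)
    assume p0: "p \<noteq> 0"
    then have fin: "finite {t. poly p t = 0}" by (rule poly_roots_finite)
    then have "card Z \<le> degree p"
      using card_mono[OF fin sub] card_poly_roots_bound[OF p0] by linarith
    then show False using Z finite_subset[OF sub fin] p(2) by linarith
  qed
  then show ?thesis by (simp add: p)
qed

definition grid :: "'a::euclidean_space set \<Rightarrow> nat \<Rightarrow> ('a \<Rightarrow> nat) set" where
  "grid B l = (\<Pi>\<^sub>E b\<in>B. {..l})"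

text \<open>Fixing the coordinate along \<open>e1\<close> at 1 uses up the homogeneity: inside a
  hyperplane of a space of dimension \<open>d + 1\<close>, only \<open>d - 1\<close> directions are
  left to be sampled.\<close>

definition grid_pt :: "'a::euclidean_space \<Rightarrow> 'a set \<Rightarrow> ('a \<Rightarrow> nat) \<Rightarrow> 'a" where
  "grid_pt e1 B i = e1 + (\<Sum>b\<in>B. real (i b) *\<^sub>R b)"

lemma homogeneous_zero_on_grid:
  assumes q: "real_polynomial_function q"
    and hom: "\<And>r x. r ^ j * q (r *\<^sub>R x) = r ^ l * q x"
    and e: "e \<in> Basis" "e1 \<in> Basis" "e \<noteq> e1"
    and zeros: "\<And>i. i \<in> grid (Basis - {e, e1}) l \<Longrightarrow> q (grid_pt e1 (Basis - {e, e1}) i) = 0"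
    and y: "inner y e = 0"
  shows "q y = 0"
proof -
  define B where "B = Basis - {e, e1}"
  have finB: "finite B" by (simp add: B_def)
  \<comment> \<open>\<open>T\<close> is the set of coordinates released from the grid. Releasing one
    more means moving along a line that already carries the \<open>l + 1\<close> zeros with
    parameters \<open>0\<close> to \<open>l\<close>.\<close>
  have affine: "q (e1 + (\<Sum>b\<in>B. c b *\<^sub>R b)) = 0"
    if "T \<subseteq> B" "\<And>b. b \<in> B - T \<Longrightarrow> \<exists>n\<le>l. c b = real n" for T and c :: "'a \<Rightarrow> real"
  proof -
    have "finite T" using that(1) finB finite_subset by blast
    then show ?thesis using that
    proof (induction T arbitrary: c rule: finite_induct)
      case empty
      then have "\<forall>b\<in>B. \<exists>n\<le>l. c b = real n" by blast
      then obtain n where n: "\<And>b. b \<in> B \<Longrightarrow> n b \<le> l \<and> c b = real (n b)" by metis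
      have "restrict n B \<in> grid B l" using n by (auto simp: grid_def)
      from zeros[folded B_def, OF this]
      have "q (e1 + (\<Sum>b\<in>B. real (restrict n B b) *\<^sub>R b)) = 0" by (simp add: grid_pt_def)
      moreover have "(\<Sum>b\<in>B. real (restrict n B b) *\<^sub>R b) = (\<Sum>b\<in>B. c b *\<^sub>R b)"
        using n by (intro sum.cong) auto
      ultimately show ?case by simp
    next
      case (insert b0 T)
      have b0: "b0 \<in> B" using insert by blast
      have upd: "e1 + (\<Sum>b\<in>B. (c(b0 := t)) b *\<^sub>R b) = (e1 + (\<Sum>b\<in>B - {b0}. c b *\<^sub>R b)) + t *\<^sub>R b0" for t
        using finB b0 by (subst sum.remove[OF finB b0]) (simp add: algebra_simps)
      have "q ((e1 + (\<Sum>b\<in>B - {b0}. c b *\<^sub>R b)) + c b0 *\<^sub>R b0) = 0"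
      proof (rule homogeneous_zero_on_line[OF q hom])
        fix t assume "t \<in> real ` {..l}"
        then obtain n where n: "n \<le> l" "t = real n" by auto
        have "q (e1 + (\<Sum>b\<in>B. (c(b0 := t)) b *\<^sub>R b)) = 0"
        proof (rule insert.IH)
          fix b assume b: "b \<in> B - T"
          show "\<exists>n\<le>l. (c(b0 := t)) b = real n"
            using n b insert.prems(2)[of b] by (cases "b = b0") auto
        qed (use insert.prems in blast)
        then show "q ((e1 + (\<Sum>b\<in>B - {b0}. c b *\<^sub>R b)) + t *\<^sub>R b0) = 0" by (simp only: upd)
      qed (simp add: card_image)
      then show ?case using upd[of "c b0", symmetric] by simp
    qed
  qed
  have repr: "z = inner z e1 *\<^sub>R e1 + (\<Sum>b\<in>B. inner z b *\<^sub>R b)" if "inner z e = 0" for z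
  proof -
    have "z = (\<Sum>b\<in>Basis. inner z b *\<^sub>R b)" by (simp add: euclidean_representation)
    also have "\<dots> = inner z e *\<^sub>R e + (inner z e1 *\<^sub>R e1 + (\<Sum>b\<in>Basis - {e} - {e1}. inner z b *\<^sub>R b))"
      using e by (subst sum.remove[of _ e], simp, simp, subst sum.remove[of _ e1]) auto
    also have "Basis - {e} - {e1} = B" by (auto simp: B_def)
    finally show ?thesis using that by simp
  qed
  have nonzero: "q z = 0" if z: "inner z e = 0" "inner z e1 \<noteq> 0" for z
  proof -
    define s where "s = inner z e1"
    define z1 where "z1 = e1 + (\<Sum>b\<in>B. (inner z b / s) *\<^sub>R b)"
    have "z = s *\<^sub>R z1"
      using repr[OF z(1)] z(2) by (simp add: z1_def s_def scaleR_right.sum scaleR_add_right)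
    moreover have "q z1 = 0" unfolding z1_def by (rule affine[of B]) auto
    ultimately have "s ^ j * q z = 0" using hom[of s z1] by simp
    then show ?thesis using z(2) by (simp add: s_def)
  qed
  \<comment> \<open>A point with vanishing \<open>e1\<close>-coordinate cannot be scaled into the
    affine grid plane. On the line through it in direction \<open>e1\<close>, all parameters but one
    are known zeros.\<close>
  have "q (y + 0 *\<^sub>R e1) = 0"
  proof (rule homogeneous_zero_on_line[OF q hom])
    fix t assume t: "t \<in> - {- inner y e1}"
    have "inner e1 e = 0" using e by (simp add: inner_Basis)
    then show "q (y + t *\<^sub>R e1) = 0" using t y e
      by (intro nonzero) (auto simp: inner_simps inner_same_Basis)
  next
    assume "finite (- {- inner y e1})"
    then show "l < card (- {- inner y e1})" by (simp add: infinite_UNIV_char_0)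
  qed
  then show ?thesis by simp
qed

section \<open>Harmonic polynomials and their Cauchy data\<close>

lemma laplacian_dirder:
  assumes q: "real_polynomial_function q" and harm: "\<And>x. laplacian q x = 0"
  shows "laplacian (dirder v q) x = 0"
proof -
  have "laplacian (dirder v q) x = (\<Sum>b\<in>Basis. dirder v (dirder b (dirder b q)) x)"
    by (simp add: laplacian_polynomial dirder_polynomial q dirder_commute[of _ _ v])
  also have "\<dots> = dirder v (laplacian q) x"
    by (simp add: laplacian_polynomial[OF q] dirder_sum dirder_polynomial q)
  also have "laplacian q = (\<lambda>x. 0)" using harm by auto
  finally show ?thesis by (simp add: dirder_const)
qed

text \<open>The Laplace equation expresses second normal derivatives through tangential ones, so all normal
  derivatives vanish on the hyperplane orthogonal to \<open>e\<close>.\<close>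

lemma harmonic_zero_Cauchy_data:
  assumes q: "real_polynomial_function q" and harm: "\<And>x. laplacian q x = 0"
    and e: "e \<in> Basis"
    and zero: "\<And>y. inner y e = 0 \<Longrightarrow> q y = 0" "\<And>y. inner y e = 0 \<Longrightarrow> dirder e q y = 0"
  shows "q z = 0"
proof -
  define D where "D = (\<lambda>k. (dirder e ^^ k) q)"
  have D_Suc: "D (Suc k) = dirder e (D k)" for k by (simp add: D_def)
  have polyD: "real_polynomial_function (D k)" for k
    by (induction k) (simp_all add: D_def q dirder_polynomial)
  have harmD: "laplacian (D k) x = 0" for k x
  proof (induction k arbitrary: x)
    case (Suc k)
    then show ?case unfolding D_Suc using laplacian_dirder[OF polyD] by blast
  qed (simp add: D_def harm)
  have D0: "(\<forall>y. inner y e = 0 \<longrightarrow> D k y = 0) \<and> (\<forall>y. inner y e = 0 \<longrightarrow> D (Suc k) y = 0)" for k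
  proof (induction k)
    case 0
    then show ?case using zero by (simp add: D_def)
  next
    case (Suc k)
    have "D (Suc (Suc k)) y = 0" if y: "inner y e = 0" for y
    proof -
      have tang: "dirder b (dirder b (D k)) y = 0" if b: "b \<in> Basis - {e}" for b
      proof -
        have be: "inner b e = 0" using b e by (auto simp: inner_Basis)
        have vanish: "dirder b f y = 0" if "\<And>y. inner y e = 0 \<Longrightarrow> f y = 0" "inner y e = 0" for f y
        proof -
          have "(\<lambda>t. f (y + t *\<^sub>R b)) = (\<lambda>t. 0)" using that be by (auto simp: inner_simps)
          then show ?thesis by (simp add: dirder_def)
        qed
        show ?thesis by (intro vanish y) (use Suc in auto)
      qed
      have "0 = (\<Sum>b\<in>Basis. dirder b (dirder b (D k)) y)"
        using harmD[of k y] by (simp add: laplacian_polynomial[OF polyD])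
      also have "\<dots> = dirder e (dirder e (D k)) y + (\<Sum>b\<in>Basis - {e}. dirder b (dirder b (D k)) y)"
        using e by (subst sum.remove[of _ e]) auto
      also have "(\<Sum>b\<in>Basis - {e}. dirder b (dirder b (D k)) y) = 0" using tang by simp
      finally show ?thesis by (simp add: D_Suc)
    qed
    then show ?case using Suc by blast
  qed
  \<comment> \<open>The foot of the perpendicular from \<open>z\<close> to the hyperplane. All
    derivatives along the normal vanish there, so the polynomial on the normal line has only zero
    coefficients.\<close>
  define y where "y = z - inner z e *\<^sub>R e"
  have y: "inner y e = 0" using e by (simp add: y_def inner_simps inner_same_Basis)
  obtain p where p: "\<And>t. q (y + t *\<^sub>R e) = poly p t" using polynomial_on_line[OF q] by blast
  have higher: "D k (y + t *\<^sub>R e) = poly ((pderiv ^^ k) p) t" for k t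
  proof (induction k arbitrary: t)
    case (Suc k)
    have "((\<lambda>t. D k (y + t *\<^sub>R e)) has_real_derivative D (Suc k) (y + t *\<^sub>R e)) (at t)"
      unfolding D_Suc by (rule dirder_line[OF polyD])
    then have "(poly ((pderiv ^^ k) p) has_real_derivative D (Suc k) (y + t *\<^sub>R e)) (at t)"
      unfolding Suc by simp
    from DERIV_unique[OF this poly_DERIV] show ?case by simp
  qed (simp add: D_def p)
  have "coeff p k = 0" for k
  proof -
    have "poly ((pderiv ^^ k) p) 0 = 0" using higher[of k 0] D0[of k] y by simp
    then have "pochhammer 1 k * coeff p k = 0"
      using coeff_higher_pderiv[of k p 0] by (simp add: poly_0_coeff_0)
    then show ?thesis by (simp add: pochhammer_fact[symmetric])
  qed
  then have "p = 0" by (intro poly_eqI) simp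
  then show ?thesis using p[of "inner z e"] by (simp add: y_def)
qed

text \<open>The grid has \<open>(l + 1) ^ (d - 1)\<close> points when \<open>DIM('a) = d + 1\<close>, which makes this a bound for
  the dimension of the spherical harmonics of degree \<open>l\<close>.\<close>

lemma solid_harmonic_zero:
  assumes q: "real_polynomial_function q" and hom: "\<And>r x. q (r *\<^sub>R x) = r ^ l * q x"
    and harm: "\<And>x. laplacian q x = 0" and e: "e \<in> Basis" "e1 \<in> Basis" "e \<noteq> e1"
    and zeros: "\<And>i. i \<in> grid (Basis - {e, e1}) l \<Longrightarrow> q (grid_pt e1 (Basis - {e, e1}) i) = 0"
      "\<And>i. i \<in> grid (Basis - {e, e1}) l \<Longrightarrow> dirder e q (grid_pt e1 (Basis - {e, e1}) i) = 0"
  shows "q z = 0"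
proof (rule harmonic_zero_Cauchy_data[OF q harm e(1)])
  show "q y = 0" if "inner y e = 0" for y
    using homogeneous_zero_on_grid[OF q _ e zeros(1) that, of 0 l] hom by simp
  have "r ^ 1 * dirder e q (r *\<^sub>R x) = r ^ l * dirder e q x" for r x
  proof -
    have eq: "(\<lambda>t. q (r *\<^sub>R x + (r * t) *\<^sub>R e)) = (\<lambda>t. r ^ l * q (x + t *\<^sub>R e))"
      using hom[of r "x + _ *\<^sub>R e"] by (simp add: scaleR_add_right)
    have "((\<lambda>t. q (r *\<^sub>R x + (r * t) *\<^sub>R e)) has_real_derivative dirder e q (r *\<^sub>R x) * r) (at 0)"
      using DERIV_chain2[OF _ DERIV_cmult_Id, of "\<lambda>t. q (r *\<^sub>R x + t *\<^sub>R e)" _ r 0 UNIV]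
        dirder_line[OF q, of "r *\<^sub>R x" e 0] by simp
    moreover have "((\<lambda>t. r ^ l * q (x + t *\<^sub>R e)) has_real_derivative r ^ l * dirder e q x) (at 0)"
      using DERIV_cmult[OF dirder_line[OF q, of x e 0]] by simp
    ultimately have "dirder e q (r *\<^sub>R x) * r = r ^ l * dirder e q x"
      unfolding eq by (rule DERIV_unique)
    then show ?thesis by (simp add: mult.commute)
  qed
  then show "dirder e q y = 0" if "inner y e = 0" for y
    by (rule homogeneous_zero_on_grid[OF dirder_polynomial[OF q] _ e zeros(2) that])
qed

section \<open>Reflection invariance of the surface measure\<close>

text \<open>Both sides are the integral of \<open>f (x + y) * g y\<close>; hence \<open>\<nu>\<close> is a multiple of Lebesgue measure.\<close>

lemma translation_invariant_nn_integral:
  fixes \<nu> :: "'a::euclidean_space measure" and f g :: "'a \<Rightarrow> ennreal"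
  assumes sf: "sigma_finite_measure \<nu>" and sets: "sets \<nu> = sets borel"
    and inv: "\<And>a. distr \<nu> borel (\<lambda>x. x + a) = \<nu>"
    and f[measurable]: "f \<in> borel_measurable borel" and g[measurable]: "g \<in> borel_measurable borel"
  shows "(\<integral>\<^sup>+x. f x \<partial>\<nu>) * (\<integral>\<^sup>+y. g y \<partial>lborel) = (\<integral>\<^sup>+x. g (- x) \<partial>\<nu>) * (\<integral>\<^sup>+y. f y \<partial>lborel)"
proof -
  interpret \<nu>: sigma_finite_measure \<nu> by (rule sf)
  interpret P: pair_sigma_finite \<nu> lborel ..
  have [measurable_cong]: "sets \<nu> = sets borel" by (rule sets)
  have shift\<nu>: "(\<integral>\<^sup>+x. h (x + a) \<partial>\<nu>) = (\<integral>\<^sup>+x. h x \<partial>\<nu>)" if [measurable]: "h \<in> borel_measurable borel" for h :: "'a \<Rightarrow> ennreal" and a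
  proof -
    have "(\<integral>\<^sup>+x. h x \<partial>\<nu>) = (\<integral>\<^sup>+x. h x \<partial>(distr \<nu> borel (\<lambda>x. x + a)))" by (simp add: inv)
    also have "\<dots> = (\<integral>\<^sup>+x. h (x + a) \<partial>\<nu>)" by (subst nn_integral_distr) auto
    finally show ?thesis by simp
  qed
  have shift: "(\<integral>\<^sup>+x. h (a + x) \<partial>lborel) = (\<integral>\<^sup>+x. h x \<partial>lborel)" if [measurable]: "h \<in> borel_measurable borel" for h :: "'a \<Rightarrow> ennreal" and a
  proof -
    have "(\<integral>\<^sup>+x. h x \<partial>lborel) = (\<integral>\<^sup>+x. h x \<partial>(distr lborel borel ((+) a)))" by (simp add: lborel_distr_plus)
    also have "\<dots> = (\<integral>\<^sup>+x. h (a + x) \<partial>lborel)" by (subst nn_integral_distr) auto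
    finally show ?thesis by simp
  qed
  have "(\<integral>\<^sup>+x. f x \<partial>\<nu>) * (\<integral>\<^sup>+y. g y \<partial>lborel) = (\<integral>\<^sup>+y. (\<integral>\<^sup>+x. f (x + y) * g y \<partial>\<nu>) \<partial>lborel)"
    by (simp add: nn_integral_multc nn_integral_cmult shift\<nu>)
  also have "\<dots> = (\<integral>\<^sup>+x. (\<integral>\<^sup>+y. f (x + y) * g y \<partial>lborel) \<partial>\<nu>)"
    by (rule P.Fubini') measurable
  also have "\<dots> = (\<integral>\<^sup>+x. (\<integral>\<^sup>+y. f y * g (y - x) \<partial>lborel) \<partial>\<nu>)"
  proof (rule nn_integral_cong)
    fix x
    show "(\<integral>\<^sup>+y. f (x + y) * g y \<partial>lborel) = (\<integral>\<^sup>+y. f y * g (y - x) \<partial>lborel)"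
      using shift[of "\<lambda>y. f y * g (y - x)" x] by simp
  qed
  also have "\<dots> = (\<integral>\<^sup>+y. (\<integral>\<^sup>+x. f y * g (y - x) \<partial>\<nu>) \<partial>lborel)"
    by (rule P.Fubini'[symmetric]) measurable
  also have "\<dots> = (\<integral>\<^sup>+y. f y * (\<integral>\<^sup>+x. g (- x) \<partial>\<nu>) \<partial>lborel)"
  proof (rule nn_integral_cong)
    fix y
    have "(\<integral>\<^sup>+x. g (y - x) \<partial>\<nu>) = (\<integral>\<^sup>+x. g (- x) \<partial>\<nu>)"
      using shift\<nu>[of "\<lambda>x. g (- x)" "- y"] by simp
    then show "(\<integral>\<^sup>+x. f y * g (y - x) \<partial>\<nu>) = f y * (\<integral>\<^sup>+x. g (- x) \<partial>\<nu>)"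
      by (simp add: nn_integral_cmult)
  qed
  also have "\<dots> = (\<integral>\<^sup>+x. g (- x) \<partial>\<nu>) * (\<integral>\<^sup>+y. f y \<partial>lborel)"
    by (simp add: nn_integral_multc mult.commute)
  finally show ?thesis .
qed

text \<open>Since \<open>T x + a = T (x + T a)\<close>, the image measure is again translation
  invariant, hence a multiple of Lebesgue measure. The unit ball, which is invariant under
  \<open>T\<close> and under negation and has positive finite volume, forces the factor to be
  1.\<close>

lemma lborel_distr_isometric_involution:
  fixes T :: "'a::euclidean_space \<Rightarrow> 'a"
  assumes lin: "linear T" and norm: "\<And>x. norm (T x) = norm x" and inv: "\<And>x. T (T x) = x"
  shows "distr lborel borel T = lborel"
proof -
  have cont: "continuous_on UNIV T" using lin by (simp add: linear_continuous_on linear_conv_bounded_linear)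
  then have [measurable]: "T \<in> borel_measurable borel" by (rule borel_measurable_continuous_onI)
  let ?\<nu> = "distr lborel borel T"
  have tinv: "distr ?\<nu> borel (\<lambda>x. x + a) = ?\<nu>" for a
  proof -
    have "distr ?\<nu> borel (\<lambda>x. x + a) = distr lborel borel (\<lambda>x. T (T a + x))"
      by (subst distr_distr) (simp_all add: o_def linear_add[OF lin] inv add.commute)
    also have "\<dots> = distr (distr lborel borel ((+) (T a))) borel T"
      by (subst distr_distr) (simp_all add: o_def)
    finally show ?thesis by (simp add: lborel_distr_plus)
  qed
  have sf: "sigma_finite_measure ?\<nu>"
  proof -
    have "range (\<lambda>n. cball (0::'a) (real n)) \<subseteq> sets ?\<nu>" by auto
    moreover have "(\<Union>n. cball (0::'a) (real n)) = UNIV"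
      by (auto simp: real_arch_simple)
    moreover have "emeasure ?\<nu> (cball 0 (real n)) \<noteq> \<infinity>" for n
    proof -
      have "T -` cball 0 (real n) = cball 0 (real n)" by (auto simp: norm)
      then show ?thesis using emeasure_lborel_cball_finite[of 0 "real n"] by (simp add: emeasure_distr less_top[symmetric])
    qed
    ultimately show ?thesis
      by (intro sigma_finite_measure.intro exI[of _ "range (\<lambda>n. cball (0::'a) (real n))"]) auto
  qed
  let ?g = "indicator (ball (0::'a) 1) :: 'a \<Rightarrow> ennreal"
  have g: "?g \<in> borel_measurable borel" by (rule borel_measurable_indicator) simp
  define c where "c = emeasure lborel (ball (0::'a) 1)"
  have "unit_ball_vol (real DIM('a)) \<noteq> 0"
    using unit_ball_vol_pos[of "real DIM('a)"] by linarith
  then have c: "c \<noteq> 0" "c \<noteq> \<infinity>"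
    using emeasure_lborel_ball_finite[of "0::'a" 1]
    by (auto simp: c_def less_top[symmetric] emeasure_ball)
  have gT: "(\<integral>\<^sup>+x. ?g (- x) \<partial>?\<nu>) = c"
  proof -
    have "(\<integral>\<^sup>+x. ?g (- x) \<partial>?\<nu>) = (\<integral>\<^sup>+x. ?g x \<partial>?\<nu>)"
      by (intro nn_integral_cong) (simp add: indicator_def)
    also have "\<dots> = emeasure ?\<nu> (ball 0 1)" by simp
    also have "\<dots> = emeasure lborel (T -` ball 0 1)" by (simp add: emeasure_distr)
    also have "T -` ball 0 1 = ball 0 1" by (auto simp: norm)
    finally show ?thesis by (simp add: c_def)
  qed
  show ?thesis
  proof (rule measure_eqI)
    fix A assume "A \<in> sets ?\<nu>"
    then have A[measurable]: "A \<in> sets borel" by simp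
    have "emeasure ?\<nu> A * c = c * emeasure lborel A"
      using translation_invariant_nn_integral[OF sf _ tinv, of "indicator A" ?g] g
      by (simp add: gT c_def)
    then show "emeasure ?\<nu> A = emeasure lborel A"
      using c ennreal_mult_cancel_left[of c "emeasure ?\<nu> A" "emeasure lborel A"] by (auto simp: mult.commute)
  qed simp
qed

section \<open>Surface measure as a radial image of Lebesgue measure\<close>

lemma space_sphere_measure[simp]: "space (sphere_measure :: 'a::euclidean_space measure) = sphere 0 1"
  by (simp add: sphere_measure_def space_scale_measure)

lemma sets_sphere_measure: "sets (sphere_measure :: 'a::euclidean_space measure) = sets (restrict_space borel (sphere 0 1))"
  by (simp add: sphere_measure_def)

lemma radial_measurable[measurable]:
  "(\<lambda>x::'a::euclidean_space. x /\<^sub>R norm x) \<in> restrict_space lborel (ball 0 1 - {0}) \<rightarrow>\<^sub>M restrict_space borel (sphere 0 1)"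
proof (rule measurable_restrict_space2)
  show "(\<lambda>x::'a. x /\<^sub>R norm x) \<in> space (restrict_space lborel (ball 0 1 - {0})) \<rightarrow> sphere 0 1"
    by (auto simp: space_restrict_space)
  show "(\<lambda>x::'a. x /\<^sub>R norm x) \<in> borel_measurable (restrict_space lborel (ball 0 1 - {0}))"
    by (rule measurable_restrict_space1) measurable
qed

lemma finite_sphere_measure: "finite_measure (sphere_measure :: 'a::euclidean_space measure)"
proof (rule finite_measureI)
  have "emeasure (distr (restrict_space lborel (ball 0 1 - {0::'a})) (restrict_space borel (sphere 0 1))
            (\<lambda>x. x /\<^sub>R norm x)) (sphere 0 1) \<le> emeasure lborel (ball (0::'a) 1)"
    by (subst emeasure_distr)
       (auto simp: sets_restrict_space_iff emeasure_restrict_space space_restrict_space intro!: emeasure_mono)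
  also have "\<dots> < \<infinity>" by (rule emeasure_lborel_ball_finite)
  finally show "emeasure (sphere_measure :: 'a measure) (space sphere_measure) \<noteq> \<infinity>"
    unfolding sphere_measure_def
    by (simp add: space_scale_measure emeasure_scale_measure ennreal_mult_eq_top_iff less_top)
qed

text \<open>A linear isometry commutes with radial projection, so invariance passes from the
  punctured ball to the sphere.\<close>

lemma sphere_measure_distr_isometry:
  fixes T :: "'a::euclidean_space \<Rightarrow> 'a"
  assumes lin: "linear T" and norm: "\<And>x. norm (T x) = norm x" and inv: "\<And>x. T (T x) = x"
  shows "distr sphere_measure sphere_measure T = (sphere_measure :: 'a measure)"
proof -
  have cont: "continuous_on UNIV T" using lin by (simp add: linear_continuous_on linear_conv_bounded_linear)
  then have Tb[measurable]: "T \<in> borel_measurable borel" by (rule borel_measurable_continuous_onI)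
  let ?B = "restrict_space lborel (ball 0 1 - {0::'a})" and ?S = "restrict_space borel (sphere (0::'a) 1)"
  let ?r = "\<lambda>x::'a. x /\<^sub>R norm x"
  have T0: "T x = 0 \<longleftrightarrow> x = 0" for x using norm[of x] by (metis norm_eq_zero)
  have TB[measurable]: "T \<in> ?B \<rightarrow>\<^sub>M ?B"
    by (intro measurable_restrict_space2 measurable_restrict_space1)
       (auto simp: space_restrict_space norm T0)
  have TS[measurable]: "T \<in> ?S \<rightarrow>\<^sub>M ?S"
    by (intro measurable_restrict_space2 measurable_restrict_space1)
       (auto simp: space_restrict_space norm)
  have invB: "distr ?B ?B T = ?B"
  proof (rule measure_eqI)
    fix A assume "A \<in> sets (distr ?B ?B T)"
    then have A: "A \<in> sets borel" "A \<subseteq> ball 0 1 - {0}" by (auto simp: sets_restrict_space_iff)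
    have sub: "T -` A \<subseteq> ball 0 1 - {0}"
    proof
      fix x assume "x \<in> T -` A"
      then have "T x \<in> ball 0 1 - {0}" using A by auto
      then show "x \<in> ball 0 1 - {0}" using norm T0 by auto
    qed
    have "emeasure (distr ?B ?B T) A = emeasure ?B (T -` A \<inter> space ?B)"
      using A by (intro emeasure_distr TB) (auto simp: sets_restrict_space_iff)
    also have "\<dots> = emeasure lborel (T -` A)"
      using A sub measurable_sets[OF Tb A(1)]
      by (subst emeasure_restrict_space) (auto simp: space_restrict_space Int_absorb2)
    also have "\<dots> = emeasure (distr lborel borel T) A"
      using A by (simp add: emeasure_distr)
    also have "\<dots> = emeasure ?B A"
      using A by (simp add: lborel_distr_isometric_involution[OF lin norm inv] emeasure_restrict_space)
    finally show "emeasure (distr ?B ?B T) A = emeasure ?B A" .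
  qed simp
  have "distr (distr ?B ?S ?r) ?S T = distr ?B ?S (T \<circ> ?r)"
    by (rule distr_distr) measurable
  also have "\<dots> = distr ?B ?S (?r \<circ> T)"
    by (rule distr_cong) (auto simp: linear_scale[OF lin] norm)
  also have "\<dots> = distr (distr ?B ?B T) ?S ?r"
    by (rule distr_distr[symmetric]) measurable
  also have "\<dots> = distr ?B ?S ?r" unfolding invB ..
  finally have base: "distr (distr ?B ?S ?r) ?S T = distr ?B ?S ?r" .
  show ?thesis
  proof (rule measure_eqI)
    fix A assume "A \<in> sets (distr sphere_measure (sphere_measure :: 'a measure) T)"
    then have A: "A \<in> sets ?S" by (simp add: sets_sphere_measure)
    have TSm: "T \<in> sphere_measure \<rightarrow>\<^sub>M (sphere_measure :: 'a measure)"
      using TS by (simp cong: measurable_cong_sets add: sets_sphere_measure)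
    have "emeasure (distr sphere_measure sphere_measure T) A = emeasure (sphere_measure :: 'a measure) (T -` A \<inter> sphere 0 1)"
      using A by (subst emeasure_distr[OF TSm]) (auto simp: sets_sphere_measure)
    also have "\<dots> = of_nat DIM('a) * emeasure (distr (distr ?B ?S ?r) ?S T) A"
    proof -
      have "T \<in> distr ?B ?S ?r \<rightarrow>\<^sub>M ?S" by simp
      then have "emeasure (distr (distr ?B ?S ?r) ?S T) A = emeasure (distr ?B ?S ?r) (T -` A \<inter> sphere 0 1)"
        using A by (subst emeasure_distr[of T]) (simp_all add: space_restrict_space)
      then show ?thesis by (simp add: sphere_measure_def emeasure_scale_measure)
    qed
    also have "\<dots> = emeasure sphere_measure A"
      unfolding base by (simp add: sphere_measure_def emeasure_scale_measure)
    finally show "emeasure (distr sphere_measure sphere_measure T) A = emeasure sphere_measure A" .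
  qed simp
qed

section \<open>Spherical harmonic expansions\<close>

lemma sphere_integrable:
  assumes "continuous_on (sphere 0 1) (f :: 'a::euclidean_space \<Rightarrow> real)"
  shows "integrable sphere_measure f"
proof -
  interpret finite_measure "sphere_measure :: 'a measure" by (rule finite_sphere_measure)
  have meas: "f \<in> borel_measurable sphere_measure"
    using borel_measurable_continuous_on_restrict[OF assms]
    by (simp cong: measurable_cong_sets add: sets_sphere_measure)
  have "bounded (f ` sphere 0 1)"
    using assms by (intro compact_imp_bounded compact_continuous_image) auto
  then obtain B where "\<And>x. x \<in> sphere 0 1 \<Longrightarrow> norm (f x) \<le> B" unfolding bounded_iff by blast
  then show ?thesis by (intro integrable_const_bound[of _ B] meas AE_I2) simp
qed

lemma sphere_inner_commute: "sphere_inner f g = sphere_inner g f"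
  by (simp add: sphere_inner_def mult.commute)

lemma sphere_inner_sum_left:
  assumes "\<And>z. z \<in> sphere 0 1 \<Longrightarrow> f z = (\<Sum>i\<in>I. a i * F i z)"
    and "\<And>i. i \<in> I \<Longrightarrow> continuous_on (sphere 0 1) (F i)" and "continuous_on (sphere 0 1) g"
  shows "sphere_inner f g = (\<Sum>i\<in>I. a i * sphere_inner (F i) g)"
proof -
  have "sphere_inner f g = (\<integral>z. (\<Sum>i\<in>I. a i * (F i z * g z)) \<partial>sphere_measure)"
    unfolding sphere_inner_def using assms(1)
    by (intro Bochner_Integration.integral_cong) (auto simp: sum_distrib_right mult.assoc)
  also have "\<dots> = (\<Sum>i\<in>I. \<integral>z. a i * (F i z * g z) \<partial>sphere_measure)"
    using assms by (intro Bochner_Integration.integral_sum integrable_mult_right sphere_integrable continuous_intros) auto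
  finally show ?thesis by (simp add: sphere_inner_def)
qed

lemma spherical_harmonic_continuous:
  assumes "spherical_harmonic l f"
  shows "continuous_on (sphere 0 1) f"
proof -
  obtain q where q: "real_polynomial_function q" "\<And>x. x \<in> sphere 0 1 \<Longrightarrow> f x = q x"
    using assms unfolding spherical_harmonic_def by blast
  have "continuous_on (sphere 0 1) q"
    using q(1) by (simp add: continuous_on_polymonial_function real_polynomial_function_eq)
  then show ?thesis by (rule continuous_on_eq) (simp add: q(2))
qed

lemma sphere_inner_reflection:
  assumes "continuous_on (sphere 0 1) f" "continuous_on (sphere 0 1) g"
  shows "sphere_inner (\<lambda>z. f (reflection w z)) (\<lambda>z. g (reflection w z)) = sphere_inner f g"
proof -
  let ?T = "reflection w" and ?M = "sphere_measure :: 'a measure"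
  have T: "?T \<in> ?M \<rightarrow>\<^sub>M ?M"
  proof -
    have "?T \<in> borel_measurable borel"
      by (intro borel_measurable_continuous_onI linear_continuous_on reflection_bounded_linear)
    then have "?T \<in> restrict_space borel (sphere 0 1) \<rightarrow>\<^sub>M restrict_space borel (sphere 0 1)"
      by (intro measurable_restrict_space2 measurable_restrict_space1) (auto simp: space_restrict_space)
    then show ?thesis by (simp cong: measurable_cong_sets add: sets_sphere_measure)
  qed
  have "(\<lambda>z. f z * g z) \<in> borel_measurable ?M"
    using sphere_integrable[OF continuous_on_mult[OF assms]] by (rule borel_measurable_integrable)
  then have "(\<integral>z. f z * g z \<partial>distr ?M ?M ?T) = (\<integral>z. f (?T z) * g (?T z) \<partial>?M)"
    by (rule integral_distr[OF T])
  then show ?thesis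
    unfolding sphere_measure_distr_isometry[OF reflection_linear norm_reflection reflection_idem]
    by (simp add: sphere_inner_def)
qed

section \<open>Orthonormal harmonics: sums of squares, dimension, convergence of zonal
  series\<close>

context
  fixes Y :: "nat \<Rightarrow> nat \<Rightarrow> 'a::euclidean_space \<Rightarrow> real" and Nd :: "nat \<Rightarrow> nat"
  assumes basis: "harmonic_basis Y Nd"
begin

lemma harmonic_Y: "\<mu> < Nd l \<Longrightarrow> spherical_harmonic l (Y l \<mu>)"
  using basis by (simp add: harmonic_basis_def)

lemma continuous_Y: "\<mu> < Nd l \<Longrightarrow> continuous_on (sphere 0 1) (Y l \<mu>)"
  by (rule spherical_harmonic_continuous[OF harmonic_Y])

lemma orthonormal_Y:
  "\<mu> < Nd l \<Longrightarrow> \<mu>' < Nd l' \<Longrightarrow> sphere_inner (Y l \<mu>) (Y l' \<mu>') = (if l = l' \<and> \<mu> = \<mu>' then 1 else 0)"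
  using basis by (simp add: harmonic_basis_def)

text \<open>The reflection exchanging \<open>x\<close> and \<open>y\<close> acts on the harmonics of
  degree \<open>l\<close> by a matrix \<open>Q\<close>. Invariance of the inner product makes its
  rows orthonormal; being square, it then has orthonormal columns, and these are what preserves the
  sum of squares.\<close>

lemma harmonic_kernel_constant:
  assumes xy: "x \<in> sphere 0 1" "y \<in> sphere 0 1"
  shows "(\<Sum>\<mu><Nd l. (Y l \<mu> x)\<^sup>2) = (\<Sum>\<mu><Nd l. (Y l \<mu> y)\<^sup>2)"
proof -
  define T where "T = reflection (x - y)"
  let ?n = "Nd l"
  have Tx: "T x = y" using xy by (simp add: T_def reflection_swap)
  have "\<forall>\<mu><?n. \<exists>a. \<forall>z\<in>sphere 0 1. Y l \<mu> (T z) = (\<Sum>\<nu><?n. a \<nu> * Y l \<nu> z)"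
    using spherical_harmonic_reflection[OF harmonic_Y] basis
    unfolding T_def harmonic_basis_def by blast
  then obtain a where a: "\<And>\<mu> z. \<mu> < ?n \<Longrightarrow> z \<in> sphere 0 1 \<Longrightarrow> Y l \<mu> (T z) = (\<Sum>\<nu><?n. a \<mu> \<nu> * Y l \<nu> z)"
    by metis
  define Q where "Q = mat ?n ?n (\<lambda>(\<mu>, \<nu>). a \<mu> \<nu>)"
  have row: "(\<Sum>\<nu><?n. a \<mu> \<nu> * a \<mu>' \<nu>) = (if \<mu> = \<mu>' then 1 else 0)" if \<mu>: "\<mu> < ?n" "\<mu>' < ?n" for \<mu> \<mu>'
  proof -
    have contT: "continuous_on (sphere 0 1) (\<lambda>z. Y l \<mu>' (T z))"
      unfolding T_def by (rule spherical_harmonic_continuous[OF spherical_harmonic_reflection[OF harmonic_Y[OF \<mu>(2)]]])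
    have single: "sphere_inner (Y l \<nu>) (\<lambda>z. Y l \<mu>' (T z)) = a \<mu>' \<nu>" if \<nu>: "\<nu> < ?n" for \<nu>
    proof -
      have "sphere_inner (\<lambda>z. Y l \<mu>' (T z)) (Y l \<nu>) = (\<Sum>i<?n. a \<mu>' i * sphere_inner (Y l i) (Y l \<nu>))"
        by (rule sphere_inner_sum_left) (use a \<mu> \<nu> continuous_Y in auto)
      also have "\<dots> = a \<mu>' \<nu>" using \<nu> by (simp add: orthonormal_Y if_distrib cong: if_cong)
      finally show ?thesis by (simp add: sphere_inner_commute)
    qed
    have "(if \<mu> = \<mu>' then 1 else 0) = sphere_inner (Y l \<mu>) (Y l \<mu>')" using \<mu> by (simp add: orthonormal_Y)
    also have "\<dots> = sphere_inner (\<lambda>z. Y l \<mu> (T z)) (\<lambda>z. Y l \<mu>' (T z))"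
      unfolding T_def using \<mu> by (intro sphere_inner_reflection[symmetric] continuous_Y)
    also have "\<dots> = (\<Sum>\<nu><?n. a \<mu> \<nu> * sphere_inner (Y l \<nu>) (\<lambda>z. Y l \<mu>' (T z)))"
      by (rule sphere_inner_sum_left) (use a \<mu> contT continuous_Y in auto)
    also have "\<dots> = (\<Sum>\<nu><?n. a \<mu> \<nu> * a \<mu>' \<nu>)" using single by simp
    finally show ?thesis by simp
  qed
  have "Q * Q\<^sup>T = 1\<^sub>m ?n"
    using row by (intro eq_matI) (auto simp: Q_def scalar_prod_def lessThan_atLeast0)
  then have "Q\<^sup>T * Q = 1\<^sub>m ?n"
    by (intro mat_mult_left_right_inverse[of Q]) (auto simp: Q_def)
  then have "(Q\<^sup>T * Q) $$ (i, j) = (if i = j then 1 else 0)" if "i < ?n" "j < ?n" for i j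
    using that by simp
  then have col: "(\<Sum>\<mu><?n. a \<mu> i * a \<mu> j) = (if i = j then 1 else 0)" if "i < ?n" "j < ?n" for i j
    using that by (simp add: Q_def scalar_prod_def lessThan_atLeast0)
  have "(\<Sum>\<mu><?n. (Y l \<mu> y)\<^sup>2) = (\<Sum>\<mu><?n. (\<Sum>i<?n. a \<mu> i * Y l i x) * (\<Sum>j<?n. a \<mu> j * Y l j x))"
    using a[OF _ xy(1)] by (simp add: Tx power2_eq_square)
  also have "\<dots> = (\<Sum>\<mu><?n. \<Sum>i<?n. \<Sum>j<?n. (a \<mu> i * a \<mu> j) * (Y l i x * Y l j x))"
    by (simp add: sum_product mult_ac)
  also have "\<dots> = (\<Sum>i<?n. \<Sum>j<?n. \<Sum>\<mu><?n. (a \<mu> i * a \<mu> j) * (Y l i x * Y l j x))"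
    by (subst sum.swap, rule sum.cong, rule refl, rule sum.swap)
  also have "\<dots> = (\<Sum>i<?n. \<Sum>j<?n. if i = j then Y l i x * Y l j x else 0)"
    by (intro sum.cong refl) (simp add: col flip: sum_distrib_right)
  also have "\<dots> = (\<Sum>i<?n. (Y l i x)\<^sup>2)"
    by (simp add: power2_eq_square)
  finally show ?thesis by simp
qed

text \<open>Each of the \<open>Nd l\<close> squares has integral 1, and their sum is constant. The
  product form avoids having to know that the sphere has nonzero measure.\<close>

lemma harmonic_kernel_value:
  assumes x: "x \<in> sphere 0 1"
  shows "(\<Sum>\<mu><Nd l. (Y l \<mu> x)\<^sup>2) * measure sphere_measure (sphere (0::'a) 1) = Nd l"
proof -
  have "real (Nd l) = (\<Sum>\<mu><Nd l. sphere_inner (Y l \<mu>) (Y l \<mu>))" by (simp add: orthonormal_Y)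
  also have "\<dots> = (\<integral>z. (\<Sum>\<mu><Nd l. Y l \<mu> z * Y l \<mu> z) \<partial>sphere_measure)"
    unfolding sphere_inner_def
    by (intro Bochner_Integration.integral_sum[symmetric] sphere_integrable continuous_intros continuous_Y) auto
  also have "\<dots> = (\<integral>z. (\<Sum>\<mu><Nd l. (Y l \<mu> x)\<^sup>2) \<partial>(sphere_measure :: 'a measure))"
    using harmonic_kernel_constant[OF _ x]
    by (intro Bochner_Integration.integral_cong) (auto simp: power2_eq_square)
  finally show ?thesis by (simp add: mult.commute)
qed

lemma harmonic_coeffs_zero:
  assumes "finite L" and zero: "\<And>z. z \<in> sphere 0 1 \<Longrightarrow> (\<Sum>l\<in>L. \<Sum>\<mu><Nd l. a l \<mu> * Y l \<mu> z) = 0"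
    and "l \<in> L" "\<mu> < Nd l"
  shows "a l \<mu> = 0"
proof -
  have "0 = sphere_inner (\<lambda>z. 0) (Y l \<mu>)" by (simp add: sphere_inner_def)
  also have "\<dots> = (\<Sum>(l', \<mu>')\<in>(SIGMA l:L. {..<Nd l}). a l' \<mu>' * sphere_inner (Y l' \<mu>') (Y l \<mu>))"
    unfolding case_prod_beta
    by (rule sphere_inner_sum_left[where F = "\<lambda>k. Y (fst k) (snd k)"])
       (use assms zero continuous_Y in \<open>auto simp: sum.Sigma case_prod_beta\<close>)
  also have "\<dots> = (\<Sum>k\<in>(SIGMA l:L. {..<Nd l}). if k = (l, \<mu>) then a l \<mu> else 0)"
    by (intro sum.cong) (use assms in \<open>auto simp: orthonormal_Y split: if_splits\<close>)
  also have "\<dots> = a l \<mu>" using assms by simp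
  finally show ?thesis by simp
qed

text \<open>With more harmonics than conditions, some nontrivial combination would have value and
  normal derivative zero at every grid point. By \<open>solid_harmonic_zero\<close> it would vanish
  identically, against linear independence.\<close>

lemma dim_harmonics_le:
  assumes dim: "DIM('a) = d + 1" and d: "d \<ge> 1"
  shows "Nd l \<le> 2 * (l + 1) ^ (d - 1)"
proof (rule ccontr)
  assume "\<not> ?thesis"
  then have less: "2 * (l + 1) ^ (d - 1) < Nd l" by simp
  obtain e :: 'a where e: "e \<in> Basis" using nonempty_Basis by blast
  have "card (Basis - {e}) = d" using e dim by simp
  then obtain e1 where e1: "e1 \<in> Basis" "e \<noteq> e1" using d by (metis card.empty DiffE ex_in_conv insertI1 not_one_le_zero)
  define B where "B = Basis - {e, e1}"
  have cardB: "card B = d - 1" using e e1 dim by (simp add: B_def card_Diff_subset)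
  define G where "G = grid B l"
  have finB: "finite B" by (simp add: B_def)
  have cardG: "card G = (l + 1) ^ (d - 1)" unfolding G_def grid_def using finB cardB by (simp add: card_PiE)
  have finG: "finite G" unfolding G_def grid_def using finB by (intro finite_PiE) auto
  \<comment> \<open>The Boolean selects between value and normal derivative at a grid point, whence
    the factor 2 in the bound.\<close>
  let ?I = "(UNIV :: bool set) \<times> G"
  define n where "n = 2 * (l + 1) ^ (d - 1)"
  have "card ?I = n" using cardG by (simp add: card_cartesian_product n_def)
  then obtain h where h: "bij_betw h {..<n} ?I"
    using ex_bij_betw_nat_finite[of ?I] finG by (auto simp: lessThan_atLeast0)
  have "\<forall>\<mu><Nd l. \<exists>q. real_polynomial_function q \<and> (\<forall>r x. q (r *\<^sub>R x) = r ^ l * q x) \<and>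
          (\<forall>x. laplacian q x = 0) \<and> (\<forall>x\<in>sphere 0 1. Y l \<mu> x = q x)"
    using harmonic_Y unfolding spherical_harmonic_def by blast
  then obtain q where q: "\<And>\<mu>. \<mu> < Nd l \<Longrightarrow> real_polynomial_function (q \<mu>)"
    "\<And>\<mu> r x. \<mu> < Nd l \<Longrightarrow> q \<mu> (r *\<^sub>R x) = r ^ l * q \<mu> x"
    "\<And>\<mu> x. \<mu> < Nd l \<Longrightarrow> laplacian (q \<mu>) x = 0"
    "\<And>\<mu> x. \<mu> < Nd l \<Longrightarrow> x \<in> sphere 0 1 \<Longrightarrow> Y l \<mu> x = q \<mu> x" by metis
  define F where "F = (\<lambda>(b, i) f. if b then f (grid_pt e1 B i) else dirder e f (grid_pt e1 B i))"
  define A where "A = mat n (Nd l) (\<lambda>(j, \<mu>). F (h j) (q \<mu>))"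
  have "A \<in> carrier_mat n (Nd l)" by (simp add: A_def)
  from wide_matrix_kernel[OF this] less obtain v
    where v: "v \<in> carrier_vec (Nd l)" "v \<noteq> 0\<^sub>v (Nd l)" "A *\<^sub>v v = 0\<^sub>v n" unfolding n_def by blast
  define Q where "Q = (\<lambda>x. \<Sum>\<mu><Nd l. v $ \<mu> * q \<mu> x)"
  have polyt: "real_polynomial_function (\<lambda>x. v $ \<mu> * q \<mu> x)" if "\<mu> < Nd l" for \<mu>
    by (rule real_polynomial_function.intros(4)[OF real_polynomial_function.intros(2) q(1)[OF that]])
  have polyQ: "real_polynomial_function Q"
    unfolding Q_def using polyt by (intro real_polynomial_function_sum) auto
  have dirQ: "dirder w Q = (\<lambda>x. \<Sum>\<mu><Nd l. v $ \<mu> * dirder w (q \<mu>) x)" for w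
    unfolding Q_def using polyt q(1) by (subst dirder_sum) (auto simp: dirder_cmult)
  have FQ: "F k Q = 0" if "k \<in> ?I" for k
  proof -
    have "k \<in> h ` {..<n}" using h that by (simp only: bij_betw_def)
    then obtain j where j: "j < n" "h j = k" by auto
    have "F k Q = (\<Sum>\<mu><Nd l. v $ \<mu> * F k (q \<mu>))"
      using dirQ by (cases k) (simp add: F_def Q_def)
    also have "\<dots> = (A *\<^sub>v v) $ j"
      using j v(1) by (simp add: A_def scalar_prod_def lessThan_atLeast0 mult.commute)
    finally show ?thesis using v j by simp
  qed
  have "Q z = 0" for z
  proof (rule solid_harmonic_zero[where l = l, OF polyQ _ _ e e1, folded B_def, folded G_def])
    show "Q (r *\<^sub>R x) = r ^ l * Q x" for r x
      using q(2) by (simp add: Q_def sum_distrib_left mult.left_commute)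
    show "laplacian Q x = 0" for x
    proof -
      have "laplacian Q x = (\<Sum>b\<in>Basis. \<Sum>\<mu><Nd l. v $ \<mu> * dirder b (dirder b (q \<mu>)) x)"
      proof -
        have "dirder b (dirder b Q) x = (\<Sum>\<mu><Nd l. v $ \<mu> * dirder b (dirder b (q \<mu>)) x)" for b
        proof -
          have "real_polynomial_function (\<lambda>x. v $ \<mu> * dirder b (q \<mu>) x)" if "\<mu> < Nd l" for \<mu>
            by (rule real_polynomial_function.intros(4)[OF real_polynomial_function.intros(2) dirder_polynomial[OF q(1)[OF that]]])
          then show ?thesis
            unfolding dirQ by (subst dirder_sum) (auto simp: dirder_cmult dirder_polynomial q(1))
        qed
        then show ?thesis by (simp add: laplacian_polynomial[OF polyQ])
      qed
      also have "\<dots> = (\<Sum>\<mu><Nd l. v $ \<mu> * laplacian (q \<mu>) x)"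
        by (subst sum.swap) (simp add: laplacian_polynomial q(1) sum_distrib_left)
      finally show ?thesis by (simp add: q(3))
    qed
    show "Q (grid_pt e1 B i) = 0" if "i \<in> G" for i using FQ[of "(True, i)"] that by (simp add: F_def)
    show "dirder e Q (grid_pt e1 B i) = 0" if "i \<in> G" for i using FQ[of "(False, i)"] that by (simp add: F_def)
  qed
  then have "(\<Sum>l\<in>{l}. \<Sum>\<mu><Nd l. v $ \<mu> * Y l \<mu> z) = 0" if "z \<in> sphere 0 1" for z
    using q(4) that by (simp add: Q_def)
  then have "v $ \<mu> = 0" if "\<mu> < Nd l" for \<mu>
    using harmonic_coeffs_zero[of "{l}" "\<lambda>l \<mu>. v $ \<mu>" l \<mu>] that by simp
  then have "v = 0\<^sub>v (Nd l)" using v(1) by (intro eq_vecI) auto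
  with v show False by simp
qed

text \<open>By the inequality of arithmetic and geometric means, the off-diagonal sum over \<mu> is
  at most the average of the two diagonal ones. Each of these is \<open>Nd l\<close> over the
  surface area, so the series is dominated by the one in \<open>conv\<close>.\<close>

lemma zonal_sum_summable:
  assumes dim: "DIM('a) = d + 1" and d: "d \<ge> 1"
    and conv: "summable (\<lambda>l. \<bar>a l\<bar> * real l ^ (d - 1))"
    and xy: "x \<in> sphere 0 1" "y \<in> sphere 0 1"
  shows "summable (\<lambda>l. \<Sum>\<mu><Nd l. a l * Y l \<mu> x * Y l \<mu> y)"
proof -
  define V where "V = measure sphere_measure (sphere (0::'a) 1)"
  have K: "(\<Sum>\<mu><Nd l. (Y l \<mu> z)\<^sup>2) \<le> Nd l / V" if "z \<in> sphere 0 1" for z l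
  proof (cases "Nd l = 0")
    case False
    then have "V \<noteq> 0" using harmonic_kernel_value[OF that, of l] by (auto simp: V_def)
    then show ?thesis using eq_divide_imp[OF _ harmonic_kernel_value[OF that, of l]] by (simp add: V_def)
  qed simp
  \<comment> \<open>The first 2 comes from \<open>dim_harmonics_le\<close>; the power of 2 is the
    price of replacing \<open>l + 1\<close> by \<open>2 * l\<close> when
    \<open>l \<ge> 1\<close>.\<close>
  define C where "C = 2 * 2 ^ (d - 1) / V"
  have bound: "norm (\<Sum>\<mu><Nd l. a l * Y l \<mu> x * Y l \<mu> y) \<le> C * (\<bar>a l\<bar> * real l ^ (d - 1))" if l: "l \<ge> 1" for l
  proof -
    have "\<bar>\<Sum>\<mu><Nd l. Y l \<mu> x * Y l \<mu> y\<bar> \<le> (\<Sum>\<mu><Nd l. \<bar>Y l \<mu> x * Y l \<mu> y\<bar>)" by (rule sum_abs)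
    also have "\<dots> \<le> (\<Sum>\<mu><Nd l. ((Y l \<mu> x)\<^sup>2 + (Y l \<mu> y)\<^sup>2) / 2)"
    proof (rule sum_mono)
      fix \<mu>
      show "\<bar>Y l \<mu> x * Y l \<mu> y\<bar> \<le> ((Y l \<mu> x)\<^sup>2 + (Y l \<mu> y)\<^sup>2) / 2"
        using sum_squares_bound[of "\<bar>Y l \<mu> x\<bar>" "\<bar>Y l \<mu> y\<bar>"] by (simp add: abs_mult)
    qed
    also have "\<dots> = ((\<Sum>\<mu><Nd l. (Y l \<mu> x)\<^sup>2) + (\<Sum>\<mu><Nd l. (Y l \<mu> y)\<^sup>2)) / 2"
      by (simp add: sum.distrib add_divide_distrib flip: sum_divide_distrib)
    also have "\<dots> \<le> Nd l / V"
    proof -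
      have "(a + b) / 2 \<le> c" if "a \<le> c" "b \<le> c" for a b c :: real using that by simp
      from this[OF K[OF xy(1)] K[OF xy(2)]] show ?thesis .
    qed
    also have "\<dots> \<le> C * real l ^ (d - 1)"
    proof -
      have "Nd l \<le> 2 * (l + 1) ^ (d - 1)" by (rule dim_harmonics_le[OF dim d])
      also have "\<dots> \<le> 2 * (2 * l) ^ (d - 1)" using l by (intro mult_left_mono power_mono) auto
      finally have "real (Nd l) \<le> real (2 * (2 * l) ^ (d - 1))" by (simp only: of_nat_le_iff)
      then have "real (Nd l) / V \<le> real (2 * (2 * l) ^ (d - 1)) / V"
        by (intro divide_right_mono) (auto simp: V_def)
      then show ?thesis by (simp add: C_def power_mult_distrib)
    qed
    finally have "\<bar>a l\<bar> * \<bar>\<Sum>\<mu><Nd l. Y l \<mu> x * Y l \<mu> y\<bar> \<le> \<bar>a l\<bar> * (C * real l ^ (d - 1))"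
      by (rule mult_left_mono) simp
    then show ?thesis by (simp add: mult_ac abs_mult flip: sum_distrib_left)
  qed
  show ?thesis
    by (rule summable_comparison_test'[OF summable_mult[OF conv, of C] bound])
qed

end

section \<open>Fourier coefficients of the kernel and the operator on trial functions\<close>

context
  fixes Y :: "nat \<Rightarrow> nat \<Rightarrow> 'a::euclidean_space \<Rightarrow> real" and Nd :: "nat \<Rightarrow> nat"
    and c :: "nat \<Rightarrow> real" and \<Phi> :: "'a \<Rightarrow> 'a \<Rightarrow> real"
  assumes basis: "harmonic_basis Y Nd" and zonal: "zonal_kernel Y Nd c \<Phi>"
begin

lemma zonal_uniform_limit:
  assumes z: "z \<in> sphere 0 1"
  shows "uniform_limit (sphere 0 1) (\<lambda>n y. \<Sum>l<n. \<Sum>\<mu><Nd l. c l * Y l \<mu> y * Y l \<mu> z) (\<lambda>y. \<Phi> y z) sequentially"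
proof (rule uniform_limitI)
  fix e :: real assume "e > 0"
  then have "\<forall>\<^sub>F n in sequentially. \<forall>p\<in>sphere 0 1 \<times> sphere 0 1.
      dist ((\<lambda>(x, y). \<Sum>l<n. \<Sum>\<mu><Nd l. c l * Y l \<mu> x * Y l \<mu> y) p) ((\<lambda>(x, y). \<Phi> x y) p) < e"
    using zonal unfolding zonal_kernel_def by (intro uniform_limitD) auto
  then show "\<forall>\<^sub>F n in sequentially. \<forall>y\<in>sphere 0 1.
      dist (\<Sum>l<n. \<Sum>\<mu><Nd l. c l * Y l \<mu> y * Y l \<mu> z) (\<Phi> y z) < e"
    by eventually_elim (use z in force)
qed

lemma continuous_kernel:
  assumes z: "z \<in> sphere 0 1"
  shows "continuous_on (sphere 0 1) (\<lambda>y. \<Phi> y z)"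
  by (rule uniform_limit_theorem[OF _ zonal_uniform_limit[OF z]])
     (auto intro!: always_eventually continuous_intros continuous_Y[OF basis])

text \<open>The partial sums have the claimed coefficient as soon as they contain degree
  \<open>l\<close>, and uniform convergence on a space of finite measure lets it pass to the
  limit.\<close>

lemma sphere_inner_kernel:
  assumes z: "z \<in> sphere 0 1" and \<mu>: "\<mu> < Nd l"
  shows "sphere_inner (\<lambda>y. \<Phi> y z) (Y l \<mu>) = c l * Y l \<mu> z"
proof -
  define s where "s = (\<lambda>n y. \<Sum>l<n. \<Sum>\<mu><Nd l. c l * Y l \<mu> y * Y l \<mu> z)"
  note lim = zonal_uniform_limit[OF z, folded s_def]
  have conts: "continuous_on (sphere 0 1) (s n)" for n
    unfolding s_def by (auto intro!: continuous_intros continuous_Y[OF basis])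
  have s_inner: "sphere_inner (s n) (Y l \<mu>) = c l * Y l \<mu> z" if n: "n > l" for n
  proof -
    let ?K = "SIGMA l:{..<n}. {..<Nd l}"
    have "sphere_inner (s n) (Y l \<mu>) =
        (\<Sum>k\<in>?K. (c (fst k) * Y (fst k) (snd k) z) * sphere_inner (Y (fst k) (snd k)) (Y l \<mu>))"
      by (rule sphere_inner_sum_left)
         (auto simp: s_def sum.Sigma case_prod_beta mult_ac intro!: continuous_Y[OF basis] \<mu>)
    also have "\<dots> = (\<Sum>k\<in>?K. if k = (l, \<mu>) then c l * Y l \<mu> z else 0)"
      by (intro sum.cong) (use \<mu> in \<open>auto simp: orthonormal_Y[OF basis] split: if_splits\<close>)
    also have "\<dots> = c l * Y l \<mu> z" using n \<mu> by simp
    finally show ?thesis .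
  qed
  have "\<forall>\<^sub>F n in sequentially. \<forall>y\<in>sphere 0 1. dist (s n y) (\<Phi> y z) < 1"
    by (rule uniform_limitD[OF lim]) simp
  then obtain n0 where n0: "\<And>n y. n \<ge> n0 \<Longrightarrow> y \<in> sphere 0 1 \<Longrightarrow> dist (s n y) (\<Phi> y z) < 1"
    unfolding eventually_sequentially by blast
  \<comment> \<open>Beyond \<open>n0\<close> the partial sums stay within 1 of the limit, which
    yields the dominating function. \<open>Suc l\<close> is needed because the sum up to
    \<open>n\<close> omits degree \<open>n\<close>.\<close>
  define n1 where "n1 = max n0 (Suc l)"
  have "(\<lambda>n. sphere_inner (s (n + n1)) (Y l \<mu>)) \<longlonglongrightarrow> sphere_inner (\<lambda>y. \<Phi> y z) (Y l \<mu>)"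
    unfolding sphere_inner_def
  proof (rule integral_dominated_convergence)
    show "(\<lambda>y. \<Phi> y z * Y l \<mu> y) \<in> borel_measurable sphere_measure"
      "\<And>n. (\<lambda>y. s (n + n1) y * Y l \<mu> y) \<in> borel_measurable sphere_measure"
      using \<mu> z by (auto intro!: borel_measurable_integrable sphere_integrable continuous_on_mult
          continuous_kernel conts continuous_Y[OF basis])
    show "integrable sphere_measure (\<lambda>y. (\<bar>\<Phi> y z\<bar> + 1) * \<bar>Y l \<mu> y\<bar>)"
      using \<mu> z by (auto intro!: sphere_integrable continuous_intros continuous_kernel continuous_Y[OF basis])
    show "AE y in sphere_measure. (\<lambda>n. s (n + n1) y * Y l \<mu> y) \<longlonglongrightarrow> \<Phi> y z * Y l \<mu> y"
    proof (rule AE_I2)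
      fix y :: 'a assume "y \<in> space sphere_measure"
      then have "(\<lambda>n. s n y) \<longlonglongrightarrow> \<Phi> y z" by (intro tendsto_uniform_limitI[OF lim]) simp
      then show "(\<lambda>n. s (n + n1) y * Y l \<mu> y) \<longlonglongrightarrow> \<Phi> y z * Y l \<mu> y"
        by (intro tendsto_mult tendsto_const LIMSEQ_ignore_initial_segment)
    qed
    show "AE y in sphere_measure. norm (s (n + n1) y * Y l \<mu> y) \<le> (\<bar>\<Phi> y z\<bar> + 1) * \<bar>Y l \<mu> y\<bar>" for n
    proof (rule AE_I2)
      fix y :: 'a assume "y \<in> space sphere_measure"
      then have "dist (s (n + n1) y) (\<Phi> y z) < 1" by (intro n0) (auto simp: n1_def)
      then have "\<bar>s (n + n1) y\<bar> \<le> \<bar>\<Phi> y z\<bar> + 1" by (simp add: dist_real_def)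
      then show "norm (s (n + n1) y * Y l \<mu> y) \<le> (\<bar>\<Phi> y z\<bar> + 1) * \<bar>Y l \<mu> y\<bar>"
        by (simp add: abs_mult mult_right_mono)
    qed
  qed
  moreover have "(\<lambda>n. sphere_inner (s (n + n1)) (Y l \<mu>)) = (\<lambda>n. c l * Y l \<mu> z)"
    by (intro ext s_inner) (simp add: n1_def)
  ultimately show ?thesis using LIMSEQ_unique tendsto_const by metis
qed

text \<open>Infinite sums split only when the pieces converge, so linearity of the operator is not
  automatic. The coefficients of \<open>u\<close> are computed first; then the series separates into
  \<open>N\<close> zonal series, convergent by \<open>summ\<close>, and \<open>M\<close> series with
  a single term.\<close>

lemma multiplier_op_trial:
  fixes idx :: "nat \<Rightarrow> nat \<times> nat" and \<alpha> a :: "nat \<Rightarrow> real"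
  assumes idx: "\<And>i. i < M \<Longrightarrow> snd (idx i) < Nd (fst (idx i))"
    and x: "\<And>j. j < N \<Longrightarrow> x j \<in> sphere 0 1" and y: "y \<in> sphere 0 1"
    and summ: "\<And>z. z \<in> sphere 0 1 \<Longrightarrow> summable (\<lambda>l. \<Sum>\<mu><Nd l. (c l * lam l) * Y l \<mu> y * Y l \<mu> z)"
    and u: "\<And>z. z \<in> sphere 0 1 \<Longrightarrow>
      u z = (\<Sum>j<N. \<alpha> j * \<Phi> z (x j)) + (\<Sum>i<M. a i * Y (fst (idx i)) (snd (idx i)) z)"
  shows "multiplier_op Y Nd lam u y = (\<Sum>j<N. \<alpha> j * zonal_sum Y Nd (\<lambda>l. c l * lam l) y (x j))
      + (\<Sum>i<M. a i * lam (fst (idx i)) * Y (fst (idx i)) (snd (idx i)) y)"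
proof -
  let ?Y = "\<lambda>i. Y (fst (idx i)) (snd (idx i))"
  have coeff: "sphere_inner u (Y l \<mu>) = (\<Sum>j<N. \<alpha> j * (c l * Y l \<mu> (x j))) + (\<Sum>i<M. if idx i = (l, \<mu>) then a i else 0)"
    if \<mu>: "\<mu> < Nd l" for l \<mu>
  proof -
    \<comment> \<open>Kernel translates and harmonics are listed as one family, so that one
      application of linearity covers both.\<close>
    have "sphere_inner u (Y l \<mu>) = (\<Sum>k<N+M. (if k < N then \<alpha> k else a (k - N)) *
        sphere_inner (if k < N then (\<lambda>z. \<Phi> z (x k)) else ?Y (k - N)) (Y l \<mu>))"
    proof (rule sphere_inner_sum_left)
      have split: "(\<Sum>k<N+M. g k) = (\<Sum>k<N. g k) + (\<Sum>k<M. g (N + k))" for g :: "nat \<Rightarrow> real"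
        by (induction M) (simp_all add: add.assoc)
      show "u z = (\<Sum>k<N+M. (if k < N then \<alpha> k else a (k - N)) * (if k < N then \<lambda>z. \<Phi> z (x k) else ?Y (k - N)) z)"
        if "z \<in> sphere 0 1" for z
        unfolding split u[OF that] by simp
      show "continuous_on (sphere 0 1) (if k < N then \<lambda>z. \<Phi> z (x k) else ?Y (k - N))" if "k \<in> {..<N+M}" for k
        using that x idx by (auto intro!: continuous_kernel continuous_Y[OF basis])
    qed (rule continuous_Y[OF basis \<mu>])
    also have "\<dots> = (\<Sum>j<N. \<alpha> j * sphere_inner (\<lambda>z. \<Phi> z (x j)) (Y l \<mu>)) + (\<Sum>i<M. a i * sphere_inner (?Y i) (Y l \<mu>))"
      by (induction M) (simp_all add: add.assoc)
    also have "(\<Sum>j<N. \<alpha> j * sphere_inner (\<lambda>z. \<Phi> z (x j)) (Y l \<mu>)) = (\<Sum>j<N. \<alpha> j * (c l * Y l \<mu> (x j)))"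
      using x \<mu> by (intro sum.cong) (auto simp: sphere_inner_kernel)
    also have "(\<Sum>i<M. a i * sphere_inner (?Y i) (Y l \<mu>)) = (\<Sum>i<M. if idx i = (l, \<mu>) then a i else 0)"
      using idx \<mu> by (intro sum.cong) (auto simp: orthonormal_Y[OF basis] prod_eq_iff)
    finally show ?thesis .
  qed
  have expand: "lam l * (\<Sum>\<mu><Nd l. sphere_inner u (Y l \<mu>) * Y l \<mu> y) =
      (\<Sum>j<N. \<alpha> j * (\<Sum>\<mu><Nd l. (c l * lam l) * Y l \<mu> y * Y l \<mu> (x j))) +
      (\<Sum>i<M. if l = fst (idx i) then a i * lam (fst (idx i)) * ?Y i y else 0)" for l
  proof -
    have "(\<Sum>\<mu><Nd l. (\<Sum>i<M. if idx i = (l, \<mu>) then a i else 0) * Y l \<mu> y) =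
        (\<Sum>i<M. \<Sum>\<mu><Nd l. if idx i = (l, \<mu>) then a i * Y l \<mu> y else 0)"
      by (subst sum.swap) (simp add: sum_distrib_right if_distrib[of "\<lambda>t. t * _"] cong: if_cong)
    also have "\<dots> = (\<Sum>i<M. if l = fst (idx i) then a i * ?Y i y else 0)"
    proof (intro sum.cong refl)
      fix i assume "i \<in> {..<M}"
      then have "snd (idx i) < Nd (fst (idx i))" using idx by simp
      moreover have "(\<Sum>\<mu><Nd l. if idx i = (l, \<mu>) then a i * Y l \<mu> y else 0) =
          (\<Sum>\<mu><Nd l. if \<mu> = snd (idx i) then (if l = fst (idx i) then a i * ?Y i y else 0) else 0)"
        by (intro sum.cong) (auto simp: prod_eq_iff)
      ultimately show "(\<Sum>\<mu><Nd l. if idx i = (l, \<mu>) then a i * Y l \<mu> y else 0) =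
          (if l = fst (idx i) then a i * ?Y i y else 0)" by auto
    qed
    finally have second: "(\<Sum>\<mu><Nd l. (\<Sum>i<M. if idx i = (l, \<mu>) then a i else 0) * Y l \<mu> y) = \<dots>" .
    have first: "(\<Sum>\<mu><Nd l. (\<Sum>j<N. \<alpha> j * (c l * Y l \<mu> (x j))) * Y l \<mu> y) =
        (\<Sum>j<N. \<alpha> j * (\<Sum>\<mu><Nd l. c l * Y l \<mu> y * Y l \<mu> (x j)))"
      by (simp add: sum_distrib_right sum_distrib_left mult_ac) (rule sum.swap)
    have "(\<Sum>\<mu><Nd l. sphere_inner u (Y l \<mu>) * Y l \<mu> y) =
        (\<Sum>j<N. \<alpha> j * (\<Sum>\<mu><Nd l. c l * Y l \<mu> y * Y l \<mu> (x j))) + (\<Sum>i<M. if l = fst (idx i) then a i * ?Y i y else 0)"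
      by (simp add: coeff distrib_right sum.distrib first second)
    then show ?thesis
      by (simp add: distrib_left sum_distrib_left mult_ac if_distrib[of "\<lambda>t. lam l * t"] cong: if_cong)
  qed
  have "(\<lambda>l. (\<Sum>j<N. \<alpha> j * (\<Sum>\<mu><Nd l. (c l * lam l) * Y l \<mu> y * Y l \<mu> (x j))) +
      (\<Sum>i<M. if l = fst (idx i) then a i * lam (fst (idx i)) * ?Y i y else 0)) sums
      ((\<Sum>j<N. \<alpha> j * zonal_sum Y Nd (\<lambda>l. c l * lam l) y (x j)) + (\<Sum>i<M. a i * lam (fst (idx i)) * ?Y i y))"
    unfolding zonal_sum_def
    by (intro sums_add sums_sum sums_mult summable_sums summ x sums_single) auto
  then show ?thesis
    unfolding multiplier_op_def expand by (rule sums_unique[symmetric])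
qed

end

section \<open>The differentiation matrix\<close>

lemma four_block_upper_triangular:
  assumes "A \<in> carrier_mat M M" "diagonal_mat A" "D \<in> carrier_mat K K" "diagonal_mat D" "B \<in> carrier_mat M K"
  shows "upper_triangular (four_block_mat A B (0\<^sub>m K M) D)"
  using assms by (auto simp: diagonal_mat_def)

text \<open>Similar matrices share the characteristic polynomial, which for a triangular matrix is a
  product over its diagonal. The root is found over the reals and then carried over to the complex
  polynomial.\<close>

lemma upper_triangular_similar_spectrum:
  fixes V T V' :: "real mat"
  assumes c: "V \<in> carrier_mat n n" "T \<in> carrier_mat n n" "V' \<in> carrier_mat n n"
    and inv: "V * V' = 1\<^sub>m n" and T: "upper_triangular T" and i: "i < n"
  shows "complex_of_real (T $$ (i, i)) \<in> complex_spectrum (V * T * V')"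
proof -
  have D: "V * T * V' \<in> carrier_mat n n" using c by simp
  have "similar_mat_wit (V * T * V') T V V'"
    by (rule similar_mat_witI[OF inv mat_mult_left_right_inverse[OF c(1,3) inv] refl D c(2,1,3)])
  then have "char_poly (V * T * V') = char_poly T"
    by (intro char_poly_similar) (auto simp: similar_mat_def)
  also have "\<dots> = (\<Prod>a\<leftarrow>diag_mat T. [:- a, 1:])"
    by (rule char_poly_upper_triangular[OF c(2) T])
  finally have cp: "char_poly (V * T * V') = \<dots>" .
  have "T $$ (i, i) \<in> set (diag_mat T)" using c i by (auto simp: diag_mat_def)
  then have "poly (char_poly (V * T * V')) (T $$ (i, i)) = 0"
    unfolding cp poly_prod_list prod_list_zero_iff by force
  then have "poly (map_poly complex_of_real (char_poly (V * T * V'))) (complex_of_real (T $$ (i, i))) = 0"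
    by (simp only: of_real_hom.poly_map_poly of_real_0)
  then have "poly (char_poly (map_mat complex_of_real (V * T * V'))) (complex_of_real (T $$ (i, i))) = 0"
    by (simp only: of_real_hom.char_poly_hom[OF D])
  moreover have "map_mat complex_of_real (V * T * V') \<in> carrier_mat n n" using D by simp
  ultimately show ?thesis
    unfolding complex_spectrum_def by (simp only: spectrum_root_char_poly mem_Collect_eq)
qed

context block_decomposition
begin

text \<open>Both halves of the definite description are covered: \<open>all\<close> shows that
  \<open>D\<close> has the required property, while \<open>ex\<close> provides enough trial
  functions to pin down a competitor through \<open>D_unique\<close>.\<close>

lemma differentiation_matrix_eq:
  assumes ex: "\<And>\<beta> a. \<beta> \<in> carrier_vec K \<Longrightarrow> a \<in> carrier_vec M \<Longrightarrow> \<exists>u\<in>TS.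
      restrict_pts n x u = F *\<^sub>v (W *\<^sub>v \<beta>) + P *\<^sub>v a \<and>
      restrict_pts n x (L u) = G *\<^sub>v (W *\<^sub>v \<beta>) + P *\<^sub>v (Lam *\<^sub>v a)"
    and all: "\<And>u. u \<in> TS \<Longrightarrow> \<exists>\<beta> a. \<beta> \<in> carrier_vec K \<and> a \<in> carrier_vec M \<and>
      restrict_pts n x u = F *\<^sub>v (W *\<^sub>v \<beta>) + P *\<^sub>v a \<and>
      restrict_pts n x (L u) = G *\<^sub>v (W *\<^sub>v \<beta>) + P *\<^sub>v (Lam *\<^sub>v a)"
  shows "differentiation_matrix L TS n x = D"
  unfolding differentiation_matrix_def
proof (rule the_equality)
  have D: "D \<in> carrier_mat n n" by (simp add: carrier_mat_iff)
  have FW: "F * W \<in> carrier_mat n K" and GW: "G * W \<in> carrier_mat n K" and PL: "P * Lam \<in> carrier_mat n M"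
    by (simp_all add: carrier_mat_iff)
  have FWv: "F *\<^sub>v (W *\<^sub>v \<beta>) = (F * W) *\<^sub>v \<beta>" "G *\<^sub>v (W *\<^sub>v \<beta>) = (G * W) *\<^sub>v \<beta>"
    if "\<beta> \<in> carrier_vec K" for \<beta>
    using assoc_mult_mat_vec[OF F W that] assoc_mult_mat_vec[OF G W that] by simp_all
  have PLv: "P *\<^sub>v (Lam *\<^sub>v a) = (P * Lam) *\<^sub>v a" if "a \<in> carrier_vec M" for a
    using assoc_mult_mat_vec[OF P Lam that] by simp
  have E_split: "E *\<^sub>v ((F * W) *\<^sub>v \<beta> + P *\<^sub>v a) = (E * (F * W)) *\<^sub>v \<beta> + (E * P) *\<^sub>v a"
    if "E \<in> carrier_mat n n" "\<beta> \<in> carrier_vec K" "a \<in> carrier_vec M" for E \<beta> a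
    using mult_add_distrib_mat_vec[OF that(1) mult_mat_vec_carrier[OF FW that(2)] mult_mat_vec_carrier[OF P that(3)]]
      assoc_mult_mat_vec[OF that(1) FW that(2)] assoc_mult_mat_vec[OF that(1) P that(3)] by simp
  show "D \<in> carrier_mat n n \<and> (\<forall>u\<in>TS. D *\<^sub>v restrict_pts n x u = restrict_pts n x (L u))"
  proof (intro conjI ballI D)
    fix u assume "u \<in> TS"
    then obtain \<beta> a where ba: "\<beta> \<in> carrier_vec K" "a \<in> carrier_vec M"
      and u: "restrict_pts n x u = F *\<^sub>v (W *\<^sub>v \<beta>) + P *\<^sub>v a"
        "restrict_pts n x (L u) = G *\<^sub>v (W *\<^sub>v \<beta>) + P *\<^sub>v (Lam *\<^sub>v a)" using all by blast
    show "D *\<^sub>v restrict_pts n x u = restrict_pts n x (L u)"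
      unfolding u FWv[OF ba(1)] PLv[OF ba(2)] E_split[OF D ba] D_FW D_P ..
  qed
  fix E assume E: "E \<in> carrier_mat n n \<and> (\<forall>u\<in>TS. E *\<^sub>v restrict_pts n x u = restrict_pts n x (L u))"
  then have Ec: "E \<in> carrier_mat n n" by blast
  have eq: "(E * (F * W)) *\<^sub>v \<beta> + (E * P) *\<^sub>v a = (G * W) *\<^sub>v \<beta> + (P * Lam) *\<^sub>v a"
    if ba: "\<beta> \<in> carrier_vec K" "a \<in> carrier_vec M" for \<beta> a
  proof -
    obtain u where "u \<in> TS" "restrict_pts n x u = F *\<^sub>v (W *\<^sub>v \<beta>) + P *\<^sub>v a"
      "restrict_pts n x (L u) = G *\<^sub>v (W *\<^sub>v \<beta>) + P *\<^sub>v (Lam *\<^sub>v a)" using ex[OF ba] by blast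
    then show ?thesis using E E_split[OF Ec ba] FWv[OF ba(1)] PLv[OF ba(2)] by metis
  qed
  have dE[simp]: "dim_row E = n" "dim_col E = n" using Ec by auto
  have zero: "Q *\<^sub>v 0\<^sub>v k = 0\<^sub>v n" if "Q \<in> carrier_mat n k" for Q :: "real mat" and k
    using that by (intro eq_vecI) auto
  have c: "E * (F * W) \<in> carrier_mat n K" "E * P \<in> carrier_mat n M" by (simp_all add: carrier_mat_iff)
  show "E = D"
  proof (rule D_unique[OF Ec])
    \<comment> \<open>Setting one of the two coefficient vectors to zero isolates one condition of
      \<open>D_unique\<close>.\<close>
    show "E * P = P * Lam"
    proof (rule mat_eqI_mult_vec[OF c(2) PL])
      fix v :: "real vec" assume v: "v \<in> carrier_vec M"
      have "E * P *\<^sub>v v \<in> carrier_vec n" "P * Lam *\<^sub>v v \<in> carrier_vec n"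
        using mult_mat_vec_carrier[OF c(2) v] mult_mat_vec_carrier[OF PL v] .
      then show "E * P *\<^sub>v v = P * Lam *\<^sub>v v"
        using eq[of "0\<^sub>v K" v] v zero[OF c(1)] zero[OF GW] by simp
    qed
    show "E * (F * W) = G * W"
    proof (rule mat_eqI_mult_vec[OF c(1) GW])
      fix v :: "real vec" assume v: "v \<in> carrier_vec K"
      have "E * (F * W) *\<^sub>v v \<in> carrier_vec n" "G * W *\<^sub>v v \<in> carrier_vec n"
        using mult_mat_vec_carrier[OF c(1) v] mult_mat_vec_carrier[OF GW v] .
      then show "E * (F * W) *\<^sub>v v = G * W *\<^sub>v v"
        using eq[of v "0\<^sub>v M"] v zero[OF c(2)] zero[OF PL] by simp
    qed
  qed
qed

text \<open>The nearby diagonal entry of \<open>T\<close> is an eigenvalue of \<open>D\<close>, so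
  it bounds the minimum from above; finiteness of the spectrum makes that minimum
  meaningful.\<close>

lemma spectrum_perturbation:
  assumes diag: "diagonal_mat Lam" "diagonal_mat \<Theta>" and Meps: "Meps \<in> carrier_mat n n"
    and \<mu>: "\<mu> \<in> complex_spectrum Meps"
  defines "\<kappa> \<equiv> op_norm V * op_norm (mat_inv V)"
  shows "Min ((\<lambda>z. cmod (\<mu> - z)) ` complex_spectrum D)
           \<le> max (2 * \<kappa> * op_norm (D - Meps)) (sqrt (2 * \<kappa> * op_norm R * op_norm (D - Meps)))"
proof -
  have [simp]: "dim_row Meps = n" "dim_col Meps = n" using Meps by auto
  have c: "V \<in> carrier_mat n n" "V' \<in> carrier_mat n n" "T \<in> carrier_mat n n" "R \<in> carrier_mat M K"
    "D - Meps \<in> carrier_mat n n" "D \<in> carrier_mat n n"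
    by (simp_all add: carrier_mat_iff)
  have D_Meps: "V * T * V' - (D - Meps) = Meps"
    unfolding D_def[symmetric] by (intro eq_matI) auto
  have "eigenvalue (map_mat complex_of_real Meps) \<mu>"
    using \<mu> by (simp add: complex_spectrum_def spectrum_def)
  then obtain y where y: "y \<in> carrier_vec n" "y \<noteq> 0\<^sub>v n" "map_mat complex_of_real Meps *\<^sub>v y = \<mu> \<cdot>\<^sub>v y"
    unfolding eigenvalue_def eigenvector_def using Meps by auto
  have "\<exists>i<n. cmod (\<mu> - of_real (T $$ (i, i)))
      \<le> max (2 * \<kappa> * op_norm (D - Meps)) (sqrt (2 * \<kappa> * op_norm R * op_norm (D - Meps)))"
    unfolding \<kappa>_def mat_inv_V
    by (rule block_triangular_perturbation[OF Lam diag(1) \<Theta> diag(2) c(4) T_def c(1,2) V_V' c(5) n y(1,2)])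
       (simp add: D_Meps y(3))
  then obtain i where i: "i < n" "cmod (\<mu> - of_real (T $$ (i, i)))
      \<le> max (2 * \<kappa> * op_norm (D - Meps)) (sqrt (2 * \<kappa> * op_norm R * op_norm (D - Meps)))" by blast
  have "upper_triangular T"
    unfolding T_def by (rule four_block_upper_triangular[OF Lam diag(1) \<Theta> diag(2) c(4)])
  then have mem: "complex_of_real (T $$ (i, i)) \<in> complex_spectrum D"
    unfolding D_def by (rule upper_triangular_similar_spectrum[OF c(1,3,2) V_V' _ i(1)])
  have "finite (complex_spectrum D)"
    unfolding complex_spectrum_def using c(6) by (intro card_finite_spectrum(1)[of _ n]) simp
  then have "Min ((\<lambda>z. cmod (\<mu> - z)) ` complex_spectrum D) \<le> cmod (\<mu> - of_real (T $$ (i, i)))"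
    using mem by (intro Min_le) auto
  with i(2) show ?thesis by linarith
qed

end

theorem proposition4p3:
  fixes d m N M :: nat
    and Y :: "nat \<Rightarrow> nat \<Rightarrow> 'a::euclidean_space \<Rightarrow> real" and Nd :: "nat \<Rightarrow> nat"
    and \<Phi> :: "'a \<Rightarrow> 'a \<Rightarrow> real" and c lam :: "nat \<Rightarrow> real" and p :: "real \<Rightarrow> real"
    and X :: "'a set" and x :: "nat \<Rightarrow> 'a" and idx :: "nat \<Rightarrow> nat \<times> nat"
    and MX P Pd Lam \<Phi>X KX W A S U \<Theta> Z V R Meps :: "real mat"
    and \<kappa> :: real and \<mu> :: complex
  assumes dim: "DIM('a) = d + 1" and d: "d \<ge> 2" and m: "m \<ge> 1"
    and basis: "harmonic_basis Y Nd"
    and zonal: "zonal_kernel Y Nd c \<Phi>"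
    and cpd: "cond_pos_def (Pi_space Y Nd (m - 1)) \<Phi>"
    and lam: "lam = (\<lambda>l. p (sphere_eigenvalue d l))"
    and growth: "\<exists>k::nat. lam \<in> O(\<lambda>l. real l ^ k)"
    and conv: "summable (\<lambda>l. \<bar>c l * \<bar>lam l\<bar> * real l ^ (d - 1)\<bar>)"
    and X: "X \<subseteq> sphere 0 1" and x: "bij_betw x {..<N} X"
    and unisolv: "unisolvent (Pi_space Y Nd (m - 1)) X"
    and MX: "MX = differentiation_matrix (multiplier_op Y Nd lam)
                    (trial_space (Pi_space Y Nd (m - 1)) \<Phi> N x) N x"
    and idx: "bij_betw idx {..<M} (SIGMA l:{..<m}. {..<Nd l})"
    and P: "P = mat N M (\<lambda>(k, j). Y (fst (idx j)) (snd (idx j)) (x k))"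
    and Pd: "Pd = mat_inv (P\<^sup>T * P) * P\<^sup>T"
    and Lam: "Lam = mat M M (\<lambda>(i, j). if i = j then lam (fst (idx j)) else 0)"
    and \<Phi>X: "\<Phi>X = kernel_mat \<Phi> N x"
    and KX: "KX = kernel_mat (zonal_sum Y Nd (\<lambda>l. c l * lam l)) N x"
    and W: "W \<in> carrier_mat N (N - M)" "W\<^sup>T * W = 1\<^sub>m (N - M)"
           "mat_range W = {v \<in> carrier_vec N. \<forall>w\<in>mat_range P. v \<bullet> w = 0}"
    and A: "A = W * mat_inv (W\<^sup>T * \<Phi>X * W) * W\<^sup>T"
    and S: "sym_pos_def S" "S * S = mat_inv (W\<^sup>T * \<Phi>X * W)"
    and U: "U \<in> carrier_mat (N - M) (N - M)" "U\<^sup>T * U = 1\<^sub>m (N - M)"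
    and \<Theta>: "\<Theta> \<in> carrier_mat (N - M) (N - M)" "diagonal_mat \<Theta>"
    and eig: "S * W\<^sup>T * KX * W * S = U * \<Theta> * U\<^sup>T"
    and Z: "Z = W * mat_inv S * U"
    and V: "V = four_block_mat P Z (0\<^sub>m 0 M) (0\<^sub>m 0 (N - M))"
    and R: "R = (Pd * KX - Lam * Pd * \<Phi>X) * A * Z"
    and \<kappa>: "\<kappa> = op_norm V * op_norm (mat_inv V)"
    and Meps: "Meps \<in> carrier_mat N N"
    and \<mu>: "\<mu> \<in> complex_spectrum Meps"
  shows "Min ((\<lambda>z. cmod (\<mu> - z)) ` complex_spectrum MX)
           \<le> max (2 * \<kappa> * op_norm (MX - Meps))
                 (sqrt (2 * \<kappa> * op_norm R * op_norm (MX - Meps)))"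
proof -
  let ?Q = "Pi_space Y Nd (m - 1)" and ?K = "N - M"
  let ?Y = "\<lambda>j. Y (fst (idx j)) (snd (idx j))"
  define comb where "comb = (\<lambda>a y. \<Sum>j<M. a $ j * ?Y j y)"
  \<comment> \<open>Subtraction is truncated, so this equality relies on \<open>m \<ge> 1\<close>.
    It matches the range of degrees in \<open>Pi_space\<close> with that of
    \<open>idx\<close>.\<close>
  have atMost_m: "{..m - 1} = {..<m}" using m by auto
  have idx_lt: "fst (idx j) < m" "snd (idx j) < Nd (fst (idx j))" if "j < M" for j
    using bij_betw_apply[OF idx, of j] that by auto
  have x_sphere: "x j \<in> sphere 0 1" if "j < N" for j
    using bij_betw_apply[OF x, of j] X that by auto
  have sum_idx: "(\<Sum>l<m. \<Sum>\<mu><Nd l. g (l, \<mu>)) = (\<Sum>j<M. g (idx j))" for g :: "nat \<times> nat \<Rightarrow> real"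
    using sum.reindex_bij_betw[OF idx, of g] by (simp add: sum.Sigma)
  have inv_idx: "inv_into {..<M} idx (idx j) = j" if "j < M" for j
    using bij_betw_inv_into_left[OF idx] that by simp
  have comb_expand: "comb a y = (\<Sum>l<m. \<Sum>\<mu><Nd l. a $ inv_into {..<M} idx (l, \<mu>) * Y l \<mu> y)" for a y
    using sum_idx[of "\<lambda>k. a $ inv_into {..<M} idx k * Y (fst k) (snd k) y"] by (simp add: comb_def inv_idx)
  have comb_Pi: "comb a \<in> ?Q" for a
    unfolding Pi_space_def atMost_m
    by (auto intro!: exI[of _ "\<lambda>l \<mu>. a $ inv_into {..<M} idx (l, \<mu>)"] simp: comb_expand)
  have Pi_comb: "\<exists>a\<in>carrier_vec M. \<forall>y\<in>sphere 0 1. q y = comb a y" if "q \<in> ?Q" for q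
  proof -
    obtain b where b: "\<And>y. y \<in> sphere 0 1 \<Longrightarrow> q y = (\<Sum>l<m. \<Sum>\<mu><Nd l. b l \<mu> * Y l \<mu> y)"
      using \<open>q \<in> ?Q\<close> unfolding Pi_space_def atMost_m by blast
    have "q y = comb (vec M (\<lambda>j. b (fst (idx j)) (snd (idx j)))) y" if "y \<in> sphere 0 1" for y
      using b[OF that] sum_idx[of "\<lambda>k. b (fst k) (snd k) * Y (fst k) (snd k) y"] by (simp add: comb_def)
    then show ?thesis by (intro bexI[of _ "vec M (\<lambda>j. b (fst (idx j)) (snd (idx j)))"]) auto
  qed
  have Pc: "P \<in> carrier_mat N M" and Fc: "\<Phi>X \<in> carrier_mat N N" and Gc: "KX \<in> carrier_mat N N"
    and Lc: "Lam \<in> carrier_mat M M"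
    by (simp_all add: P \<Phi>X KX Lam kernel_mat_def)
  have P_comb: "(P *\<^sub>v a) $ k = comb a (x k)" if "a \<in> carrier_vec M" "k < N" for a k
    using that by (simp add: P comb_def scalar_prod_def lessThan_atLeast0 mult.commute)
  \<comment> \<open>A kernel vector is the coefficient vector of a polynomial vanishing on
    \<open>X\<close>, hence on the whole sphere by unisolvence; independence of the harmonics makes
    it zero.\<close>
  have P_inj: "v = 0\<^sub>v M" if v: "v \<in> carrier_vec M" "P *\<^sub>v v = 0\<^sub>v N" for v
  proof -
    have "comb v z = 0" if z: "z \<in> X" for z
    proof -
      obtain k where "k < N" "z = x k" using bij_betw_imp_surj_on[OF x] z by blast
      then show ?thesis using P_comb[OF v(1), of k] v(2) by simp
    qed
    then have "comb v y = 0" if "y \<in> sphere 0 1" for y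
      using unisolv comb_Pi that unfolding unisolvent_def by blast
    note vanish = this[unfolded comb_expand]
    have zero: "v $ inv_into {..<M} idx (l, \<mu>) = 0" if lm: "l < m" "\<mu> < Nd l" for l \<mu>
      by (rule harmonic_coeffs_zero[OF basis, of "{..<m}" "\<lambda>l \<mu>. v $ inv_into {..<M} idx (l, \<mu>)"])
         (use vanish lm in simp_all)
    have "v $ j = 0" if "j < M" for j
      using zero[OF idx_lt[OF that]] by (simp add: inv_idx that)
    then show ?thesis using v by (intro eq_vecI) auto
  qed
  \<comment> \<open>Only with this does the truncated \<open>N - M\<close> satisfy
    \<open>N = M + (N - M)\<close>.\<close>
  have MN: "M \<le> N"
  proof (rule ccontr)
    assume "\<not> M \<le> N"
    then obtain v where "v \<in> carrier_vec M" "v \<noteq> 0\<^sub>v M" "P *\<^sub>v v = 0\<^sub>v N"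
      using wide_matrix_kernel[OF Pc] by auto
    then show False using P_inj by blast
  qed
  \<comment> \<open>The moment conditions express orthogonality to the range of \<open>P\<close>, so
    the columns of \<open>W\<close> parametrise the admissible kernel coefficients.\<close>
  have moment: "moment_space ?Q N x = mat_range W"
  proof -
    have eq: "(\<Sum>j<N. \<alpha> $ j * comb a (x j)) = \<alpha> \<bullet> (P *\<^sub>v a)" if "\<alpha> \<in> carrier_vec N" "a \<in> carrier_vec M" for \<alpha> a
      using that Pc P_comb by (simp add: scalar_prod_def[of \<alpha>] lessThan_atLeast0)
    have "(\<forall>q\<in>?Q. (\<Sum>j<N. \<alpha> $ j * q (x j)) = 0) \<longleftrightarrow> (\<forall>w\<in>mat_range P. \<alpha> \<bullet> w = 0)" if \<alpha>: "\<alpha> \<in> carrier_vec N" for \<alpha>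
    proof
      assume "\<forall>q\<in>?Q. (\<Sum>j<N. \<alpha> $ j * q (x j)) = 0"
      then show "\<forall>w\<in>mat_range P. \<alpha> \<bullet> w = 0"
        using comb_Pi eq[OF \<alpha>] Pc by (auto simp: mat_range_def)
    next
      assume orth: "\<forall>w\<in>mat_range P. \<alpha> \<bullet> w = 0"
      show "\<forall>q\<in>?Q. (\<Sum>j<N. \<alpha> $ j * q (x j)) = 0"
      proof
        fix q assume "q \<in> ?Q"
        then obtain a where a: "a \<in> carrier_vec M" "\<And>y. y \<in> sphere 0 1 \<Longrightarrow> q y = comb a y" using Pi_comb by blast
        have "(\<Sum>j<N. \<alpha> $ j * q (x j)) = \<alpha> \<bullet> (P *\<^sub>v a)"
          unfolding eq[OF \<alpha> a(1), symmetric] using a(2) x_sphere by (intro sum.cong) auto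
        also have "\<dots> = 0" using orth a(1) Pc by (auto simp: mat_range_def)
        finally show "(\<Sum>j<N. \<alpha> $ j * q (x j)) = 0" .
      qed
    qed
    then show ?thesis unfolding W(3) moment_space_def by blast
  qed
  have range_W: "W *\<^sub>v \<beta> \<in> moment_space ?Q N x" if "\<beta> \<in> carrier_vec ?K" for \<beta>
    unfolding moment mat_range_def using that W(1) by auto
  have WP: "W\<^sup>T * P = 0\<^sub>m ?K M"
  proof (rule mat_eqI_mult_vec[of _ ?K M])
    fix a :: "real vec" assume a: "a \<in> carrier_vec M"
    have Pa: "P *\<^sub>v a \<in> carrier_vec N" using mult_mat_vec_carrier[OF Pc a] .
    have "(W\<^sup>T *\<^sub>v (P *\<^sub>v a)) $ i = 0" if i: "i < ?K" for i
    proof -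
      have "W *\<^sub>v unit_vec ?K i \<in> mat_range W" using W(1) by (auto simp: mat_range_def)
      moreover have "P *\<^sub>v a \<in> mat_range P" using a Pc by (auto simp: mat_range_def)
      ultimately have "(W *\<^sub>v unit_vec ?K i) \<bullet> (P *\<^sub>v a) = 0" unfolding W(3) by blast
      moreover have "W *\<^sub>v unit_vec ?K i = col W i"
        using W(1) i by (intro eq_vecI) (auto simp: scalar_prod_right_unit)
      ultimately show ?thesis using W(1) i by simp
    qed
    then have "W\<^sup>T *\<^sub>v (P *\<^sub>v a) = 0\<^sub>v ?K" using W(1) by (intro eq_vecI) auto
    moreover have "(0\<^sub>m ?K M :: real mat) *\<^sub>v a = 0\<^sub>v ?K" using a by (intro eq_vecI) auto
    ultimately show "(W\<^sup>T * P) *\<^sub>v a = 0\<^sub>m ?K M *\<^sub>v a"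
      using assoc_mult_mat_vec[of "W\<^sup>T" ?K N P M a] W(1) Pc a by simp
  qed (use W(1) Pc in auto)
  \<comment> \<open>The quadratic form at \<open>v\<close> is that of \<open>\<Phi>X\<close> at the
    moment vector \<open>W *\<^sub>v v\<close>. Conditional positive definiteness makes this vector
    zero, and orthonormality of the columns of \<open>W\<close> then gives
    \<open>v = 0\<close>.\<close>
  have B_inj: "v = 0\<^sub>v ?K" if v: "v \<in> carrier_vec ?K" "(W\<^sup>T * \<Phi>X * W) *\<^sub>v v = 0\<^sub>v ?K" for v
  proof -
    define \<alpha> where "\<alpha> = W *\<^sub>v v"
    have \<alpha>: "\<alpha> \<in> carrier_vec N" "\<Phi>X *\<^sub>v \<alpha> \<in> carrier_vec N"
      using mult_mat_vec_carrier[OF W(1) v(1)] mult_mat_vec_carrier[OF Fc] by (auto simp: \<alpha>_def)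
    have WT: "W\<^sup>T \<in> carrier_mat ?K N" using W(1) by simp
    have "W\<^sup>T *\<^sub>v (\<Phi>X *\<^sub>v \<alpha>) = (W\<^sup>T * \<Phi>X * W) *\<^sub>v v"
      using assoc_mult_mat_vec[OF mult_carrier_mat[OF WT Fc] W(1) v(1)] assoc_mult_mat_vec[OF WT Fc \<alpha>(1)]
      by (simp add: \<alpha>_def)
    then have "v \<bullet> (W\<^sup>T *\<^sub>v (\<Phi>X *\<^sub>v \<alpha>)) = 0" using v by simp
    moreover have "v \<bullet> (W\<^sup>T *\<^sub>v (\<Phi>X *\<^sub>v \<alpha>)) = \<alpha> \<bullet> (\<Phi>X *\<^sub>v \<alpha>)"
      using transpose_vec_mult_scalar[OF W(1) v(1) \<alpha>(2)] comm_scalar_prod[OF \<alpha>]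
        comm_scalar_prod[OF v(1) mult_mat_vec_carrier[OF WT \<alpha>(2)]] comm_scalar_prod[OF \<alpha>(2,1)]
      by (simp add: \<alpha>_def)
    ultimately have zero: "\<alpha> \<bullet> (\<Phi>X *\<^sub>v \<alpha>) = 0" by simp
    have inj: "inj_on x {..<N}" "x ` {..<N} \<subseteq> sphere 0 1" using x X by (simp_all add: bij_betw_def)
    have "\<alpha> \<noteq> 0\<^sub>v N \<longrightarrow> \<alpha> \<bullet> (kernel_mat \<Phi> N x *\<^sub>v \<alpha>) > 0"
      using cpd inj range_W[OF v(1)] unfolding cond_pos_def_def \<alpha>_def by blast
    then have "\<alpha> = 0\<^sub>v N" using zero by (auto simp: \<Phi>X)
    then have "W\<^sup>T *\<^sub>v (W *\<^sub>v v) = 0\<^sub>v ?K" using WT by (intro eq_vecI) (auto simp: \<alpha>_def)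
    then show ?thesis using assoc_mult_mat_vec[OF WT W(1) v(1)] W(2) v(1) by simp
  qed
  have Bc: "W\<^sup>T * \<Phi>X * W \<in> carrier_mat ?K ?K" using W(1) Fc by (intro mult_carrier_mat[of _ _ N]) auto
  \<comment> \<open>Positive definiteness of \<open>S\<close> does not fix its size; the dimensions
    are read off from \<open>S * S\<close>.\<close>
  have Sc: "S \<in> carrier_mat ?K ?K"
  proof -
    have "S * S \<in> carrier_mat ?K ?K" using injective_mat_inverse(1)[OF Bc B_inj] S(2) by simp
    from carrier_matD[OF this] show ?thesis by (intro carrier_matI) simp_all
  qed
  have S_inj: "v = 0\<^sub>v ?K" if "v \<in> carrier_vec ?K" "S *\<^sub>v v = 0\<^sub>v ?K" for v
  proof (rule ccontr)
    assume "v \<noteq> 0\<^sub>v ?K"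
    then have "v \<bullet> (S *\<^sub>v v) > 0" using S(1) Sc that(1) by (auto simp: sym_pos_def_def)
    then show False using that by simp
  qed
  interpret bd: block_decomposition N M ?K P W \<Phi>X KX S U \<Theta> Lam
    by unfold_locales (use MN Pc W Fc Gc Sc U \<Theta> Lc P_inj WP B_inj S_inj S(2) eig in auto)
  have bd_eqs: "bd.Z = Z" "bd.V = V" "bd.R = R"
    by (simp_all add: bd.Z_def bd.V_def bd.R_def bd.Pd_def bd.A_def bd.B_def Z V R Pd A)
  \<comment> \<open>The common core of both premises of \<open>differentiation_matrix_eq\<close>,
    for arbitrary kernel coefficients; the moment conditions come in only afterwards.\<close>
  have action: "restrict_pts N x u = \<Phi>X *\<^sub>v \<alpha> + P *\<^sub>v a \<and>
      restrict_pts N x (multiplier_op Y Nd lam u) = KX *\<^sub>v \<alpha> + P *\<^sub>v (Lam *\<^sub>v a)"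
    if \<alpha>: "\<alpha> \<in> carrier_vec N" and a: "a \<in> carrier_vec M"
      and u: "\<And>y. y \<in> sphere 0 1 \<Longrightarrow> u y = (\<Sum>j<N. \<alpha> $ j * \<Phi> y (x j)) + comb a y" for u \<alpha> a
  proof
    have La: "(Lam *\<^sub>v a) $ j = lam (fst (idx j)) * a $ j" if "j < M" for j
    proof -
      have "(Lam *\<^sub>v a) $ j = (\<Sum>i<M. (if j = i then lam (fst (idx i)) else 0) * a $ i)"
        using that a by (simp add: Lam scalar_prod_def lessThan_atLeast0)
      also have "\<dots> = (\<Sum>i<M. if i = j then lam (fst (idx j)) * a $ j else 0)"
        by (intro sum.cong) auto
      finally show "(Lam *\<^sub>v a) $ j = lam (fst (idx j)) * a $ j" using that by simp
    qed
    show "restrict_pts N x u = \<Phi>X *\<^sub>v \<alpha> + P *\<^sub>v a"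
    proof (rule eq_vecI)
      fix k assume "k < dim_vec (\<Phi>X *\<^sub>v \<alpha> + P *\<^sub>v a)"
      then have k: "k < N" using Pc by simp
      have "(\<Phi>X *\<^sub>v \<alpha>) $ k = (\<Sum>j<N. \<alpha> $ j * \<Phi> (x k) (x j))"
        using k \<alpha> by (simp add: \<Phi>X kernel_mat_def scalar_prod_def lessThan_atLeast0 mult.commute)
      then show "restrict_pts N x u $ k = (\<Phi>X *\<^sub>v \<alpha> + P *\<^sub>v a) $ k"
        using k u[OF x_sphere[OF k]] P_comb[OF a k] Pc by (simp add: restrict_pts_def)
    qed (use Pc in \<open>simp add: restrict_pts_def\<close>)
    show "restrict_pts N x (multiplier_op Y Nd lam u) = KX *\<^sub>v \<alpha> + P *\<^sub>v (Lam *\<^sub>v a)"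
    proof (rule eq_vecI)
      fix k assume "k < dim_vec (KX *\<^sub>v \<alpha> + P *\<^sub>v (Lam *\<^sub>v a))"
      then have k: "k < N" using Pc by simp
      \<comment> \<open>Here \<open>conv\<close> enters: its weight \<open>real l ^ (d - 1)\<close>
        matches the growth of the dimensions, so the series of the differentiated kernel converges
        at every pair of points of the sphere.\<close>
      have summ: "summable (\<lambda>l. \<Sum>\<mu><Nd l. (c l * lam l) * Y l \<mu> (x k) * Y l \<mu> z)" if "z \<in> sphere 0 1" for z
        using d conv x_sphere[OF k] that
        by (intro zonal_sum_summable[OF basis dim]) (simp_all add: abs_mult)
      have "multiplier_op Y Nd lam u (x k) =
          (\<Sum>j<N. \<alpha> $ j * zonal_sum Y Nd (\<lambda>l. c l * lam l) (x k) (x j)) +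
          (\<Sum>i<M. a $ i * lam (fst (idx i)) * ?Y i (x k))"
        by (rule multiplier_op_trial[OF basis zonal])
           (use idx_lt x_sphere k u summ in \<open>auto simp: comb_def\<close>)
      also have "(\<Sum>j<N. \<alpha> $ j * zonal_sum Y Nd (\<lambda>l. c l * lam l) (x k) (x j)) = (KX *\<^sub>v \<alpha>) $ k"
        using k \<alpha> by (simp add: KX kernel_mat_def scalar_prod_def lessThan_atLeast0 mult.commute)
      also have "(\<Sum>i<M. a $ i * lam (fst (idx i)) * ?Y i (x k)) = comb (Lam *\<^sub>v a) (x k)"
        unfolding comb_def by (intro sum.cong) (simp_all add: La del: index_mult_mat_vec)
      also have "\<dots> = (P *\<^sub>v (Lam *\<^sub>v a)) $ k"
        using P_comb[OF mult_mat_vec_carrier[OF Lc a] k] by simp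
      finally show "restrict_pts N x (multiplier_op Y Nd lam u) $ k = (KX *\<^sub>v \<alpha> + P *\<^sub>v (Lam *\<^sub>v a)) $ k"
        using k Pc by (simp add: restrict_pts_def)
    qed (use Pc in \<open>simp add: restrict_pts_def\<close>)
  qed
  have MX_eq: "MX = bd.D"
    unfolding MX
  proof (rule bd.differentiation_matrix_eq)
    fix \<beta> a :: "real vec" assume ba: "\<beta> \<in> carrier_vec ?K" "a \<in> carrier_vec M"
    let ?u = "\<lambda>y. (\<Sum>j<N. (W *\<^sub>v \<beta>) $ j * \<Phi> y (x j)) + comb a y"
    have "?u \<in> trial_space ?Q \<Phi> N x"
      unfolding trial_space_def using range_W[OF ba(1)] comb_Pi[of a] by blast
    then show "\<exists>u\<in>trial_space ?Q \<Phi> N x. restrict_pts N x u = \<Phi>X *\<^sub>v (W *\<^sub>v \<beta>) + P *\<^sub>v a \<and>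
        restrict_pts N x (multiplier_op Y Nd lam u) = KX *\<^sub>v (W *\<^sub>v \<beta>) + P *\<^sub>v (Lam *\<^sub>v a)"
      using action[OF mult_mat_vec_carrier[OF W(1) ba(1)] ba(2), of ?u] by blast
  next
    fix u assume "u \<in> trial_space ?Q \<Phi> N x"
    then obtain \<alpha> q where \<alpha>: "\<alpha> \<in> moment_space ?Q N x" and q: "q \<in> ?Q"
      and u: "\<And>y. y \<in> sphere 0 1 \<Longrightarrow> u y = (\<Sum>j<N. \<alpha> $ j * \<Phi> y (x j)) + q y"
      unfolding trial_space_def by blast
    obtain \<beta> where \<beta>: "\<beta> \<in> carrier_vec ?K" "\<alpha> = W *\<^sub>v \<beta>"
      using \<alpha> W(1) unfolding moment mat_range_def by auto
    obtain a where a: "a \<in> carrier_vec M" "\<And>y. y \<in> sphere 0 1 \<Longrightarrow> q y = comb a y" using Pi_comb[OF q] by blast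
    have "\<alpha> \<in> carrier_vec N" using \<alpha> by (simp add: moment_space_def)
    from action[OF this a(1), of u] u a(2)
    show "\<exists>\<beta> a. \<beta> \<in> carrier_vec ?K \<and> a \<in> carrier_vec M \<and>
        restrict_pts N x u = \<Phi>X *\<^sub>v (W *\<^sub>v \<beta>) + P *\<^sub>v a \<and>
        restrict_pts N x (multiplier_op Y Nd lam u) = KX *\<^sub>v (W *\<^sub>v \<beta>) + P *\<^sub>v (Lam *\<^sub>v a)"
      using \<beta> a(1) by metis
  qed
  have "diagonal_mat Lam" by (auto simp: Lam diagonal_mat_def)
  from bd.spectrum_perturbation[OF this \<Theta>(2) Meps \<mu>] show ?thesis
    unfolding bd_eqs MX_eq \<kappa> .
qed

end
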